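(* Let $A$ be a QF ring and $\mathcal{C}$ a non-zero $A$-coring such that ${}_A\mathcal{C}$ is flat and $\mathcal{C}^{\ast}$ is right Noetherian. Then $$\mathrm{Prad}(\mathcal{C}^{\ast})=\mathrm{CPcorad}(\mathcal{C}^{r})^{\bot(\mathcal{C}^{\ast})}\quad\text{and}\quad \mathrm{CPcorad}(\mathcal{C}^{r})=\mathrm{Prad}(\mathcal{C}^{\ast})^{\bot(\mathcal{C})}.$$
   Context: $R$ is a commutative ring with $1\neq 0$ and $A$ is a unital $R$-algebra; QF means quasi-Frobenius. An $A$-coring is a coalgebra $(\mathcal{C},\Delta,\varepsilon)$ in the monoidal category of $(A,A)$-bimodules. $\mathcal{C}^r$ denotes $\mathcal{C}$ as a right $\mathcal{C}$-comodule via $\Delta$; $\mathrm{End}^{\mathcal{C}}(\mathcal{C})$ is the set of its right $\mathcal{C}$-colinear endomorphisms. $\mathcal{C}^{\ast}=\mathrm{Hom}_{-A}(\mathcal{C},A)$ (right $A$-linear maps) is a ring with product $(f\ast^r g)(c)=\sum g(f(c_1)c_2)$ and unit $\varepsilon$; one has $\mathcal{C}^{\ast}\simeq\mathrm{End}^{\mathcal{C}}(\mathcal{C})^{op}$ via $f\mapsto[c\mapsto\sum f(c_1)c_2]$. $\mathrm{Prad}$ denotes the prime radical (intersection of all prime ideals). For $K\subseteq\mathcal{C}$, $I\subseteq\mathcal{C}^{\ast}$ put $K^{\bot(\mathcal{C}^{\ast})}=\{f\in\mathcal{C}^{\ast}: f(K)=0\}$ and $I^{\bot(\mathcal{C})}=\{c\in\mathcal{C}: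 f(c)=0\ \forall f\in I\}$. A right subcomodule $X\subseteq\mathcal{C}^r$ is fully invariant if $f(X)\subseteq X$ for all $f\in\mathrm{End}^{\mathcal{C}}(\mathcal{C})$. For right subcomodules $X,Y\subseteq\mathcal{C}$ let $(X:_{\mathcal{C}^r}Y)=\bigcap\{f^{-1}(Y): f\in\mathrm{End}^{\mathcal{C}}(\mathcal{C}),\ f(X)=0\}$. A non-zero fully invariant right subcomodule $B\subseteq\mathcal{C}^r$ is fully $\mathcal{C}$-coprime if for all fully invariant right subcomodules $X,Y\subseteq\mathcal{C}^r$ with $B\subseteq(X:_{\mathcal{C}^r}Y)$ one has $B\subseteq X$ or $B\subseteq Y$. The fully coprime coradical $\mathrm{CPcorad}(\mathcal{C}^r)$ is the sum of all fully $\mathcal{C}$-coprime $B\subseteq\mathcal{C}^r$. *)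

theory Defs
  imports "HOL-Algebra.Module" "HOL-Algebra.Ideal_Product" "HOL-Algebra.Free_Abelian_Groups"
begin

section \<open>Modules over a noncommutative ring\<close>

text \<open>The library's \<open>module\<close> and \<open>algebra\<close> ask for commutative rings, so left modules are
  redone here over an arbitrary ring. A right \<open>A\<close>-module is encoded as a left module over the
  opposite ring: if \<open>M\<close> is a right module, \<open>a \<odot>\<^bsub>M\<^esub> x\<close> stands for \<open>x a\<close>.\<close>

definition opp_ring :: "('a, 'm) ring_scheme \<Rightarrow> 'a ring" where
  "opp_ring A = \<lparr>carrier = carrier A, monoid.mult = (\<lambda>x y. y \<otimes>\<^bsub>A\<^esub> x), monoid.one = \<one>\<^bsub>A\<^esub>,
     ring.zero = \<zero>\<^bsub>A\<^esub>, ring.add = ring.add A\<rparr>"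

locale left_module = A?: ring A + M?: abelian_group M
  for A (structure) and M :: "('a, 'b, 'm) module_scheme" (structure) +
  assumes smult_closed: "\<lbrakk>a \<in> carrier A; x \<in> carrier M\<rbrakk> \<Longrightarrow> a \<odot>\<^bsub>M\<^esub> x \<in> carrier M"
    and smult_l_distr: "\<lbrakk>a \<in> carrier A; b \<in> carrier A; x \<in> carrier M\<rbrakk>
      \<Longrightarrow> (a \<oplus>\<^bsub>A\<^esub> b) \<odot>\<^bsub>M\<^esub> x = a \<odot>\<^bsub>M\<^esub> x \<oplus>\<^bsub>M\<^esub> b \<odot>\<^bsub>M\<^esub> x"
    and smult_r_distr: "\<lbrakk>a \<in> carrier A; x \<in> carrier M; y \<in> carrier M\<rbrakk>
      \<Longrightarrow> a \<odot>\<^bsub>M\<^esub> (x \<oplus>\<^bsub>M\<^esub> y) = a \<odot>\<^bsub>M\<^esub> x \<oplus>\<^bsub>M\<^esub> a \<odot>\<^bsub>M\<^esub> y"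
    and smult_assoc: "\<lbrakk>a \<in> carrier A; b \<in> carrier A; x \<in> carrier M\<rbrakk>
      \<Longrightarrow> (a \<otimes>\<^bsub>A\<^esub> b) \<odot>\<^bsub>M\<^esub> x = a \<odot>\<^bsub>M\<^esub> (b \<odot>\<^bsub>M\<^esub> x)"
    and smult_one: "x \<in> carrier M \<Longrightarrow> \<one>\<^bsub>A\<^esub> \<odot>\<^bsub>M\<^esub> x = x"

abbreviation right_module :: "('a, 'n) ring_scheme \<Rightarrow> ('a, 'b, 'm) module_scheme \<Rightarrow> bool" where
  "right_module A M \<equiv> left_module (opp_ring A) M"

text \<open>Maps are made extensional (\<open>undefined\<close> off the carrier) so that equality of maps is
  equality on the carrier.\<close>

definition mod_hom ::
    "('a, 'k) ring_scheme \<Rightarrow> ('a, 'b, 'm) module_scheme \<Rightarrow> ('a, 'c, 'n) module_scheme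
      \<Rightarrow> ('b \<Rightarrow> 'c) set" where
  "mod_hom A M N = {f \<in> carrier M \<rightarrow>\<^sub>E carrier N.
     (\<forall>x\<in>carrier M. \<forall>y\<in>carrier M. f (x \<oplus>\<^bsub>M\<^esub> y) = f x \<oplus>\<^bsub>N\<^esub> f y) \<and>
     (\<forall>a\<in>carrier A. \<forall>x\<in>carrier M. f (a \<odot>\<^bsub>M\<^esub> x) = a \<odot>\<^bsub>N\<^esub> f x)}"

abbreviation right_mod_hom ::
    "('a, 'k) ring_scheme \<Rightarrow> ('a, 'b, 'm) module_scheme \<Rightarrow> ('a, 'c, 'n) module_scheme
      \<Rightarrow> ('b \<Rightarrow> 'c) set" where
  "right_mod_hom A M N \<equiv> mod_hom (opp_ring A) M N"

definition regular_module :: "('a, 'k) ring_scheme \<Rightarrow> ('a, 'a) module" where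
  "regular_module A = \<lparr>carrier = carrier A, monoid.mult = monoid.mult A, monoid.one = \<one>\<^bsub>A\<^esub>,
     ring.zero = \<zero>\<^bsub>A\<^esub>, ring.add = ring.add A, smult = monoid.mult A\<rparr>"

text \<open>With the encoding above, \<open>A\<close> as a right module over itself.\<close>

abbreviation right_regular_module :: "('a, 'k) ring_scheme \<Rightarrow> ('a, 'a) module" where
  "right_regular_module A \<equiv> regular_module (opp_ring A)"


section \<open>Quasi-Frobenius rings\<close>

text \<open>One-sided counterpart of the library's \<open>noetherian_ring\<close>: every left ideal is finitely
  generated.\<close>

definition left_noetherian :: "('a, 'k) ring_scheme \<Rightarrow> bool" where
  "left_noetherian A \<longleftrightarrow> ring A \<and>
     (\<forall>I. submodule I A (regular_module A) \<longrightarrow>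
       (\<exists>F \<subseteq> carrier A. finite F \<and> I = \<Inter>{J. submodule J A (regular_module A) \<and> F \<subseteq> J}))"

definition right_noetherian :: "('a, 'k) ring_scheme \<Rightarrow> bool" where
  "right_noetherian A \<longleftrightarrow> left_noetherian (opp_ring A)"

text \<open>Injectivity and flatness quantify over all modules, which HOL can only do over a fixed
  carrier type. The type below contains an isomorphic copy of every countably generated
  \<open>A\<close>-module (a quotient of a free module of countable rank). This loses nothing:
  by Baer's criterion injectivity is detected on inclusions of one-sided ideals into \<open>A\<close>, and
  an element of the kernel of \<open>X \<otimes> C \<rightarrow> Y \<otimes> C\<close> involves only finitely many elements of
  \<open>X\<close> and \<open>Y\<close>, so flatness is detected on finitely generated modules.\<close>

type_synonym 'a test = "(nat \<Rightarrow> 'a) set"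

definition injective_module :: "('a, 'k) ring_scheme \<Rightarrow> ('a, 'b, 'm) module_scheme \<Rightarrow> bool" where
  "injective_module A M \<longleftrightarrow> left_module A M \<and>
     (\<forall>(X :: ('a, 'a test) module) (Y :: ('a, 'a test) module) i f.
        left_module A X \<and> left_module A Y \<and>
        i \<in> mod_hom A X Y \<and> inj_on i (carrier X) \<and> f \<in> mod_hom A X M
        \<longrightarrow> (\<exists>g\<in>mod_hom A Y M. \<forall>x\<in>carrier X. g (i x) = f x))"

definition qf_ring :: "('a, 'k) ring_scheme \<Rightarrow> bool" where
  "qf_ring A \<longleftrightarrow> left_noetherian A \<and> right_noetherian A \<and>
     injective_module A (regular_module A) \<and>
     injective_module (opp_ring A) (right_regular_module A)"


section \<open>Tensor products over a noncommutative ring\<close>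

text \<open>\<open>M\<close> is a right and \<open>N\<close> a left \<open>A\<close>-module; \<open>M \<otimes>\<^bsub>A\<^esub> N\<close> is the quotient of the free
  abelian group on \<open>M \<times> N\<close> by the balanced relations, presented additively. The ring fields
  \<open>mult\<close> and \<open>one\<close> carry no meaning.\<close>

type_synonym ('b, 'c) tens = "(('b \<times> 'c) \<Rightarrow>\<^sub>0 int) set"

definition tensor_relators ::
    "('a, 'k) ring_scheme \<Rightarrow> ('a, 'b, 'm) module_scheme \<Rightarrow> ('a, 'c, 'n) module_scheme
      \<Rightarrow> ('b, 'c) tens" where
  "tensor_relators A M N =
     {frag_of (x \<oplus>\<^bsub>M\<^esub> y, n) - frag_of (x, n) - frag_of (y, n) | x y n.
        x \<in> carrier M \<and> y \<in> carrier M \<and> n \<in> carrier N} \<union>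
     {frag_of (m, x \<oplus>\<^bsub>N\<^esub> y) - frag_of (m, x) - frag_of (m, y) | m x y.
        m \<in> carrier M \<and> x \<in> carrier N \<and> y \<in> carrier N} \<union>
     {frag_of (a \<odot>\<^bsub>M\<^esub> m, n) - frag_of (m, a \<odot>\<^bsub>N\<^esub> n) | a m n.
        a \<in> carrier A \<and> m \<in> carrier M \<and> n \<in> carrier N}"

definition tensor_kernel ::
    "('a, 'k) ring_scheme \<Rightarrow> ('a, 'b, 'm) module_scheme \<Rightarrow> ('a, 'c, 'n) module_scheme
      \<Rightarrow> ('b, 'c) tens" where
  "tensor_kernel A M N =
     generate (free_Abelian_group (carrier M \<times> carrier N)) (tensor_relators A M N)"

definition tensor ::
    "('a, 'k) ring_scheme \<Rightarrow> ('a, 'b, 'm) module_scheme \<Rightarrow> ('a, 'c, 'n) module_scheme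
      \<Rightarrow> ('b, 'c) tens ring" where
  "tensor A M N =
     (let Q = free_Abelian_group (carrier M \<times> carrier N) Mod tensor_kernel A M N
      in \<lparr>carrier = carrier Q, monoid.mult = undefined, monoid.one = undefined,
          ring.zero = \<one>\<^bsub>Q\<^esub>, ring.add = monoid.mult Q\<rparr>)"

definition tens ::
    "('a, 'k) ring_scheme \<Rightarrow> ('a, 'b, 'm) module_scheme \<Rightarrow> ('a, 'c, 'n) module_scheme
      \<Rightarrow> 'b \<Rightarrow> 'c \<Rightarrow> ('b, 'c) tens" where
  "tens A M N m n =
     tensor_kernel A M N #>\<^bsub>free_Abelian_group (carrier M \<times> carrier N)\<^esub> frag_of (m, n)"

text \<open>The additive map \<open>M \<otimes>\<^bsub>A\<^esub> N \<rightarrow> G\<close> induced by an \<open>A\<close>-balanced biadditive \<open>\<beta>\<close>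
  (it exists and is unique for such \<open>\<beta>\<close>).\<close>

definition tensor_lift ::
    "('a, 'k) ring_scheme \<Rightarrow> ('a, 'b, 'm) module_scheme \<Rightarrow> ('a, 'c, 'n) module_scheme
      \<Rightarrow> ('g, 'l) ring_scheme \<Rightarrow> ('b \<Rightarrow> 'c \<Rightarrow> 'g) \<Rightarrow> ('b, 'c) tens \<Rightarrow> 'g" where
  "tensor_lift A M N G \<beta> =
     (THE h. h \<in> carrier (tensor A M N) \<rightarrow>\<^sub>E carrier G \<and>
        (\<forall>s\<in>carrier (tensor A M N). \<forall>t\<in>carrier (tensor A M N).
           h (s \<oplus>\<^bsub>tensor A M N\<^esub> t) = h s \<oplus>\<^bsub>G\<^esub> h t) \<and>
        (\<forall>m\<in>carrier M. \<forall>n\<in>carrier N. h (tens A M N m n) = \<beta> m n))"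

definition tensor_map ::
    "('a, 'k) ring_scheme \<Rightarrow> ('a, 'b, 'm) module_scheme \<Rightarrow> ('a, 'c, 'n) module_scheme
      \<Rightarrow> ('a, 'd, 'o) module_scheme \<Rightarrow> ('a, 'e, 'p) module_scheme
      \<Rightarrow> ('b \<Rightarrow> 'd) \<Rightarrow> ('c \<Rightarrow> 'e) \<Rightarrow> ('b, 'c) tens \<Rightarrow> ('d, 'e) tens" where
  "tensor_map A M N M' N' f g =
     tensor_lift A M N (tensor A M' N') (\<lambda>m n. tens A M' N' (f m) (g n))"

definition flat_left_module ::
    "('a, 'k) ring_scheme \<Rightarrow> ('a, 'c, 'm) module_scheme \<Rightarrow> bool" where
  "flat_left_module A N \<longleftrightarrow> left_module A N \<and>
     (\<forall>(X :: ('a, 'a test) module) (Y :: ('a, 'a test) module) i.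
        right_module A X \<and> right_module A Y \<and>
        i \<in> right_mod_hom A X Y \<and> inj_on i (carrier X)
        \<longrightarrow> inj_on (tensor_map A X N Y N i (\<lambda>n. n)) (carrier (tensor A X N)))"


section \<open>Bimodules\<close>

record ('a, 'c) bimodule = "('a, 'c) module" +
  rsmult :: "'c \<Rightarrow> 'a \<Rightarrow> 'c"

text \<open>A bimodule is itself a left module; \<open>rmod\<close> extracts its right module structure.\<close>

definition rmod :: "('a, 'c, 'm) bimodule_scheme \<Rightarrow> ('a, 'c) module" where
  "rmod C = \<lparr>carrier = carrier C, monoid.mult = monoid.mult C, monoid.one = \<one>\<^bsub>C\<^esub>,
     ring.zero = \<zero>\<^bsub>C\<^esub>, ring.add = ring.add C, smult = (\<lambda>a c. rsmult C c a)\<rparr>"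

text \<open>\<open>A\<close> is a unital, not necessarily commutative, algebra over the commutative ring \<open>R\<close>.\<close>

locale unital_algebra = module R A + ring A
  for R (structure) and A (structure) +
  assumes smult_mult: "\<lbrakk>r \<in> carrier R; a \<in> carrier A; b \<in> carrier A\<rbrakk>
      \<Longrightarrow> (r \<odot>\<^bsub>A\<^esub> a) \<otimes>\<^bsub>A\<^esub> b = r \<odot>\<^bsub>A\<^esub> (a \<otimes>\<^bsub>A\<^esub> b)"
    and mult_smult: "\<lbrakk>r \<in> carrier R; a \<in> carrier A; b \<in> carrier A\<rbrakk>
      \<Longrightarrow> a \<otimes>\<^bsub>A\<^esub> (r \<odot>\<^bsub>A\<^esub> b) = r \<odot>\<^bsub>A\<^esub> (a \<otimes>\<^bsub>A\<^esub> b)"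

text \<open>\<open>(A, A)\<close>-bimodules over the \<open>R\<close>-algebra \<open>A\<close>: the two induced \<open>R\<close>-actions agree.\<close>

locale bimodule = unital_algebra R A + L: left_module A C + Rt: left_module "opp_ring A" "rmod C"
  for R (structure) and A (structure) and C :: "('a, 'c, 'm) bimodule_scheme" (structure) +
  assumes bimodule_assoc: "\<lbrakk>a \<in> carrier A; c \<in> carrier C; b \<in> carrier A\<rbrakk>
      \<Longrightarrow> rsmult C (a \<odot>\<^bsub>C\<^esub> c) b = a \<odot>\<^bsub>C\<^esub> rsmult C c b"
    and central: "\<lbrakk>r \<in> carrier R; c \<in> carrier C\<rbrakk>
      \<Longrightarrow> (r \<odot>\<^bsub>A\<^esub> \<one>\<^bsub>A\<^esub>) \<odot>\<^bsub>C\<^esub> c = rsmult C c (r \<odot>\<^bsub>A\<^esub> \<one>\<^bsub>A\<^esub>)"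

definition regular_bimodule :: "('a, 'k) ring_scheme \<Rightarrow> ('a, 'a) bimodule" where
  "regular_bimodule A = \<lparr>carrier = carrier A, monoid.mult = monoid.mult A, monoid.one = \<one>\<^bsub>A\<^esub>,
     ring.zero = \<zero>\<^bsub>A\<^esub>, ring.add = ring.add A, smult = monoid.mult A, rsmult = monoid.mult A\<rparr>"

definition bimod_hom ::
    "('a, 'k) ring_scheme \<Rightarrow> ('a, 'b, 'm) bimodule_scheme \<Rightarrow> ('a, 'c, 'n) bimodule_scheme
      \<Rightarrow> ('b \<Rightarrow> 'c) set" where
  "bimod_hom A C D = mod_hom A C D \<inter> right_mod_hom A (rmod C) (rmod D)"

text \<open>\<open>M \<otimes>\<^bsub>A\<^esub> C\<close> as a right module, for a right module \<open>M\<close> and a bimodule \<open>C\<close>, and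
  \<open>C \<otimes>\<^bsub>A\<^esub> D\<close> as a bimodule, for bimodules \<open>C\<close> and \<open>D\<close>.\<close>

definition right_tensor ::
    "('a, 'k) ring_scheme \<Rightarrow> ('a, 'b, 'm) module_scheme \<Rightarrow> ('a, 'c, 'n) bimodule_scheme
      \<Rightarrow> ('a, ('b, 'c) tens) module" where
  "right_tensor A M C = \<lparr>carrier = carrier (tensor A M C), monoid.mult = undefined,
     monoid.one = undefined, ring.zero = \<zero>\<^bsub>tensor A M C\<^esub>, ring.add = ring.add (tensor A M C),
     smult = (\<lambda>a. tensor_lift A M C (tensor A M C) (\<lambda>m c. tens A M C m (rsmult C c a)))\<rparr>"

definition bimod_tensor ::
    "('a, 'k) ring_scheme \<Rightarrow> ('a, 'b, 'm) bimodule_scheme \<Rightarrow> ('a, 'c, 'n) bimodule_scheme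
      \<Rightarrow> ('a, ('b, 'c) tens) bimodule" where
  "bimod_tensor A C D =
     (let T = tensor A (rmod C) D
      in \<lparr>carrier = carrier T, monoid.mult = undefined, monoid.one = undefined,
          ring.zero = \<zero>\<^bsub>T\<^esub>, ring.add = ring.add T,
          smult = (\<lambda>a. tensor_lift A (rmod C) D T (\<lambda>c d. tens A (rmod C) D (a \<odot>\<^bsub>C\<^esub> c) d)),
          rsmult = (\<lambda>t a. a \<odot>\<^bsub>right_tensor A (rmod C) D\<^esub> t)\<rparr>)"

text \<open>The canonical map \<open>(M \<otimes> C) \<otimes> D \<rightarrow> M \<otimes> (C \<otimes> D)\<close>.\<close>

definition tensor_assoc ::
    "('a, 'k) ring_scheme \<Rightarrow> ('a, 'b, 'm) module_scheme \<Rightarrow> ('a, 'c, 'n) bimodule_scheme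
      \<Rightarrow> ('a, 'd, 'o) bimodule_scheme \<Rightarrow> (('b, 'c) tens, 'd) tens \<Rightarrow> ('b, ('c, 'd) tens) tens" where
  "tensor_assoc A M C D =
     (let T = tensor A M (bimod_tensor A C D)
      in tensor_lift A (right_tensor A M C) D T
           (\<lambda>t d. tensor_lift A M C T
              (\<lambda>m c. tens A M (bimod_tensor A C D) m (tens A (rmod C) D c d)) t))"


section \<open>Corings, comodules and subcomodules\<close>

record ('a, 'c) coring = "('a, 'c) bimodule" +
  comult :: "'c \<Rightarrow> ('c, 'c) tens"
  counit :: "'c \<Rightarrow> 'a"

locale coring = bimodule R A C
  for R (structure) and A (structure) and C :: "('a, 'c, 'm) coring_scheme" (structure) +
  assumes comult_hom: "comult C \<in> bimod_hom A C (bimod_tensor A C C)"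
    and counit_hom: "counit C \<in> bimod_hom A C (regular_bimodule A)"
    and coassoc: "c \<in> carrier C \<Longrightarrow>
      tensor_assoc A (rmod C) C C
        (tensor_map A (rmod C) C (right_tensor A (rmod C) C) C (comult C) (\<lambda>y. y) (comult C c))
      = tensor_map A (rmod C) C (rmod C) (bimod_tensor A C C) (\<lambda>x. x) (comult C) (comult C c)"
    and left_counit: "c \<in> carrier C \<Longrightarrow>
      tensor_lift A (rmod C) C C (\<lambda>x y. counit C x \<odot>\<^bsub>C\<^esub> y) (comult C c) = c"
    and right_counit: "c \<in> carrier C \<Longrightarrow>
      tensor_lift A (rmod C) C C (\<lambda>x y. rsmult C x (counit C y)) (comult C c) = c"

text \<open>\<open>M\<close> is a right \<open>A\<close>-module with coaction \<open>\<rho> : M \<rightarrow> M \<otimes>\<^bsub>A\<^esub> C\<close>.\<close>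

definition right_comodule ::
    "('a, 'k) ring_scheme \<Rightarrow> ('a, 'c, 'm) coring_scheme \<Rightarrow> ('a, 'b, 'n) module_scheme
      \<Rightarrow> ('b \<Rightarrow> ('b, 'c) tens) \<Rightarrow> bool" where
  "right_comodule A C M \<rho> \<longleftrightarrow> right_module A M \<and>
     \<rho> \<in> right_mod_hom A M (right_tensor A M C) \<and>
     (\<forall>m\<in>carrier M.
        tensor_assoc A M C C (tensor_map A M C (right_tensor A M C) C \<rho> (\<lambda>c. c) (\<rho> m))
        = tensor_map A M C M (bimod_tensor A C C) (\<lambda>x. x) (comult C) (\<rho> m)) \<and>
     (\<forall>m\<in>carrier M. tensor_lift A M C M (\<lambda>x c. counit C c \<odot>\<^bsub>M\<^esub> x) (\<rho> m) = m)"

definition comod_hom ::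
    "('a, 'k) ring_scheme \<Rightarrow> ('a, 'c, 'm) coring_scheme
      \<Rightarrow> ('a, 'b, 'n) module_scheme \<Rightarrow> ('b \<Rightarrow> ('b, 'c) tens)
      \<Rightarrow> ('a, 'd, 'o) module_scheme \<Rightarrow> ('d \<Rightarrow> ('d, 'c) tens) \<Rightarrow> ('b \<Rightarrow> 'd) set" where
  "comod_hom A C M \<rho> N \<sigma> = {f \<in> right_mod_hom A M N.
     \<forall>m\<in>carrier M. \<sigma> (f m) = tensor_map A M C N C f (\<lambda>c. c) (\<rho> m)}"

definition comod_End :: "('a, 'k) ring_scheme \<Rightarrow> ('a, 'c, 'm) coring_scheme \<Rightarrow> ('c \<Rightarrow> 'c) set" where
  "comod_End A C = comod_hom A C (rmod C) (comult C) (rmod C) (comult C)"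

text \<open>A right subcomodule of \<open>C\<^sup>r\<close>: a right submodule with some right coaction for which the
  inclusion is colinear.\<close>

definition right_subcomodule ::
    "('a, 'k) ring_scheme \<Rightarrow> ('a, 'c, 'm) coring_scheme \<Rightarrow> 'c set \<Rightarrow> bool" where
  "right_subcomodule A C X \<longleftrightarrow> submodule X (opp_ring A) (rmod C) \<and>
     (\<exists>\<rho>. right_comodule A C (rmod C\<lparr>carrier := X\<rparr>) \<rho> \<and>
          (\<lambda>x\<in>X. x) \<in> comod_hom A C (rmod C\<lparr>carrier := X\<rparr>) \<rho> (rmod C) (comult C))"

definition fully_invariant ::
    "('a, 'k) ring_scheme \<Rightarrow> ('a, 'c, 'm) coring_scheme \<Rightarrow> 'c set \<Rightarrow> bool" where
  "fully_invariant A C X \<longleftrightarrow> right_subcomodule A C X \<and> (\<forall>f\<in>comod_End A C. f ` X \<subseteq> X)"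

definition subcomodule_colon ::
    "('a, 'k) ring_scheme \<Rightarrow> ('a, 'c, 'm) coring_scheme \<Rightarrow> 'c set \<Rightarrow> 'c set \<Rightarrow> 'c set" where
  "subcomodule_colon A C X Y =
     \<Inter>{{c \<in> carrier C. f c \<in> Y} | f. f \<in> comod_End A C \<and> f ` X \<subseteq> {\<zero>\<^bsub>C\<^esub>}}"

definition fully_coprime ::
    "('a, 'k) ring_scheme \<Rightarrow> ('a, 'c, 'm) coring_scheme \<Rightarrow> 'c set \<Rightarrow> bool" where
  "fully_coprime A C B \<longleftrightarrow> fully_invariant A C B \<and> B \<noteq> {\<zero>\<^bsub>C\<^esub>} \<and>
     (\<forall>X Y. fully_invariant A C X \<and> fully_invariant A C Y \<and> B \<subseteq> subcomodule_colon A C X Y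
        \<longrightarrow> B \<subseteq> X \<or> B \<subseteq> Y)"

text \<open>The sum of a family of subgroups is the additive subgroup generated by its union.\<close>

definition CPcorad :: "('a, 'k) ring_scheme \<Rightarrow> ('a, 'c, 'm) coring_scheme \<Rightarrow> 'c set" where
  "CPcorad A C = generate (add_monoid C) (\<Union>{B. fully_coprime A C B})"


section \<open>The dual ring and the prime radical\<close>

definition dual_ring ::
    "('a, 'k) ring_scheme \<Rightarrow> ('a, 'c, 'm) coring_scheme \<Rightarrow> ('c \<Rightarrow> 'a) ring" where
  "dual_ring A C =
     \<lparr>carrier = right_mod_hom A (rmod C) (right_regular_module A),
      monoid.mult = (\<lambda>f g. \<lambda>c\<in>carrier C.
        tensor_lift A (rmod C) C A (\<lambda>x y. g (f x \<odot>\<^bsub>C\<^esub> y)) (comult C c)),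
      monoid.one = counit C,
      ring.zero = (\<lambda>c\<in>carrier C. \<zero>\<^bsub>A\<^esub>),
      ring.add = (\<lambda>f g. \<lambda>c\<in>carrier C. f c \<oplus>\<^bsub>A\<^esub> g c)\<rparr>"

definition perp_dual ::
    "('a, 'k) ring_scheme \<Rightarrow> ('a, 'c, 'm) coring_scheme \<Rightarrow> 'c set \<Rightarrow> ('c \<Rightarrow> 'a) set" where
  "perp_dual A C K = {f \<in> carrier (dual_ring A C). \<forall>c\<in>K. f c = \<zero>\<^bsub>A\<^esub>}"

definition perp_coring ::
    "('a, 'k) ring_scheme \<Rightarrow> ('a, 'c, 'm) coring_scheme \<Rightarrow> ('c \<Rightarrow> 'a) set \<Rightarrow> 'c set" where
  "perp_coring A C I = {c \<in> carrier C. \<forall>f\<in>I. f c = \<zero>\<^bsub>A\<^esub>}"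

text \<open>The library's \<open>primeideal\<close> is the commutative (elementwise) notion; here ideals are
  two-sided and primeness is tested on products of ideals.\<close>

definition prime_ideal :: "('a, 'k) ring_scheme \<Rightarrow> 'a set \<Rightarrow> bool" where
  "prime_ideal S P \<longleftrightarrow> ideal P S \<and> P \<noteq> carrier S \<and>
     (\<forall>I J. ideal I S \<and> ideal J S \<and> I \<cdot>\<^bsub>S\<^esub> J \<subseteq> P \<longrightarrow> I \<subseteq> P \<or> J \<subseteq> P)"

definition Prad :: "('a, 'k) ring_scheme \<Rightarrow> 'a set" where
  "Prad S = carrier S \<inter> \<Inter>{P. prime_ideal S P}"

end

theory Submission
  imports Defs
begin

text \<open>Each \<open>f\<close> in the dual ring \<open>S\<close> gives a right colinear endomorphism \<open>\<phi> f\<close> of \<open>C\<close>, sending \<open>c\<close> to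
  \<open>f(c\<^sub>1) c\<^sub>2\<close>, and every such endomorphism arises this way. Since \<open>A\<close> is an injective cogenerator
  as a right module over itself, functionals separate points from right submodules of \<open>C\<close>, so \<open>X\<close> is
  recovered from \<open>X\<^sup>\<bottom>\<close>. Conversely an ideal \<open>I\<close> of \<open>S\<close> is finitely generated on the right, so \<open>I\<^sup>\<bottom>\<close> is a
  common kernel of finitely many \<open>\<phi> f\<close>; flatness makes it a subcomodule, and injectivity of \<open>A\<close> gives
  \<open>I\<^sup>\<bottom>\<^sup>\<bottom> = I\<close>. Under this inclusion-reversing bijection between fully invariant subcomodules and
  ideals, \<open>(X : Y)\<close> corresponds to the product of ideals, hence fully coprime subcomodules to prime
  ideals, and a sum of subcomodules to the intersection of their ideals.\<close>

section \<open>Modules and additive maps\<close>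

text \<open>Injectivity and flatness are assumed only for test modules of one fixed type, while
  \<open>C\<close>, its submodules and their tensor products have other carriers. Hence injectivity
  is rebuilt from one-sided ideals of \<open>A\<close> by Zorn's lemma, and flatness from finitely
  generated submodules, copied into the test type. The definition of a QF ring does not mention
  cogenerators: left self-injectivity produces nonzero left annihilators of proper right ideals, and
  right self-injectivity then extends the functionals built from them. A subcomodule has to carry a
  coassociative coaction of its own. This is compared inside C \<otimes> (C \<otimes> C), so C
  \<otimes> C must be flat too, which is obtained through associativity of the tensor product.
  Finite generation of ideals matters because tensoring with a flat module preserves finite
  intersections of kernels, not arbitrary ones in general. The product satisfies (fg)(c) = g(\<phi>
  f c), so \<phi> reverses multiplication; this fixes the order of the two annihilators in the
  product attached to (X : Y).\<close>

lemma opp_ring_simps [simp]: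
  "carrier (opp_ring A) = carrier A" "x \<otimes>\<^bsub>opp_ring A\<^esub> y = y \<otimes>\<^bsub>A\<^esub> x" "\<one>\<^bsub>opp_ring A\<^esub> = \<one>\<^bsub>A\<^esub>"
  "\<zero>\<^bsub>opp_ring A\<^esub> = \<zero>\<^bsub>A\<^esub>" "x \<oplus>\<^bsub>opp_ring A\<^esub> y = x \<oplus>\<^bsub>A\<^esub> y"
  by (simp_all add: opp_ring_def)

lemma opp_opp_ring [simp]: "opp_ring (opp_ring S) = (S :: 'a ring)"
  by (simp add: opp_ring_def)

lemma (in abelian_group) minus_eq_zero_iff:
  assumes "x \<in> carrier G" "y \<in> carrier G"
  shows "x \<ominus> y = \<zero> \<longleftrightarrow> x = y"
proof
  assume *: "x \<ominus> y = \<zero>"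
  have "x = (x \<ominus> y) \<oplus> y" using assms by (simp add: a_minus_def a_assoc l_neg)
  then show "x = y" using * assms by simp
qed (use assms in \<open>simp add: a_minus_def r_neg\<close>)

lemma ring_opp_ring:
  fixes A (structure)
  assumes "ring A" shows "ring (opp_ring A)"
proof -
  interpret ring A by fact
  have "abelian_group (opp_ring A)"
    by (rule abelian_groupI) (auto simp: a_ac intro: l_neg bexI[of _ "\<ominus> _"])
  then show ?thesis
    by (intro ringI monoidI) (auto simp: m_assoc l_distr r_distr)
qed

lemma abelian_group_carrier_update:
  fixes G (structure)
  assumes "abelian_group G" "subgroup X (add_monoid G)"
  shows "abelian_group (G\<lparr>carrier := X\<rparr>)"
proof -
  interpret abelian_group G by fact
  interpret subgroup X "add_monoid G" by fact
  have [simp, intro]: "x \<in> X \<Longrightarrow> x \<in> carrier G" for x using subset by auto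
  show ?thesis
    using m_closed one_closed m_inv_closed
    by (intro abelian_groupI) (auto simp: a_ac a_inv_def[symmetric] intro: r_neg)
qed

text \<open>Additive maps without the extensionality demanded by \<open>mod_hom\<close>, so that
  composites and pointwise sums can be written as plain abstractions and still belong to the set.
  Identities between such maps are tested on the carrier only.\<close>

definition add_hom :: "('a, 'k) ring_scheme \<Rightarrow> ('b, 'l) ring_scheme \<Rightarrow> ('a \<Rightarrow> 'b) set" where
  "add_hom G H = {h \<in> carrier G \<rightarrow> carrier H.
     \<forall>x\<in>carrier G. \<forall>y\<in>carrier G. h (x \<oplus>\<^bsub>G\<^esub> y) = h x \<oplus>\<^bsub>H\<^esub> h y}"

lemma add_homI:
  assumes "\<And>x. x \<in> carrier G \<Longrightarrow> h x \<in> carrier H"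
    and "\<And>x y. x \<in> carrier G \<Longrightarrow> y \<in> carrier G \<Longrightarrow> h (x \<oplus>\<^bsub>G\<^esub> y) = h x \<oplus>\<^bsub>H\<^esub> h y"
  shows "h \<in> add_hom G H"
  using assms by (auto simp: add_hom_def)

lemma add_hom_closed: "h \<in> add_hom G H \<Longrightarrow> x \<in> carrier G \<Longrightarrow> h x \<in> carrier H"
  by (auto simp: add_hom_def)

lemma add_hom_add:
  "h \<in> add_hom G H \<Longrightarrow> x \<in> carrier G \<Longrightarrow> y \<in> carrier G \<Longrightarrow> h (x \<oplus>\<^bsub>G\<^esub> y) = h x \<oplus>\<^bsub>H\<^esub> h y"
  by (auto simp: add_hom_def)

lemma add_hom_zero:
  assumes "h \<in> add_hom G H" "abelian_group G" "abelian_group H"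
  shows "h \<zero>\<^bsub>G\<^esub> = \<zero>\<^bsub>H\<^esub>"
proof -
  interpret G: abelian_group G by fact
  interpret H: abelian_group H by fact
  have "h \<zero>\<^bsub>G\<^esub> \<oplus>\<^bsub>H\<^esub> h \<zero>\<^bsub>G\<^esub> = h \<zero>\<^bsub>G\<^esub> \<oplus>\<^bsub>H\<^esub> \<zero>\<^bsub>H\<^esub>"
    using add_hom_add[OF assms(1), of "\<zero>\<^bsub>G\<^esub>" "\<zero>\<^bsub>G\<^esub>"] add_hom_closed[OF assms(1)] by simp
  then show ?thesis
    using add_hom_closed[OF assms(1)] by (metis G.zero_closed H.add.l_cancel_one H.r_zero)
qed

lemma add_hom_minus:
  assumes "h \<in> add_hom G H" "abelian_group G" "abelian_group H" "x \<in> carrier G"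
  shows "h (\<ominus>\<^bsub>G\<^esub> x) = \<ominus>\<^bsub>H\<^esub> h x"
proof -
  interpret G: abelian_group G by fact
  interpret H: abelian_group H by fact
  have "h (\<ominus>\<^bsub>G\<^esub> x) \<oplus>\<^bsub>H\<^esub> h x = \<zero>\<^bsub>H\<^esub>"
    using add_hom_add[OF assms(1), of "\<ominus>\<^bsub>G\<^esub> x" x] add_hom_zero[OF assms(1-3)] assms(4)
    by (simp add: G.l_neg)
  then show ?thesis
    using H.minus_equality[of "h (\<ominus>\<^bsub>G\<^esub> x)" "h x"] add_hom_closed[OF assms(1)] assms(4) by simp
qed

lemma add_hom_diff:
  assumes "h \<in> add_hom G H" "abelian_group G" "abelian_group H" "x \<in> carrier G" "y \<in> carrier G"
  shows "h (x \<ominus>\<^bsub>G\<^esub> y) = h x \<ominus>\<^bsub>H\<^esub> h y"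
proof -
  interpret G: abelian_group G by fact
  show ?thesis
    using assms by (simp add: a_minus_def add_hom_add add_hom_minus)
qed

lemma add_hom_compose:
  "f \<in> add_hom G H \<Longrightarrow> g \<in> add_hom H K \<Longrightarrow> (\<lambda>x. g (f x)) \<in> add_hom G K"
  by (auto simp: add_hom_def Pi_iff)

lemma add_hom_inj_iff:
  assumes "h \<in> add_hom G H" "abelian_group G" "abelian_group H"
  shows "inj_on h (carrier G) \<longleftrightarrow> (\<forall>x\<in>carrier G. h x = \<zero>\<^bsub>H\<^esub> \<longrightarrow> x = \<zero>\<^bsub>G\<^esub>)"
proof -
  interpret G: abelian_group G by fact
  interpret H: abelian_group H by fact
  have "x = y" if "\<forall>x\<in>carrier G. h x = \<zero>\<^bsub>H\<^esub> \<longrightarrow> x = \<zero>\<^bsub>G\<^esub>" "x \<in> carrier G" "y \<in> carrier G" "h x = h y" for x y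
  proof -
    have "h (x \<ominus>\<^bsub>G\<^esub> y) = \<zero>\<^bsub>H\<^esub>"
      using add_hom_diff[OF assms that(2,3)] that add_hom_closed[OF assms(1)] by (simp add: H.r_neg a_minus_def)
    then have "x \<ominus>\<^bsub>G\<^esub> y = \<zero>\<^bsub>G\<^esub>" using that by simp
    then show ?thesis
      using that(2,3) by (metis G.minus_eq_zero_iff)
  qed
  then show ?thesis
    using add_hom_zero[OF assms] by (metis inj_onI inj_onD G.zero_closed)
qed

section \<open>Linear maps between modules\<close>

lemma mod_homI:
  assumes "\<And>x. x \<in> carrier M \<Longrightarrow> f x \<in> carrier N" "\<And>x. x \<notin> carrier M \<Longrightarrow> f x = undefined"
    and "\<And>x y. x \<in> carrier M \<Longrightarrow> y \<in> carrier M \<Longrightarrow> f (x \<oplus>\<^bsub>M\<^esub> y) = f x \<oplus>\<^bsub>N\<^esub> f y"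
    and "\<And>a x. a \<in> carrier A \<Longrightarrow> x \<in> carrier M \<Longrightarrow> f (a \<odot>\<^bsub>M\<^esub> x) = a \<odot>\<^bsub>N\<^esub> f x"
  shows "f \<in> mod_hom A M N"
  using assms by (auto simp: mod_hom_def PiE_def extensional_def)

lemma mod_hom_add_hom: "f \<in> mod_hom A M N \<Longrightarrow> f \<in> add_hom M N"
  by (auto simp: mod_hom_def add_hom_def)

lemma mod_hom_closed: "f \<in> mod_hom A M N \<Longrightarrow> x \<in> carrier M \<Longrightarrow> f x \<in> carrier N"
  by (auto simp: mod_hom_def)

lemma mod_hom_add:
  "f \<in> mod_hom A M N \<Longrightarrow> x \<in> carrier M \<Longrightarrow> y \<in> carrier M \<Longrightarrow> f (x \<oplus>\<^bsub>M\<^esub> y) = f x \<oplus>\<^bsub>N\<^esub> f y"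
  by (auto simp: mod_hom_def)

lemma mod_hom_smult:
  "f \<in> mod_hom A M N \<Longrightarrow> a \<in> carrier A \<Longrightarrow> x \<in> carrier M \<Longrightarrow> f (a \<odot>\<^bsub>M\<^esub> x) = a \<odot>\<^bsub>N\<^esub> f x"
  by (auto simp: mod_hom_def)

lemma mod_hom_undefined: "f \<in> mod_hom A M N \<Longrightarrow> x \<notin> carrier M \<Longrightarrow> f x = undefined"
  by (auto simp: mod_hom_def)

lemma mod_hom_eqI:
  assumes "f \<in> mod_hom A M N" "g \<in> mod_hom A M N" "\<And>x. x \<in> carrier M \<Longrightarrow> f x = g x"
  shows "f = g"
  using assms by (metis ext mod_hom_undefined)

lemma mod_hom_compose:
  assumes "left_module A M" "f \<in> mod_hom A M N" "g \<in> mod_hom A N P"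
  shows "(\<lambda>x\<in>carrier M. g (f x)) \<in> mod_hom A M P"
proof -
  interpret M: left_module A M by fact
  show ?thesis
    by (intro mod_homI) (auto simp: M.smult_closed mod_hom_add[OF assms(2)] mod_hom_add[OF assms(3)]
      mod_hom_smult[OF assms(2)] mod_hom_smult[OF assms(3)] mod_hom_closed[OF assms(2)] mod_hom_closed[OF assms(3)])
qed

lemma left_module_abelian: "left_module A M \<Longrightarrow> abelian_group M"
  by (simp add: left_module_def)

lemma left_module_ring: "left_module A M \<Longrightarrow> ring A"
  by (simp add: left_module_def)

lemma mod_hom_zero:
  "f \<in> mod_hom A M N \<Longrightarrow> left_module A M \<Longrightarrow> left_module A N \<Longrightarrow> f \<zero>\<^bsub>M\<^esub> = \<zero>\<^bsub>N\<^esub>"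
  by (meson add_hom_zero left_module_abelian mod_hom_add_hom)

context left_module
begin

lemma smult_right_add_hom: "a \<in> carrier A \<Longrightarrow> (\<lambda>x. a \<odot>\<^bsub>M\<^esub> x) \<in> add_hom M M"
  by (intro add_homI) (auto simp: smult_closed smult_r_distr)

lemma smult_left_add_hom: "x \<in> carrier M \<Longrightarrow> (\<lambda>a. a \<odot>\<^bsub>M\<^esub> x) \<in> add_hom A M"
  by (intro add_homI) (auto simp: smult_closed smult_l_distr)

end

lemma smult_zero_right:
  fixes M (structure)
  shows "left_module A M \<Longrightarrow> a \<in> carrier A \<Longrightarrow> a \<odot> \<zero> = \<zero>"
  by (rule add_hom_zero[OF left_module.smult_right_add_hom left_module_abelian left_module_abelian])

lemma smult_zero_left:
  fixes M (structure)
  shows "left_module A M \<Longrightarrow> x \<in> carrier M \<Longrightarrow> \<zero>\<^bsub>A\<^esub> \<odot> x = \<zero>"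
  by (rule add_hom_zero[OF left_module.smult_left_add_hom ring.is_abelian_group[OF left_module_ring] left_module_abelian])

lemma smult_minus_right:
  fixes M (structure)
  shows "left_module A M \<Longrightarrow> a \<in> carrier A \<Longrightarrow> x \<in> carrier M \<Longrightarrow> a \<odot> (\<ominus> x) = \<ominus> (a \<odot> x)"
  by (rule add_hom_minus[OF left_module.smult_right_add_hom left_module_abelian left_module_abelian])

lemma smult_minus_left:
  fixes M (structure)
  shows "left_module A M \<Longrightarrow> a \<in> carrier A \<Longrightarrow> x \<in> carrier M \<Longrightarrow> (\<ominus>\<^bsub>A\<^esub> a) \<odot> x = \<ominus> (a \<odot> x)"
  by (rule add_hom_minus[OF left_module.smult_left_add_hom ring.is_abelian_group[OF left_module_ring] left_module_abelian])

section \<open>Submodules, kernels, images and preimages\<close>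

lemma submoduleD:
  fixes M (structure)
  assumes "submodule X A M"
  shows "X \<subseteq> carrier M" "\<zero> \<in> X" "\<And>x y. x \<in> X \<Longrightarrow> y \<in> X \<Longrightarrow> x \<oplus> y \<in> X"
    "\<And>x. x \<in> X \<Longrightarrow> \<ominus> x \<in> X" "\<And>a x. a \<in> carrier A \<Longrightarrow> x \<in> X \<Longrightarrow> a \<odot> x \<in> X"
  using assms by (auto simp: submodule_def submodule_axioms_def subgroup_def a_inv_def)

text \<open>Closure under negation is free: \<open>-x = (-1) x\<close>.\<close>

lemma submoduleI:
  fixes M (structure)
  assumes M: "left_module A M" and X: "X \<subseteq> carrier M" "\<zero> \<in> X"
    "\<And>x y. x \<in> X \<Longrightarrow> y \<in> X \<Longrightarrow> x \<oplus> y \<in> X"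
    "\<And>a x. a \<in> carrier A \<Longrightarrow> x \<in> X \<Longrightarrow> a \<odot> x \<in> X"
  shows "submodule X A M"
proof -
  interpret left_module A M by fact
  have neg: "\<ominus> x \<in> X" if "x \<in> X" for x
  proof -
    have "(\<ominus>\<^bsub>A\<^esub> \<one>\<^bsub>A\<^esub>) \<odot> x = \<ominus> x"
      using smult_minus_left[OF M, of "\<one>\<^bsub>A\<^esub>" x] X(1) that by (auto simp: smult_one)
    then show ?thesis using X(4)[of "\<ominus>\<^bsub>A\<^esub> \<one>\<^bsub>A\<^esub>" x] that by simp
  qed
  have "subgroup X (add_monoid M)"
    using X neg by (auto simp: subgroup_def a_inv_def[symmetric])
  then show ?thesis
    using X by (simp add: submodule_def submodule_axioms_def)
qed

lemma left_module_submodule: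
  fixes M (structure)
  assumes "left_module A M" "submodule X A M"
  shows "left_module A (M\<lparr>carrier := X\<rparr>)"
proof -
  interpret M: left_module A M by fact
  note X = submoduleD[OF assms(2)]
  have *: "abelian_group (M\<lparr>carrier := X\<rparr>)"
    using assms by (simp add: abelian_group_carrier_update left_module_abelian submodule_def)
  have [simp]: "x \<in> X \<Longrightarrow> x \<in> carrier M" for x using X by auto
  show ?thesis
    unfolding left_module_def left_module_axioms_def
    using * M.A.ring_axioms X(5) by (auto simp: M.smult_l_distr M.smult_r_distr M.smult_assoc M.smult_one)
qed

lemma mod_hom_incl:
  assumes "submodule X A M"
  shows "(\<lambda>x\<in>X. x) \<in> mod_hom A (M\<lparr>carrier := X\<rparr>) M"
  using submoduleD[OF assms] by (intro mod_homI) auto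

lemma submodule_common_kernel:
  fixes M (structure)
  assumes M: "left_module A M" and N: "left_module A N" and F: "F \<subseteq> mod_hom A M N"
  shows "submodule {x \<in> carrier M. \<forall>\<phi>\<in>F. \<phi> x = \<zero>\<^bsub>N\<^esub>} A M" (is "submodule ?K A M")
proof (rule submoduleI[OF M])
  interpret M: left_module A M by (rule M)
  interpret N: left_module A N by (rule N)
  have F: "\<phi> \<in> mod_hom A M N" if "\<phi> \<in> F" for \<phi> using F that by blast
  show "?K \<subseteq> carrier M" "\<zero> \<in> ?K"
    using mod_hom_zero[OF F M N] by auto
  show "x \<oplus> y \<in> ?K" if "x \<in> ?K" "y \<in> ?K" for x y
  proof -
    have "\<phi> (x \<oplus> y) = \<zero>\<^bsub>N\<^esub> \<oplus>\<^bsub>N\<^esub> \<zero>\<^bsub>N\<^esub>" if "\<phi> \<in> F" for \<phi>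
      using mod_hom_add[OF F[OF that], of x y] \<open>x \<in> ?K\<close> \<open>y \<in> ?K\<close> that by force
    then show ?thesis using that by simp
  qed
  show "a \<odot> x \<in> ?K" if "a \<in> carrier A" "x \<in> ?K" for a x
  proof -
    have "\<phi> (a \<odot> x) = \<zero>\<^bsub>N\<^esub>" if "\<phi> \<in> F" for \<phi>
      using mod_hom_smult[OF F[OF that], of a x] \<open>a \<in> carrier A\<close> \<open>x \<in> ?K\<close> that smult_zero_right[OF N] by auto
    then show ?thesis using that by (simp add: M.smult_closed)
  qed
qed

lemma submodule_image:
  assumes "left_module A M" "left_module A N" "f \<in> mod_hom A M N"
  shows "submodule (f ` carrier M) A N"
proof -
  interpret M: left_module A M by fact
  interpret N: left_module A N by fact
  show ?thesis
  proof (intro submoduleI)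
    show "left_module A N" by fact
    show "f ` carrier M \<subseteq> carrier N" using assms(3) by (auto simp: mod_hom_closed)
    show "\<zero>\<^bsub>N\<^esub> \<in> f ` carrier M"
      using mod_hom_zero[OF assms(3,1,2)] by (metis M.zero_closed image_eqI)
    show "x \<oplus>\<^bsub>N\<^esub> y \<in> f ` carrier M" if xy: "x \<in> f ` carrier M" "y \<in> f ` carrier M" for x y
    proof -
      from xy obtain u v where uv: "x = f u" "y = f v" "u \<in> carrier M" "v \<in> carrier M" by blast
      then show ?thesis
        by (intro image_eqI[of _ _ "u \<oplus>\<^bsub>M\<^esub> v"]) (simp_all add: mod_hom_add[OF assms(3)])
    qed
    show "a \<odot>\<^bsub>N\<^esub> x \<in> f ` carrier M" if "a \<in> carrier A" and x: "x \<in> f ` carrier M" for a x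
    proof -
      from x obtain u where u: "x = f u" "u \<in> carrier M" by blast
      with that show ?thesis
        by (intro image_eqI[of _ _ "a \<odot>\<^bsub>M\<^esub> u"]) (simp_all add: mod_hom_smult[OF assms(3)] M.smult_closed)
    qed
  qed
qed

lemma submodule_preimage:
  assumes "left_module A M" "left_module A N" "f \<in> mod_hom A M N" "submodule Y A N"
  shows "submodule {x \<in> carrier M. f x \<in> Y} A M"
proof -
  interpret M: left_module A M by fact
  show ?thesis
    using assms submoduleD[OF assms(4)] by (intro submoduleI)
      (auto simp: mod_hom_zero mod_hom_add mod_hom_smult M.smult_closed)
qed


section \<open>Tensor products\<close>

lemmas free_Abelian_group_induct' =
  free_Abelian_group_induct [consumes 1, case_names zero diff of]

text \<open>As \<open>M\<close> is a right module encoded on the left, the last axiom reads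
  \<beta>(ma, n) = \<beta>(m, an). Over an abelian group \<open>G\<close> these conditions make the
  definite description in \<open>tensor_lift\<close> denote a map.\<close>

locale balanced =
  fixes A :: "('a, 'k) ring_scheme" and M :: "('a, 'b, 'm) module_scheme"
    and N :: "('a, 'c, 'n) module_scheme" and G :: "('g, 'l) ring_scheme" and \<beta> :: "'b \<Rightarrow> 'c \<Rightarrow> 'g"
  assumes closed: "m \<in> carrier M \<Longrightarrow> n \<in> carrier N \<Longrightarrow> \<beta> m n \<in> carrier G"
    and add_left: "x \<in> carrier M \<Longrightarrow> y \<in> carrier M \<Longrightarrow> n \<in> carrier N \<Longrightarrow> \<beta> (x \<oplus>\<^bsub>M\<^esub> y) n = \<beta> x n \<oplus>\<^bsub>G\<^esub> \<beta> y n"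
    and add_right: "m \<in> carrier M \<Longrightarrow> n \<in> carrier N \<Longrightarrow> n' \<in> carrier N \<Longrightarrow> \<beta> m (n \<oplus>\<^bsub>N\<^esub> n') = \<beta> m n \<oplus>\<^bsub>G\<^esub> \<beta> m n'"
    and smult: "a \<in> carrier A \<Longrightarrow> m \<in> carrier M \<Longrightarrow> n \<in> carrier N \<Longrightarrow> \<beta> (a \<odot>\<^bsub>M\<^esub> m) n = \<beta> m (a \<odot>\<^bsub>N\<^esub> n)"

locale tensor_product =
  fixes A :: "('a, 'k) ring_scheme" and M :: "('a, 'b, 'm) module_scheme"
    and N :: "('a, 'c, 'n) module_scheme"
  assumes right: "right_module A M" and left: "left_module A N"
begin

sublocale M: left_module "opp_ring A" M by (rule right)
sublocale N: left_module A N by (rule left)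

lemma M_smult_closed [simp]: "a \<in> carrier A \<Longrightarrow> m \<in> carrier M \<Longrightarrow> a \<odot>\<^bsub>M\<^esub> m \<in> carrier M"
  using M.smult_closed by simp

abbreviation T where "T \<equiv> tensor A M N"
abbreviation K where "K \<equiv> tensor_kernel A M N"
abbreviation supp where "supp u \<equiv> Poly_Mapping.keys u \<subseteq> carrier M \<times> carrier N"
abbreviation F where "F \<equiv> free_Abelian_group (carrier M \<times> carrier N)"

text \<open>The class of a formal sum of pairs in the tensor product. Keeping representatives in
  sight makes it possible to ask which elements of the modules a vanishing tensor involves, and to
  apply maps that are not linear.\<close>

definition cls :: "(('b \<times> 'c) \<Rightarrow>\<^sub>0 int) \<Rightarrow> ('b, 'c) tens" where
  "cls u = K #>\<^bsub>F\<^esub> u"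

lemma keys_diff_subset:
  "Poly_Mapping.keys u \<subseteq> S \<Longrightarrow> Poly_Mapping.keys v \<subseteq> S \<Longrightarrow> Poly_Mapping.keys (u - v) \<subseteq> S"
  using keys_diff[of u v] by blast

lemma relator_cases [consumes 1, case_names left right smult]:
  assumes "u \<in> tensor_relators A M N"
  obtains x y n where "u = frag_of (x \<oplus>\<^bsub>M\<^esub> y, n) - frag_of (x, n) - frag_of (y, n)"
      "x \<in> carrier M" "y \<in> carrier M" "n \<in> carrier N"
    | m x y where "u = frag_of (m, x \<oplus>\<^bsub>N\<^esub> y) - frag_of (m, x) - frag_of (m, y)"
      "m \<in> carrier M" "x \<in> carrier N" "y \<in> carrier N"
    | a m n where "u = frag_of (a \<odot>\<^bsub>M\<^esub> m, n) - frag_of (m, a \<odot>\<^bsub>N\<^esub> n)"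
      "a \<in> carrier A" "m \<in> carrier M" "n \<in> carrier N"
  using assms unfolding tensor_relators_def by blast

lemma relators_closed: "tensor_relators A M N \<subseteq> carrier F"
proof
  fix u assume "u \<in> tensor_relators A M N"
  then show "u \<in> carrier F"
    unfolding carrier_free_Abelian_group_iff
    by (cases rule: relator_cases; hypsubst; intro keys_diff_subset) (simp_all add: N.smult_closed)
qed

lemma K_subgroup: "subgroup K F"
  unfolding tensor_kernel_def
  by (intro group.generate_is_subgroup group_free_Abelian_group relators_closed)

lemma K_normal: "normal K F"
  using comm_group.normal_iff_subgroup[OF abelian_free_Abelian_group] K_subgroup by blast

lemma K_closed: "u \<in> K \<Longrightarrow> supp u"
  using subgroup.mem_carrier[OF K_subgroup] by simp

lemma K_zero: "0 \<in> K"
  using subgroup.one_closed[OF K_subgroup] by simp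

lemma K_add: "u \<in> K \<Longrightarrow> v \<in> K \<Longrightarrow> u + v \<in> K"
  using subgroup.m_closed[OF K_subgroup] by simp

lemma K_minus: "u \<in> K \<Longrightarrow> - u \<in> K"
  using subgroup.m_inv_closed[OF K_subgroup] K_closed by simp

lemma K_diff: "u \<in> K \<Longrightarrow> v \<in> K \<Longrightarrow> u - v \<in> K"
  using K_add[OF _ K_minus] by simp

lemma K_relator: "u \<in> tensor_relators A M N \<Longrightarrow> u \<in> K"
  by (simp add: tensor_kernel_def generate.incl)

text \<open>Differences suffice as the closure step, since -h = 0 - h and g + h = g - (0 - h). This
  matches the difference step in the induction principle of the free abelian group.\<close>

lemma K_induct [consumes 1, case_names zero relator diff]:
  assumes "u \<in> K" "P 0" "\<And>u. u \<in> tensor_relators A M N \<Longrightarrow> P u"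
    "\<And>u v. u \<in> K \<Longrightarrow> v \<in> K \<Longrightarrow> P u \<Longrightarrow> P v \<Longrightarrow> P (u - v)"
  shows "P u"
proof -
  have "u \<in> K \<and> P u" using assms(1) unfolding tensor_kernel_def
  proof induction
    case one then show ?case using assms(2) K_zero by (simp add: tensor_kernel_def)
  next
    case (incl h) then show ?case using assms(3) generate.incl by metis
  next
    case (inv h)
    then have "inv\<^bsub>F\<^esub> h = 0 - h" using relators_closed by auto
    then show ?case using assms(4)[OF K_zero K_relator assms(2) assms(3)] inv
        K_diff[OF K_zero K_relator] by (auto simp: tensor_kernel_def)
  next
    case (eng h1 h2)
    have *: "h1 \<in> K" "h2 \<in> K" using eng by (simp_all add: tensor_kernel_def)
    have "P (0 - h2)" using assms(4)[OF K_zero *(2) assms(2)] eng by simp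
    then have "P (h1 - (0 - h2))" using assms(4)[OF *(1) K_diff[OF K_zero *(2)]] eng by simp
    then show ?case using K_add[OF *] by (simp add: tensor_kernel_def)
  qed
  then show ?thesis ..
qed

lemma cls_image: "cls u = (\<lambda>h. h + u) ` K"
  by (auto simp: cls_def r_coset_def)

lemma cls_eq: "cls u = cls v \<longleftrightarrow> u - v \<in> K"
proof
  assume "cls u = cls v"
  then have "0 + u \<in> (\<lambda>h. h + v) ` K"
    using K_zero by (metis cls_image image_eqI)
  then show "u - v \<in> K" by auto
next
  have sub: "cls u \<subseteq> cls v" if "u - v \<in> K" for u v
  proof
    fix x assume "x \<in> cls u"
    then obtain h where "h \<in> K" "x = h + u" by (auto simp: cls_image)
    then show "x \<in> cls v"
      using K_add[OF _ that, of h] unfolding cls_image by (intro image_eqI[of _ _ "h + (u - v)"]) auto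
  qed
  assume "u - v \<in> K"
  then show "cls u = cls v" using sub[of u v] sub[of v u] K_minus[of "u - v"] by auto
qed

lemma carrier_T: "carrier T = cls ` {u. supp u}"
  by (auto simp: tensor_def Let_def carrier_FactGroup cls_def)

lemma cls_closed: "supp u \<Longrightarrow> cls u \<in> carrier T"
  by (auto simp: carrier_T)

lemma zero_T: "\<zero>\<^bsub>T\<^esub> = cls 0"
  by (auto simp: tensor_def Let_def cls_image)

lemma cls_add:
  assumes "supp u" "supp v"
  shows "cls u \<oplus>\<^bsub>T\<^esub> cls v = cls (u + v)"
  using normal.rcos_sum[OF K_normal, of u v] assms by (simp add: tensor_def Let_def cls_def)

lemma cls_eq_zero: "cls u = \<zero>\<^bsub>T\<^esub> \<longleftrightarrow> u \<in> K"
  by (simp add: zero_T cls_eq)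

lemma abelian_T: "abelian_group T"
proof (rule comm_group_abelian_groupI)
  have "add_monoid T = F Mod K"
    by (simp add: tensor_def Let_def FactGroup_def)
  then show "comm_group (add_monoid T)"
    using comm_group.abelian_FactGroup[OF abelian_free_Abelian_group K_subgroup] by simp
qed

sublocale T: abelian_group T by (rule abelian_T)

lemma tens_cls: "tens A M N m n = cls (frag_of (m, n))"
  by (simp add: tens_def cls_def)

lemma tens_closed [simp]: "m \<in> carrier M \<Longrightarrow> n \<in> carrier N \<Longrightarrow> tens A M N m n \<in> carrier T"
  by (auto simp: tens_cls intro!: cls_closed)

lemma cls_minus:
  assumes "supp u"
  shows "\<ominus>\<^bsub>T\<^esub> cls u = cls (- u)"
proof (rule T.minus_equality)
  show "cls (- u) \<oplus>\<^bsub>T\<^esub> cls u = \<zero>\<^bsub>T\<^esub>"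
    using assms cls_add[of "-u" u] by (simp add: zero_T)
qed (use assms in \<open>auto intro!: cls_closed\<close>)

lemma cls_diff:
  assumes "supp u" "supp v"
  shows "cls u \<ominus>\<^bsub>T\<^esub> cls v = cls (u - v)"
  using assms by (simp add: a_minus_def cls_minus cls_add)

lemma tens_balanced: "balanced A M N T (tens A M N)"
proof -
  have *: "cls p = cls q \<oplus>\<^bsub>T\<^esub> cls r"
    if "p - q - r \<in> tensor_relators A M N" "supp q" "supp r"
    for p q r
    using that K_relator[OF that(1)] by (simp add: cls_add cls_eq diff_diff_eq)
  show ?thesis
  proof (rule balanced.intro)
    fix x y n assume "x \<in> carrier M" "y \<in> carrier M" "n \<in> carrier N"
    then show "tens A M N (x \<oplus>\<^bsub>M\<^esub> y) n = tens A M N x n \<oplus>\<^bsub>T\<^esub> tens A M N y n"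
      unfolding tens_cls by (intro *) (auto simp: tensor_relators_def)
  next
    fix m x y assume "m \<in> carrier M" "x \<in> carrier N" "y \<in> carrier N"
    then show "tens A M N m (x \<oplus>\<^bsub>N\<^esub> y) = tens A M N m x \<oplus>\<^bsub>T\<^esub> tens A M N m y"
      unfolding tens_cls by (intro *) (auto simp: tensor_relators_def)
  next
    fix a m n assume "a \<in> carrier A" "m \<in> carrier M" "n \<in> carrier N"
    then show "tens A M N (a \<odot>\<^bsub>M\<^esub> m) n = tens A M N m (a \<odot>\<^bsub>N\<^esub> n)"
      unfolding tens_cls cls_eq by (intro K_relator) (auto simp: tensor_relators_def)
  qed simp
qed

lemmas tens_add_left = balanced.add_left[OF tens_balanced]
  and tens_add_right = balanced.add_right[OF tens_balanced]
  and tens_smult = balanced.smult[OF tens_balanced]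

text \<open>Sums of pure tensors reach everything, with no case for zero or negatives, because 0 = 0
  \<otimes> 0 and -(m \<otimes> n) = (-m) \<otimes> n.\<close>

lemma induct [consumes 1, case_names tens add]:
  assumes "t \<in> carrier T"
    and tens: "\<And>m n. m \<in> carrier M \<Longrightarrow> n \<in> carrier N \<Longrightarrow> P (tens A M N m n)"
    and add: "\<And>s t. s \<in> carrier T \<Longrightarrow> t \<in> carrier T \<Longrightarrow> P s \<Longrightarrow> P t \<Longrightarrow> P (s \<oplus>\<^bsub>T\<^esub> t)"
  shows "P t"
proof -
  have zero_tens: "\<zero>\<^bsub>T\<^esub> = tens A M N \<zero>\<^bsub>M\<^esub> \<zero>\<^bsub>N\<^esub>"
    using tens_add_left[of "\<zero>\<^bsub>M\<^esub>" "\<zero>\<^bsub>M\<^esub>" "\<zero>\<^bsub>N\<^esub>"] by (metis M.zero_closed N.zero_closed tens_closed M.M.l_zero T.add.l_cancel_one)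
  have neg: "\<ominus>\<^bsub>T\<^esub> tens A M N m n = tens A M N (\<ominus>\<^bsub>M\<^esub> m) n" if "m \<in> carrier M" "n \<in> carrier N" for m n
  proof (rule T.minus_equality)
    have "(\<lambda>m. tens A M N m n) \<in> add_hom M T"
      using that by (intro add_homI) (auto simp: tens_add_left)
    then have "tens A M N \<zero>\<^bsub>M\<^esub> n = \<zero>\<^bsub>T\<^esub>"
      using add_hom_zero[of _ M T] M.abelian_group_axioms abelian_T by blast
    then show "tens A M N (\<ominus>\<^bsub>M\<^esub> m) n \<oplus>\<^bsub>T\<^esub> tens A M N m n = \<zero>\<^bsub>T\<^esub>"
      using that tens_add_left[of "\<ominus>\<^bsub>M\<^esub> m" m n] by (simp add: M.M.l_neg)
  qed (use that in auto)
  \<comment> \<open>The property is carried for a class and its negative together, since the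
    difference step of the free group needs \<open>P\<close> for the negative of the second
    class.\<close>
  have "P (cls u) \<and> P (\<ominus>\<^bsub>T\<^esub> cls u)" if "supp u" for u
    using that
  proof (induction u rule: free_Abelian_group_induct')
    case zero
    have "P \<zero>\<^bsub>T\<^esub>" unfolding zero_tens by (intro tens) auto
    moreover have "\<ominus>\<^bsub>T\<^esub> \<zero>\<^bsub>T\<^esub> = \<zero>\<^bsub>T\<^esub>"
      by (rule T.minus_equality) auto
    ultimately show ?case by (simp only: zero_T[symmetric])
  next
    case (diff x y)
    have "cls (x - y) = cls x \<oplus>\<^bsub>T\<^esub> (\<ominus>\<^bsub>T\<^esub> cls y)" "\<ominus>\<^bsub>T\<^esub> cls (x - y) = (\<ominus>\<^bsub>T\<^esub> cls x) \<oplus>\<^bsub>T\<^esub> cls y"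
      using diff cls_closed[of x] cls_closed[of y] by (simp_all add: T.minus_add T.minus_minus a_minus_def flip: cls_diff)
    then show ?case using diff cls_closed[of x] cls_closed[of y] by (simp add: add)
  next
    case (of p)
    then show ?case using neg tens by (cases p) (auto simp flip: tens_cls)
  qed
  then show ?thesis using assms(1) by (auto simp: carrier_T)
qed

text \<open>Pure tensors generate additively. This is the uniqueness half of the universal property;
  naturality, colinearity and coassociativity are later reduced to pure tensors through it.\<close>

lemma hom_eqI:
  assumes "h \<in> add_hom T G" "h' \<in> add_hom T G" "t \<in> carrier T"
    and "\<And>m n. m \<in> carrier M \<Longrightarrow> n \<in> carrier N \<Longrightarrow> h (tens A M N m n) = h' (tens A M N m n)"
  shows "h t = h' t"
  using assms(3) by (induction rule: induct) (use assms in \<open>auto simp: add_hom_add\<close>)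

text \<open>Existence half of the universal property: the extension of \<beta> to the free abelian
  group kills the three kinds of relators, hence the subgroup they generate, and so factors through
  the quotient.\<close>

lemma ex_lift:
  assumes G: "abelian_group G" and "balanced A M N G \<beta>"
  shows "\<exists>h\<in>add_hom T G. \<forall>m\<in>carrier M. \<forall>n\<in>carrier N. h (tens A M N m n) = \<beta> m n"
proof -
  interpret G: abelian_group G by fact
  interpret \<beta>: balanced A M N G \<beta> by fact
  note \<beta> = \<beta>.closed \<beta>.add_left \<beta>.add_right \<beta>.smult
  have "(\<lambda>(m, n). \<beta> m n) ` (carrier M \<times> carrier N) \<subseteq> carrier (add_monoid G)"
    using \<beta>.closed by auto
  then obtain h where hom: "h \<in> hom F (add_monoid G)"
    and h: "\<And>x. x \<in> carrier M \<times> carrier N \<Longrightarrow> h (frag_of x) = (case x of (m, n) \<Rightarrow> \<beta> m n)"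
    using comm_group.free_Abelian_group_universal[OF G.a_comm_group] by metis
  have h_closed: "h u \<in> carrier G" if "supp u" for u using hom_in_carrier[OF hom, of u] that by simp
  have h_add: "h (u + v) = h u \<oplus>\<^bsub>G\<^esub> h v" if "supp u" "supp v" for u v
    using hom_mult[OF hom, of u v] that by simp
  have h_diff: "h (u - v) = h u \<ominus>\<^bsub>G\<^esub> h v" if "supp u" "supp v" for u v
  proof -
    have c: "supp (u - v)" by (rule keys_diff_subset[OF that])
    have "h u = h (u - v) \<oplus>\<^bsub>G\<^esub> h v" using h_add[OF c that(2)] by simp
    then show ?thesis using h_closed[OF c] h_closed[OF that(2)]
      by (simp add: a_minus_def G.a_assoc G.r_neg)
  qed
  have G_cancel: "x \<oplus>\<^bsub>G\<^esub> y \<ominus>\<^bsub>G\<^esub> x \<ominus>\<^bsub>G\<^esub> y = \<zero>\<^bsub>G\<^esub>" if "x \<in> carrier G" "y \<in> carrier G" for x y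
  proof -
    have "x \<oplus>\<^bsub>G\<^esub> y \<ominus>\<^bsub>G\<^esub> x \<ominus>\<^bsub>G\<^esub> y = (x \<oplus>\<^bsub>G\<^esub> y) \<oplus>\<^bsub>G\<^esub> \<ominus>\<^bsub>G\<^esub> (x \<oplus>\<^bsub>G\<^esub> y)"
      using that by (simp add: a_minus_def G.a_assoc G.minus_add)
    then show ?thesis using that by (simp only: G.r_neg G.a_closed)
  qed
  have rel: "h u = \<zero>\<^bsub>G\<^esub>" if "u \<in> tensor_relators A M N" for u
    using that
    by (cases rule: relator_cases)
      (simp_all add: h_diff h \<beta> keys_diff_subset N.smult_closed G_cancel G.minus_eq_zero_iff)
  have K: "h u = \<zero>\<^bsub>G\<^esub>" if "u \<in> K" for u
    using that
  proof (induction rule: K_induct)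
    case zero
    have "h (0 - 0) = \<zero>\<^bsub>G\<^esub>" using h_diff[of 0 0] h_closed[of 0] by (simp add: a_minus_def G.r_neg)
    then show ?case by simp
  next
    case (diff u v) then show ?case by (simp add: h_diff K_closed a_minus_def)
  qed (rule rel)
  have "h u = h v" if "u \<in> carrier F" "v \<in> carrier F" "K #>\<^bsub>F\<^esub> u = K #>\<^bsub>F\<^esub> v" for u v
    using that K[of "u - v"] h_diff[of u v] h_closed G.minus_eq_zero_iff[of "h u" "h v"]
    by (simp flip: cls_def add: cls_eq)
  then obtain h' where h': "h' \<in> hom (F Mod K) (add_monoid G)" "\<And>u. u \<in> carrier F \<Longrightarrow> h' (cls u) = h u"
    using FactGroup_universal[OF hom K_normal] unfolding cls_def by blast
  have "h' \<in> add_hom T G"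
    using h'(1) by (simp add: hom_def add_hom_def tensor_def Let_def)
  moreover have "h' (tens A M N m n) = \<beta> m n" if "m \<in> carrier M" "n \<in> carrier N" for m n
    using h'(2)[of "frag_of (m, n)"] h that by (simp add: tens_cls)
  ultimately show ?thesis by blast
qed

context
  fixes G :: "('g, 'l) ring_scheme" and \<beta>
  assumes G: "abelian_group G" and \<beta>: "balanced A M N G \<beta>"
begin

text \<open>Existence and uniqueness together make the definite description in
  \<open>tensor_lift\<close> meaningful. The map from \<open>ex_lift\<close> is restricted to the
  carrier because the description asks for extensionality, and uniqueness off the carrier rests on
  the same clause.\<close>

private lemma lift_props:
  "tensor_lift A M N G \<beta> \<in> add_hom T G \<and> tensor_lift A M N G \<beta> \<in> extensional (carrier T) \<and>
   (\<forall>m\<in>carrier M. \<forall>n\<in>carrier N. tensor_lift A M N G \<beta> (tens A M N m n) = \<beta> m n)"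
proof -
  define Q where "Q h \<longleftrightarrow> h \<in> carrier T \<rightarrow>\<^sub>E carrier G \<and>
        (\<forall>s\<in>carrier T. \<forall>t\<in>carrier T. h (s \<oplus>\<^bsub>T\<^esub> t) = h s \<oplus>\<^bsub>G\<^esub> h t) \<and>
        (\<forall>m\<in>carrier M. \<forall>n\<in>carrier N. h (tens A M N m n) = \<beta> m n)" for h
  have Q: "Q h \<longleftrightarrow> h \<in> add_hom T G \<and> h \<in> extensional (carrier T) \<and>
        (\<forall>m\<in>carrier M. \<forall>n\<in>carrier N. h (tens A M N m n) = \<beta> m n)" for h
    by (auto simp: Q_def add_hom_def PiE_def)
  obtain h where h: "h \<in> add_hom T G" "\<forall>m\<in>carrier M. \<forall>n\<in>carrier N. h (tens A M N m n) = \<beta> m n"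
    using ex_lift[OF G \<beta>] by blast
  have "(\<lambda>t\<in>carrier T. h t) \<in> add_hom T G"
    using h(1) by (auto simp: add_hom_def)
  then have ex: "Q (\<lambda>t\<in>carrier T. h t)"
    using h(2) unfolding Q by auto
  moreover have "h1 = h2" if "Q h1" "Q h2" for h1 h2
  proof (rule extensionalityI[of _ "carrier T"])
    show "h1 x = h2 x" if "x \<in> carrier T" for x
      using \<open>Q h1\<close> \<open>Q h2\<close> unfolding Q by - (rule hom_eqI[OF _ _ that], auto)
  qed (use that Q in auto)
  ultimately have "Q (THE h. Q h)" by (intro theI[of Q]) auto
  moreover have "tensor_lift A M N G \<beta> = (THE h. Q h)"
    unfolding tensor_lift_def Q_def by (rule refl)
  ultimately show ?thesis
    unfolding Q by simp
qed

lemma lift_add_hom: "tensor_lift A M N G \<beta> \<in> add_hom T G"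
  and lift_tens: "\<And>m n. m \<in> carrier M \<Longrightarrow> n \<in> carrier N \<Longrightarrow>
    tensor_lift A M N G \<beta> (tens A M N m n) = \<beta> m n"
  and lift_extensional: "tensor_lift A M N G \<beta> \<in> extensional (carrier T)"
  using lift_props by blast+

lemma lift_closed: "t \<in> carrier T \<Longrightarrow> tensor_lift A M N G \<beta> t \<in> carrier G"
  using lift_add_hom by (rule add_hom_closed)

lemma lift_add:
  "s \<in> carrier T \<Longrightarrow> t \<in> carrier T \<Longrightarrow>
    tensor_lift A M N G \<beta> (s \<oplus>\<^bsub>T\<^esub> t) = tensor_lift A M N G \<beta> s \<oplus>\<^bsub>G\<^esub> tensor_lift A M N G \<beta> t"
  using lift_add_hom by (rule add_hom_add)

lemma lift_eqI:
  assumes "h \<in> add_hom T G" "\<And>m n. m \<in> carrier M \<Longrightarrow> n \<in> carrier N \<Longrightarrow> h (tens A M N m n) = \<beta> m n"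
    "t \<in> carrier T"
  shows "tensor_lift A M N G \<beta> t = h t"
  by (rule hom_eqI[OF lift_add_hom assms(1,3)]) (simp add: lift_tens assms(2))

end

end

text \<open>\<open>f\<close> and \<open>g\<close> are asked to be additive and linear on the
  carriers, without extensionality, so that the unrestricted identity can serve as either
  factor.\<close>

locale tensor_mapping =
  S: tensor_product A M N + S': tensor_product A M' N'
  for A :: "('a, 'k) ring_scheme" and M :: "('a, 'b, 'm) module_scheme"
    and N :: "('a, 'c, 'n) module_scheme" and M' :: "('a, 'd, 'o) module_scheme"
    and N' :: "('a, 'e, 'p) module_scheme" +
  fixes f g
  assumes f: "f \<in> add_hom M M'" "\<And>a m. a \<in> carrier A \<Longrightarrow> m \<in> carrier M \<Longrightarrow> f (a \<odot>\<^bsub>M\<^esub> m) = a \<odot>\<^bsub>M'\<^esub> f m"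
    and g: "g \<in> add_hom N N'" "\<And>a n. a \<in> carrier A \<Longrightarrow> n \<in> carrier N \<Longrightarrow> g (a \<odot>\<^bsub>N\<^esub> n) = a \<odot>\<^bsub>N'\<^esub> g n"
begin

abbreviation fg where "fg \<equiv> tensor_map A M N M' N' f g"

lemma map_balanced: "balanced A M N S'.T (\<lambda>m n. tens A M' N' (f m) (g n))"
  by (intro balanced.intro)
    (simp_all add: add_hom_closed[OF f(1)] add_hom_closed[OF g(1)] add_hom_add[OF f(1)] add_hom_add[OF g(1)]
      f(2) g(2) S'.tens_add_left S'.tens_add_right S'.tens_smult)

lemmas map_add_hom = S.lift_add_hom[OF S'.abelian_T map_balanced, folded tensor_map_def]
  and map_tens = S.lift_tens[OF S'.abelian_T map_balanced, folded tensor_map_def]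
  and map_closed = S.lift_closed[OF S'.abelian_T map_balanced, folded tensor_map_def]
  and map_add = S.lift_add[OF S'.abelian_T map_balanced, folded tensor_map_def]
  and map_extensional = S.lift_extensional[OF S'.abelian_T map_balanced, folded tensor_map_def]

lemma keys_frag_map:
  assumes "S.supp u"
  shows "S'.supp (frag_extend (frag_of \<circ> map_prod f g) u)"
proof -
  have "S'.supp ((frag_of \<circ> map_prod f g) p)"
    if "p \<in> Poly_Mapping.keys u" for p
    using that assms add_hom_closed[OF f(1)] add_hom_closed[OF g(1)] by (cases p) auto
  then show ?thesis
    by (intro order_trans[OF keys_frag_extend]) blast
qed

text \<open>On representatives f \<otimes> g is the push-forward of formal sums along
  \<open>map_prod f g\<close>. Questions about the kernel of f \<otimes> g thus become questions
  about membership in \<open>tensor_kernel\<close>.\<close>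

lemma map_cls:
  assumes "S.supp u"
  shows "fg (S.cls u) = S'.cls (frag_extend (frag_of \<circ> map_prod f g) u)"
  using assms
proof (induction rule: free_Abelian_group_induct')
  case zero
  show ?case using add_hom_zero[OF map_add_hom S.abelian_T S'.abelian_T] by (simp add: S.zero_T S'.zero_T)
next
  case (diff x y)
  have "fg (S.cls (x - y)) = fg (S.cls x) \<ominus>\<^bsub>S'.T\<^esub> fg (S.cls y)"
    using diff add_hom_diff[OF map_add_hom S.abelian_T S'.abelian_T, of "S.cls x" "S.cls y"]
    by (simp add: S.cls_closed S.cls_diff)
  then show ?case
    using diff S'.cls_diff[OF keys_frag_map keys_frag_map, of x y] by (simp add: frag_extend_diff comp_def)
next
  case (of p)
  then show ?case using map_tens by (cases p) (auto simp: S.tens_cls S'.tens_cls)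
qed

end

section \<open>Flatness over arbitrary carrier types\<close>

text \<open>A copy of \<open>M\<close> along a map that is meant to be injective on its carrier. The
  injectivity and flatness hypotheses speak only about modules carried by \<open>'a test\<close>, so
  their use on other modules passes through such copies.\<close>

definition transport :: "('b \<Rightarrow> 'd) \<Rightarrow> ('a, 'b, 'm) module_scheme \<Rightarrow> ('a, 'd) module" where
  "transport \<theta> M = \<lparr>carrier = \<theta> ` carrier M, monoid.mult = undefined, monoid.one = undefined,
     ring.zero = \<theta> \<zero>\<^bsub>M\<^esub>,
     ring.add = (\<lambda>p q. \<theta> (inv_into (carrier M) \<theta> p \<oplus>\<^bsub>M\<^esub> inv_into (carrier M) \<theta> q)),
     smult = (\<lambda>a p. \<theta> (a \<odot>\<^bsub>M\<^esub> inv_into (carrier M) \<theta> p))\<rparr>"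

lemma transport_simps [simp]:
  assumes "inj_on \<theta> (carrier M)"
  shows "carrier (transport \<theta> M) = \<theta> ` carrier M" "\<zero>\<^bsub>transport \<theta> M\<^esub> = \<theta> \<zero>\<^bsub>M\<^esub>"
    "x \<in> carrier M \<Longrightarrow> y \<in> carrier M \<Longrightarrow> \<theta> x \<oplus>\<^bsub>transport \<theta> M\<^esub> \<theta> y = \<theta> (x \<oplus>\<^bsub>M\<^esub> y)"
    "x \<in> carrier M \<Longrightarrow> a \<odot>\<^bsub>transport \<theta> M\<^esub> \<theta> x = \<theta> (a \<odot>\<^bsub>M\<^esub> x)"
  using assms by (simp_all add: transport_def)

lemma left_module_transport:
  assumes "left_module A M" "inj_on \<theta> (carrier M)"
  shows "left_module A (transport \<theta> M)"
proof -
  interpret M: left_module A M by fact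
  note [simp] = transport_simps[OF assms(2)]
  have "abelian_group (transport \<theta> M)"
  proof (rule abelian_groupI)
    fix x assume "x \<in> carrier (transport \<theta> M)"
    then obtain m where m: "x = \<theta> m" "m \<in> carrier M" by auto
    then show "\<exists>y\<in>carrier (transport \<theta> M). y \<oplus>\<^bsub>transport \<theta> M\<^esub> x = \<zero>\<^bsub>transport \<theta> M\<^esub>"
      by (intro bexI[of _ "\<theta> (\<ominus>\<^bsub>M\<^esub> m)"]) (auto simp: M.M.l_neg)
  qed (auto simp: M.M.a_ac)
  then show ?thesis
    unfolding left_module_def left_module_axioms_def using M.A.ring_axioms
    by (auto simp: M.smult_closed M.smult_l_distr M.smult_r_distr M.smult_assoc M.smult_one)
qed

lemma transport_hom:
  assumes "left_module A M" "inj_on \<theta> (carrier M)"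
  shows "(\<lambda>x\<in>carrier M. \<theta> x) \<in> mod_hom A M (transport \<theta> M)"
proof -
  interpret M: left_module A M by fact
  show ?thesis
    using assms(2) by (intro mod_homI) (auto simp: M.smult_closed)
qed

lemma transport_inv_hom:
  assumes "left_module A M" "inj_on \<theta> (carrier M)"
  shows "(\<lambda>p\<in>\<theta> ` carrier M. inv_into (carrier M) \<theta> p) \<in> mod_hom A (transport \<theta> M) M"
proof -
  interpret M: left_module A M by fact
  show ?thesis
    using assms(2) by (intro mod_homI) (auto simp: M.smult_closed inj_on_eq_iff)
qed

section \<open>Finite linear combinations and their spans\<close>

primrec lin_comb :: "('a, 'b, 'm) module_scheme \<Rightarrow> (nat \<Rightarrow> 'a) \<Rightarrow> 'b list \<Rightarrow> 'b" where
  "lin_comb M v [] = \<zero>\<^bsub>M\<^esub>"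
| "lin_comb M v (y # ys) = v 0 \<odot>\<^bsub>M\<^esub> y \<oplus>\<^bsub>M\<^esub> lin_comb M (\<lambda>n. v (Suc n)) ys"

text \<open>Coefficient vectors are infinite sequences because the test type consists of sets of
  sequences. Only the first \<open>length ys\<close> entries enter the sum, but all of them have to
  lie in \<open>carrier A\<close>.\<close>

definition lin_span :: "('a, 'k) ring_scheme \<Rightarrow> ('a, 'b, 'm) module_scheme \<Rightarrow> 'b list \<Rightarrow> 'b set" where
  "lin_span A M ys = {lin_comb M v ys | v. \<forall>n. v n \<in> carrier A}"

context left_module
begin

lemma lin_comb_closed:
  "set ys \<subseteq> carrier M \<Longrightarrow> (\<And>n. v n \<in> carrier A) \<Longrightarrow> lin_comb M v ys \<in> carrier M"
  by (induction ys arbitrary: v) (auto simp: smult_closed)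

lemma lin_comb_zero: "set ys \<subseteq> carrier M \<Longrightarrow> lin_comb M (\<lambda>_. \<zero>\<^bsub>A\<^esub>) ys = \<zero>\<^bsub>M\<^esub>"
  by (induction ys) (auto simp: smult_zero_left[OF left_module_axioms])

lemma lin_comb_add:
  "set ys \<subseteq> carrier M \<Longrightarrow> (\<And>n. v n \<in> carrier A) \<Longrightarrow> (\<And>n. w n \<in> carrier A) \<Longrightarrow>
    lin_comb M (\<lambda>n. v n \<oplus>\<^bsub>A\<^esub> w n) ys = lin_comb M v ys \<oplus>\<^bsub>M\<^esub> lin_comb M w ys"
proof (induction ys arbitrary: v w)
  case (Cons y ys)
  then have "lin_comb M (\<lambda>n. v (Suc n)) ys \<in> carrier M" "lin_comb M (\<lambda>n. w (Suc n)) ys \<in> carrier M"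
    by (auto intro!: lin_comb_closed)
  with Cons show ?case
    by (simp add: smult_l_distr smult_closed M.a_ac)
qed auto

lemma lin_comb_smult:
  "set ys \<subseteq> carrier M \<Longrightarrow> (\<And>n. v n \<in> carrier A) \<Longrightarrow> a \<in> carrier A \<Longrightarrow>
    lin_comb M (\<lambda>n. a \<otimes>\<^bsub>A\<^esub> v n) ys = a \<odot>\<^bsub>M\<^esub> lin_comb M v ys"
proof (induction ys arbitrary: v)
  case (Cons y ys)
  then have "lin_comb M (\<lambda>n. v (Suc n)) ys \<in> carrier M"
    by (auto intro!: lin_comb_closed)
  with Cons show ?case
    by (simp add: smult_assoc smult_r_distr smult_closed)
qed (auto simp: smult_zero_right[OF left_module_axioms])

lemma lin_comb_generators:
  assumes "set ys \<subseteq> carrier M" "y \<in> set ys"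
  shows "\<exists>v. (\<forall>n. v n \<in> carrier A) \<and> lin_comb M v ys = y"
  using assms
proof (induction ys)
  case (Cons z ys)
  show ?case
  proof (cases "y = z")
    case True
    define v where "v n = (if n = 0 then \<one>\<^bsub>A\<^esub> else \<zero>\<^bsub>A\<^esub>)" for n :: nat
    have "lin_comb M v (z # ys) = y"
      using Cons.prems True by (simp add: v_def lin_comb_zero smult_one)
    then show ?thesis by (intro exI[of _ v]) (simp add: v_def)
  next
    case False
    with Cons obtain v where v: "\<forall>n. v n \<in> carrier A" "lin_comb M v ys = y" by auto
    define w where "w n = (case n of 0 \<Rightarrow> \<zero>\<^bsub>A\<^esub> | Suc k \<Rightarrow> v k)" for n
    have "lin_comb M w (z # ys) = y"
      using Cons.prems v by (auto simp: w_def smult_zero_left[OF left_module_axioms])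
    then show ?thesis using v by (intro exI[of _ w]) (simp add: w_def split: nat.split)
  qed
qed auto

lemma lin_span_submodule:
  assumes "set ys \<subseteq> carrier M"
  shows "submodule (lin_span A M ys) A M"
proof (rule submoduleI[OF left_module_axioms])
  show "lin_span A M ys \<subseteq> carrier M"
    using assms by (auto simp: lin_span_def lin_comb_closed)
  show "\<zero>\<^bsub>M\<^esub> \<in> lin_span A M ys"
    unfolding lin_span_def using lin_comb_zero[OF assms, symmetric] A.zero_closed by blast
next
  fix x y assume "x \<in> lin_span A M ys" "y \<in> lin_span A M ys"
  then obtain v w where "x = lin_comb M v ys" "y = lin_comb M w ys" "\<forall>n. v n \<in> carrier A" "\<forall>n. w n \<in> carrier A"
    by (auto simp: lin_span_def)
  then show "x \<oplus>\<^bsub>M\<^esub> y \<in> lin_span A M ys"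
    using lin_comb_add[OF assms, of v w, symmetric] unfolding lin_span_def
    by (auto intro!: exI[of _ "\<lambda>n. v n \<oplus>\<^bsub>A\<^esub> w n"])
next
  fix a x assume "a \<in> carrier A" "x \<in> lin_span A M ys"
  then obtain v where "x = lin_comb M v ys" "\<forall>n. v n \<in> carrier A"
    by (auto simp: lin_span_def)
  then show "a \<odot>\<^bsub>M\<^esub> x \<in> lin_span A M ys"
    using lin_comb_smult[OF assms, of v a, symmetric] \<open>a \<in> carrier A\<close> unfolding lin_span_def
    by (auto intro!: exI[of _ "\<lambda>n. a \<otimes>\<^bsub>A\<^esub> v n"])
qed

lemma set_subset_lin_span: "set ys \<subseteq> carrier M \<Longrightarrow> set ys \<subseteq> lin_span A M ys"
  using lin_comb_generators[of ys] unfolding lin_span_def by blast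

text \<open>A finitely generated module embeds into the test type: an element goes to the set of its
  coefficient vectors.\<close>

lemma lin_span_embedding: "\<exists>\<theta> :: 'b \<Rightarrow> 'a test. inj_on \<theta> (lin_span A M ys)"
proof
  show "inj_on (\<lambda>y. {v. (\<forall>n. v n \<in> carrier A) \<and> lin_comb M v ys = y}) (lin_span A M ys)"
    by (intro inj_onI) (auto simp: lin_span_def)
qed

end

lemma tensor_mapping_hom:
  assumes "right_module A M" "right_module A M'" "left_module A N" "f \<in> right_mod_hom A M M'"
  shows "tensor_mapping A M N M' N f (\<lambda>n. n)"
  using assms by (intro tensor_mapping.intro tensor_product.intro tensor_mapping_axioms.intro)
    (auto simp: add_hom_def mod_hom_def)

section \<open>Vanishing tensors and finitely generated submodules\<close>

context tensor_product
begin

text \<open>Membership in the kernel is witnessed by finitely many relators, and \<open>ys\<close>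
  collects the left entries from which they are built. The conclusion covers every submodule
  containing \<open>ys\<close>, so that for a difference the two lists are simply appended.\<close>

lemma kernel_finitely_supported:
  assumes "u \<in> K"
  shows "\<exists>ys. set ys \<subseteq> carrier M \<and> (\<forall>Y. submodule Y (opp_ring A) M \<and> set ys \<subseteq> Y \<longrightarrow>
    u \<in> tensor_kernel A (M\<lparr>carrier := Y\<rparr>) N)"
  using assms
proof (induction rule: K_induct)
  case zero
  have "0 \<in> tensor_kernel A (M\<lparr>carrier := Y\<rparr>) N" if "submodule Y (opp_ring A) M" for Y
  proof -
    interpret Y: tensor_product A "M\<lparr>carrier := Y\<rparr>" N
      using left_module_submodule[OF right that] left by (rule tensor_product.intro)
    show ?thesis by (rule Y.K_zero)
  qed
  then show ?case by (intro exI[of _ "[]"]) auto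
next
  case (relator u)
  then show ?case
  proof (cases rule: relator_cases)
    case (left x y n)
    then show ?thesis
      by (intro exI[of _ "[x, y]"]) (auto simp: tensor_kernel_def tensor_relators_def intro!: generate.incl)
  next
    case (right m x y)
    then show ?thesis
      by (intro exI[of _ "[m]"]) (auto simp: tensor_kernel_def tensor_relators_def intro!: generate.incl)
  next
    case (smult a m n)
    then show ?thesis
      by (intro exI[of _ "[m]"]) (auto simp: tensor_kernel_def tensor_relators_def intro!: generate.incl)
  qed
next
  case (diff u v)
  then obtain ys zs where
    "set ys \<subseteq> carrier M" "\<forall>Y. submodule Y (opp_ring A) M \<and> set ys \<subseteq> Y \<longrightarrow> u \<in> tensor_kernel A (M\<lparr>carrier := Y\<rparr>) N"
    "set zs \<subseteq> carrier M" "\<forall>Y. submodule Y (opp_ring A) M \<and> set zs \<subseteq> Y \<longrightarrow> v \<in> tensor_kernel A (M\<lparr>carrier := Y\<rparr>) N"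
    by blast
  moreover have "u - v \<in> tensor_kernel A (M\<lparr>carrier := Y\<rparr>) N" if "submodule Y (opp_ring A) M"
    "u \<in> tensor_kernel A (M\<lparr>carrier := Y\<rparr>) N" "v \<in> tensor_kernel A (M\<lparr>carrier := Y\<rparr>) N" for Y
  proof -
    interpret Y: tensor_product A "M\<lparr>carrier := Y\<rparr>" N
      using left_module_submodule[OF right that(1)] left by (rule tensor_product.intro)
    show ?thesis using that by (simp add: Y.K_diff)
  qed
  ultimately show ?case by (intro exI[of _ "ys @ zs"]) simp
qed

lemma tens_left_add_hom: "n \<in> carrier N \<Longrightarrow> (\<lambda>m. tens A M N m n) \<in> add_hom M T"
  by (intro add_homI) (auto simp: tens_add_left)

lemma tens_minus_left:
  assumes "x \<in> carrier M" "y \<in> carrier M" "n \<in> carrier N"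
  shows "tens A M N (x \<ominus>\<^bsub>M\<^esub> y) n = tens A M N x n \<ominus>\<^bsub>T\<^esub> tens A M N y n"
  using add_hom_diff[OF tens_left_add_hom[OF assms(3)] M.abelian_group_axioms abelian_T assms(1,2)] .

end

text \<open>That i \<otimes> N kills t is witnessed inside a finitely generated submodule of
  \<open>Y\<close>. Enlarged by the images of the left entries of t, this submodule and its preimage
  in \<open>X\<close> have copies in the test type. There the flatness hypothesis makes t vanish,
  and the vanishing is carried back to \<open>X\<close>.\<close>

lemma flat_tensor_map_eq_zero:
  fixes A :: "('a, 'k) ring_scheme" and N :: "('a, 'c, 'n) module_scheme"
    and X :: "('a, 'b, 'm) module_scheme" and Y :: "('a, 'd, 'o) module_scheme"
  assumes flat: "flat_left_module A N" and X: "right_module A X" and Y: "right_module A Y"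
    and i: "i \<in> right_mod_hom A X Y" and inj: "inj_on i (carrier X)"
    and t: "t \<in> carrier (tensor A X N)" and zero: "tensor_map A X N Y N i (\<lambda>n. n) t = \<zero>\<^bsub>tensor A Y N\<^esub>"
  shows "t = \<zero>\<^bsub>tensor A X N\<^esub>"
proof -
  have N: "left_module A N" using flat by (simp add: flat_left_module_def)
  interpret i: tensor_mapping A X N Y N i "\<lambda>n. n" by (rule tensor_mapping_hom[OF X Y N i])
  interpret X: left_module "opp_ring A" X by (rule X)
  interpret Y: left_module "opp_ring A" Y by (rule Y)
  obtain u where u: "t = i.S.cls u" and keys: "i.S.supp u"
    using t by (auto simp: i.S.carrier_T)
  define w where "w = frag_extend (frag_of \<circ> map_prod i (\<lambda>n. n)) u"
  have "w \<in> tensor_kernel A Y N"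
    using zero i.map_cls[OF keys] by (simp add: u w_def i.S'.cls_eq_zero)
  then obtain ys where ys: "set ys \<subseteq> carrier Y"
    "\<And>Z. submodule Z (opp_ring A) Y \<Longrightarrow> set ys \<subseteq> Z \<Longrightarrow> w \<in> tensor_kernel A (Y\<lparr>carrier := Z\<rparr>) N"
    using i.S'.kernel_finitely_supported by blast
  \<comment> \<open>These extra generators guarantee that \<open>u\<close> is supported on the
    preimage of the span.\<close>
  obtain xs where xs: "set xs = i ` fst ` Poly_Mapping.keys u"
    using finite_list[of "i ` fst ` Poly_Mapping.keys u"] by auto
  have zs: "set (ys @ xs) \<subseteq> carrier Y"
    using ys(1) xs keys mod_hom_closed[OF i] by auto
  define Y' where "Y' = lin_span (opp_ring A) Y (ys @ xs)"
  \<comment> \<open>Only \<open>Y'\<close> has to be finitely generated: its preimage embeds into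
    the test type through it.\<close>
  define X' where "X' = {x \<in> carrier X. i x \<in> Y'}"
  define Y1 where "Y1 = Y\<lparr>carrier := Y'\<rparr>"
  define X1 where "X1 = X\<lparr>carrier := X'\<rparr>"
  have Y': "submodule Y' (opp_ring A) Y" unfolding Y'_def by (rule left_module.lin_span_submodule[OF Y zs])
  have X': "submodule X' (opp_ring A) X" unfolding X'_def by (rule submodule_preimage[OF X Y i Y'])
  have Y1: "right_module A Y1" unfolding Y1_def by (rule left_module_submodule[OF Y Y'])
  have X1: "right_module A X1" unfolding X1_def by (rule left_module_submodule[OF X X'])
  have cX1: "carrier X1 = X'" and cY1: "carrier Y1 = Y'" by (simp_all add: X1_def Y1_def)
  have sub: "set (ys @ xs) \<subseteq> Y'" unfolding Y'_def by (rule left_module.set_subset_lin_span[OF Y zs])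
  have wK: "w \<in> tensor_kernel A Y1 N" unfolding Y1_def using ys(2)[OF Y'] sub by simp
  have keys': "Poly_Mapping.keys u \<subseteq> carrier X1 \<times> carrier N"
    using keys sub xs by (force simp: cX1 X'_def)
  obtain \<theta> :: "_ \<Rightarrow> 'a test" where \<theta>: "inj_on \<theta> (carrier Y1)"
    using left_module.lin_span_embedding[OF Y] by (auto simp: cY1 Y'_def)
  have \<theta>i: "inj_on (\<theta> \<circ> i) (carrier X1)"
    using inj_on_subset[OF inj, of X'] inj_on_subset[OF \<theta>, of "i ` X'"]
    by (intro comp_inj_on) (auto simp: cX1 cY1 X'_def)
  \<comment> \<open>\<open>X1\<close> is copied along \<theta> \<circ> i rather than along an
    embedding of its own, so that i becomes the literal inclusion \<open>j\<close> of one test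
    carrier in another.\<close>
  define TX where "TX = transport (\<theta> \<circ> i) X1"
  define TY where "TY = transport \<theta> Y1"
  have TX: "right_module A TX" unfolding TX_def by (rule left_module_transport[OF X1 \<theta>i])
  have TY: "right_module A TY" unfolding TY_def by (rule left_module_transport[OF Y1 \<theta>])
  have iX: "i x \<in> carrier Y1" if "x \<in> carrier X1" for x using that by (simp add: cX1 cY1 X'_def)
  have cTX: "carrier TX = (\<theta> \<circ> i) ` carrier X1" unfolding TX_def using \<theta>i by simp
  define j where "j = (\<lambda>p\<in>carrier TX. p)"
  \<comment> \<open>The inverse of the copying map, used to bring the vanishing of the copied tensor
    back to \<open>X\<close>.\<close>
  define \<kappa> where "\<kappa> = (\<lambda>p\<in>(\<theta> \<circ> i) ` carrier X1. inv_into (carrier X1) (\<theta> \<circ> i) p)"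
  have \<kappa>: "\<kappa> \<in> right_mod_hom A TX X1" unfolding \<kappa>_def TX_def by (rule transport_inv_hom[OF X1 \<theta>i])
  have \<kappa>_eq: "\<kappa> p \<in> carrier X1" "\<theta> (i (\<kappa> p)) = p" if "p \<in> carrier TX" for p
    using that inv_into_into[of p "\<theta> \<circ> i" "carrier X1"] f_inv_into_f[of p "\<theta> \<circ> i" "carrier X1"]
    unfolding cTX \<kappa>_def by simp_all
  have \<theta>h: "(\<lambda>y\<in>carrier Y1. \<theta> y) \<in> right_mod_hom A Y1 TY"
    unfolding TY_def by (rule transport_hom[OF Y1 \<theta>])
  have "(\<lambda>x\<in>carrier X1. i x) \<in> right_mod_hom A X1 Y1"
    using i iX submoduleD[OF X'] by (auto simp: mod_hom_def X1_def Y1_def subset_iff)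
  note mod_hom_compose[OF TX \<kappa> mod_hom_compose[OF X1 this \<theta>h]]
  moreover have "(\<lambda>p\<in>carrier TX. (\<lambda>x\<in>carrier X1. (\<lambda>y\<in>carrier Y1. \<theta> y) ((\<lambda>x\<in>carrier X1. i x) x)) (\<kappa> p)) = j"
    unfolding j_def by (rule restrict_ext) (simp add: \<kappa>_eq iX)
  ultimately have j: "j \<in> right_mod_hom A TX TY" by (simp only:)
  interpret j: tensor_mapping A TX N TY N j "\<lambda>n. n" by (rule tensor_mapping_hom[OF TX TY N j])
  interpret \<theta>: tensor_mapping A Y1 N TY N "\<lambda>x\<in>carrier Y1. \<theta> x" "\<lambda>n. n"
    by (rule tensor_mapping_hom[OF Y1 TY N \<theta>h])
  have "\<kappa> \<in> right_mod_hom A TX X"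
    using \<kappa> by (auto simp: mod_hom_def PiE_def X1_def X'_def)
  then interpret \<kappa>: tensor_mapping A TX N X N \<kappa> "\<lambda>n. n"
    by (intro tensor_mapping_hom[OF TX X N])
  define u1 where "u1 = frag_extend (frag_of \<circ> map_prod (\<theta> \<circ> i) (\<lambda>n. n)) u"
  have keys1: "j.S.supp u1"
    using keys' unfolding u1_def
    by (intro order_trans[OF keys_frag_extend]) (auto simp: cTX)
  \<comment> \<open>Copying \<open>u\<close> and then including it in \<open>TY\<close> is the same
    as copying \<open>w\<close>, whose class is zero already over \<open>Y1\<close>.\<close>
  have "frag_extend (frag_of \<circ> map_prod j (\<lambda>n. n)) u1
      = frag_extend ((frag_of \<circ> map_prod j (\<lambda>n. n)) \<circ> map_prod (\<theta> \<circ> i) (\<lambda>n. n)) u"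
    unfolding u1_def by (rule frag_extend_compose)
  also have "\<dots> = frag_extend ((frag_of \<circ> map_prod (\<lambda>x\<in>carrier Y1. \<theta> x) (\<lambda>n. n)) \<circ> map_prod i (\<lambda>n. n)) u"
    using keys' iX by (intro frag_extend_eq) (auto simp: j_def cTX)
  also have "\<dots> = frag_extend (frag_of \<circ> map_prod (\<lambda>x\<in>carrier Y1. \<theta> x) (\<lambda>n. n)) w"
    unfolding w_def by (rule frag_extend_compose[symmetric])
  finally have "j.fg (j.S.cls u1) = \<theta>.fg (\<theta>.S.cls w)"
    using j.map_cls[OF keys1] \<theta>.map_cls[OF \<theta>.S.K_closed[OF wK]] by simp
  also have "\<dots> = \<zero>\<^bsub>tensor A TY N\<^esub>"
    using wK \<theta>.S.cls_eq_zero add_hom_zero[OF \<theta>.map_add_hom \<theta>.S.abelian_T j.S'.abelian_T] by metis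
  finally have "j.fg (j.S.cls u1) = \<zero>\<^bsub>tensor A TY N\<^esub>" .
  moreover have "inj_on j.fg (carrier (tensor A TX N))"
  proof -
    have "inj_on j (carrier TX)" by (auto simp: j_def inj_on_def)
    then show ?thesis using flat TX TY j unfolding flat_left_module_def by blast
  qed
  ultimately have "j.S.cls u1 = \<zero>\<^bsub>tensor A TX N\<^esub>"
    using j.S.cls_closed[OF keys1] add_hom_inj_iff[OF j.map_add_hom j.S.abelian_T j.S'.abelian_T] by simp
  then have "\<kappa>.fg (j.S.cls u1) = \<zero>\<^bsub>tensor A X N\<^esub>"
    using add_hom_zero[OF \<kappa>.map_add_hom j.S.abelian_T i.S.abelian_T] by simp
  moreover have "frag_extend (frag_of \<circ> map_prod \<kappa> (\<lambda>n. n)) u1 = u"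
  proof -
    have "frag_extend (frag_of \<circ> map_prod \<kappa> (\<lambda>n. n)) u1
      = frag_extend ((frag_of \<circ> map_prod \<kappa> (\<lambda>n. n)) \<circ> map_prod (\<theta> \<circ> i) (\<lambda>n. n)) u"
      unfolding u1_def by (rule frag_extend_compose)
    also have "\<dots> = frag_extend frag_of u"
      using keys' inv_into_f_f[OF \<theta>i] by (intro frag_extend_eq) (auto simp: \<kappa>_def)
    finally show ?thesis by (simp flip: frag_expansion)
  qed
  ultimately show ?thesis
    using \<kappa>.map_cls[OF keys1] by (simp add: u)
qed

text \<open>The composite enters as a separate map \<open>h\<close> agreeing with it on the carrier,
  since f' \<circ> f itself need not be extensional and so need not belong to
  \<open>right_mod_hom\<close>.\<close>

lemma tensor_map_compose:
  assumes "right_module A M" "right_module A M'" "right_module A M''" "left_module A N"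
    "f \<in> right_mod_hom A M M'" "f' \<in> right_mod_hom A M' M''" "h \<in> right_mod_hom A M M''"
    "\<And>m. m \<in> carrier M \<Longrightarrow> h m = f' (f m)" "t \<in> carrier (tensor A M N)"
  shows "tensor_map A M' N M'' N f' (\<lambda>n. n) (tensor_map A M N M' N f (\<lambda>n. n) t)
    = tensor_map A M N M'' N h (\<lambda>n. n) t"
proof -
  interpret f: tensor_mapping A M N M' N f "\<lambda>n. n" by (rule tensor_mapping_hom[OF assms(1,2,4,5)])
  interpret f': tensor_mapping A M' N M'' N f' "\<lambda>n. n" by (rule tensor_mapping_hom[OF assms(2,3,4,6)])
  interpret h: tensor_mapping A M N M'' N h "\<lambda>n. n" by (rule tensor_mapping_hom[OF assms(1,3,4,7)])
  show ?thesis
    by (rule f.S.hom_eqI[OF add_hom_compose[OF f.map_add_hom f'.map_add_hom] h.map_add_hom assms(9)])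
      (simp add: f.map_tens f'.map_tens h.map_tens mod_hom_closed[OF assms(5)] assms(8))
qed

text \<open>Flatness handles the inclusion of the image of \<open>\<phi>\<close>; a set-theoretic section of \<open>\<phi>\<close> inverts
  \<open>\<phi> \<otimes> N\<close> up to the image of \<open>ker \<phi> \<otimes> N\<close>, which gives right exactness.\<close>

lemma tensor_map_kernel:
  fixes A :: "('a, 'k) ring_scheme" and N :: "('a, 'c, 'n) module_scheme"
    and M :: "('a, 'b, 'm) module_scheme" and M' :: "('a, 'd, 'o) module_scheme"
  assumes flat: "flat_left_module A N" and M: "right_module A M" and M': "right_module A M'"
    and \<phi>: "\<phi> \<in> right_mod_hom A M M'" and L: "L = {x \<in> carrier M. \<phi> x = \<zero>\<^bsub>M'\<^esub>}"
    and t: "t \<in> carrier (tensor A M N)" and zero: "tensor_map A M N M' N \<phi> (\<lambda>n. n) t = \<zero>\<^bsub>tensor A M' N\<^esub>"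
  shows "\<exists>s\<in>carrier (tensor A (M\<lparr>carrier := L\<rparr>) N).
    tensor_map A (M\<lparr>carrier := L\<rparr>) N M N (\<lambda>x\<in>L. x) (\<lambda>n. n) s = t"
proof -
  have N: "left_module A N" using flat by (simp add: flat_left_module_def)
  interpret M: left_module "opp_ring A" M by (rule M)
  interpret M': left_module "opp_ring A" M' by (rule M')
  interpret N: left_module A N by (rule N)
  define P where "P = \<phi> ` carrier M"
  define P1 where "P1 = M'\<lparr>carrier := P\<rparr>"
  define L1 where "L1 = M\<lparr>carrier := L\<rparr>"
  define \<iota> where "\<iota> = (\<lambda>x\<in>L. x)"
  have Psub: "submodule P (opp_ring A) M'" unfolding P_def by (rule submodule_image[OF M M' \<phi>])
  have P1: "right_module A P1" unfolding P1_def by (rule left_module_submodule[OF M' Psub])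
  have Lsub: "submodule L (opp_ring A) M" unfolding L using submodule_common_kernel[OF M M', of "{\<phi>}"] \<phi> by simp
  have L1: "right_module A L1" unfolding L1_def by (rule left_module_submodule[OF M Lsub])
  have \<phi>P: "\<phi> \<in> right_mod_hom A M P1"
    using \<phi> by (auto simp: mod_hom_def PiE_def P1_def P_def)
  have iP: "(\<lambda>x\<in>P. x) \<in> right_mod_hom A P1 M'" unfolding P1_def by (rule mod_hom_incl[OF Psub])
  have iL: "\<iota> \<in> right_mod_hom A L1 M" unfolding L1_def \<iota>_def by (rule mod_hom_incl[OF Lsub])
  interpret \<phi>P: tensor_mapping A M N P1 N \<phi> "\<lambda>n. n" by (rule tensor_mapping_hom[OF M P1 N \<phi>P])
  interpret iL: tensor_mapping A L1 N M N \<iota> "\<lambda>n. n" by (rule tensor_mapping_hom[OF L1 M N iL])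
  let ?T = "tensor A M N"
  note T = \<phi>P.S.abelian_T
  have "\<phi>P.fg t = \<zero>\<^bsub>tensor A P1 N\<^esub>"
  proof (rule flat_tensor_map_eq_zero[OF flat P1 M' iP])
    show "inj_on (\<lambda>x\<in>P. x) (carrier P1)" by (auto simp: inj_on_def P1_def)
    show "\<phi>P.fg t \<in> carrier (tensor A P1 N)" using t by (rule \<phi>P.map_closed)
    show "tensor_map A P1 N M' N (\<lambda>x\<in>P. x) (\<lambda>n. n) (\<phi>P.fg t) = \<zero>\<^bsub>tensor A M' N\<^esub>"
      using tensor_map_compose[OF M P1 M' N \<phi>P iP \<phi> _ t] zero by (simp add: P_def)
  qed
  obtain u where u: "t = \<phi>P.S.cls u" and keys: "\<phi>P.S.supp u"
    using t by (auto simp: \<phi>P.S.carrier_T)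
  define s where "s = inv_into (carrier M) \<phi>"
  have sP: "s p \<in> carrier M" "\<phi> (s p) = p" if "p \<in> P" for p
    using that by (auto simp: s_def P_def intro: inv_into_into f_inv_into_f)
  define Im where "Im = iL.fg ` carrier (tensor A L1 N)"
  have Im_sub: "Im \<subseteq> carrier ?T" using iL.map_closed unfolding Im_def by blast
  have Im_diff: "x \<ominus>\<^bsub>?T\<^esub> y \<in> Im" if xy: "x \<in> Im" "y \<in> Im" for x y
  proof -
    obtain p q where "x = iL.fg p" "y = iL.fg q" "p \<in> carrier (tensor A L1 N)" "q \<in> carrier (tensor A L1 N)"
      using xy unfolding Im_def by blast
    then have "x \<ominus>\<^bsub>?T\<^esub> y = iL.fg (p \<ominus>\<^bsub>tensor A L1 N\<^esub> q)" "p \<ominus>\<^bsub>tensor A L1 N\<^esub> q \<in> carrier (tensor A L1 N)"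
      using add_hom_diff[OF iL.map_add_hom iL.S.abelian_T T] by simp_all
    then show ?thesis unfolding Im_def by blast
  qed
  have Im_tens: "tens A M N x n \<in> Im" if "x \<in> L" "n \<in> carrier N" for x n
  proof -
    have "x \<in> carrier L1" "\<iota> x = x" using that by (simp_all add: L1_def \<iota>_def)
    then have "tens A M N x n = iL.fg (tens A L1 N x n)" "tens A L1 N x n \<in> carrier (tensor A L1 N)"
      using iL.map_tens[of x n] that by simp_all
    then show ?thesis unfolding Im_def by blast
  qed
  have Im_zero: "\<zero>\<^bsub>?T\<^esub> \<in> Im"
    using add_hom_zero[OF iL.map_add_hom iL.S.abelian_T T, symmetric] iL.S.T.zero_closed
    unfolding Im_def by blast
  have L_diff: "x \<ominus>\<^bsub>M\<^esub> y \<in> L" if "x \<in> carrier M" "y \<in> carrier M" "\<phi> x = \<phi> y" for x y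
    using that add_hom_diff[OF mod_hom_add_hom[OF \<phi>] M.abelian_group_axioms M'.abelian_group_axioms that(1,2)] mod_hom_closed[OF \<phi>]
    by (simp add: L a_minus_def M'.M.r_neg)
  define \<sigma> where "\<sigma> w = frag_extend (frag_of \<circ> map_prod s (\<lambda>n. n)) w" for w :: "'d \<times> 'c \<Rightarrow>\<^sub>0 int"
  \<comment> \<open>As \<open>s\<close> need not be linear, \<open>E\<close> lives on formal sums
    and descends to P1 \<otimes> N only modulo \<open>Im\<close>.\<close>
  define E where "E w = \<phi>P.S.cls (\<sigma> w)" for w
  have \<sigma>_keys: "\<phi>P.S.supp (\<sigma> w)"
    if "\<phi>P.S'.supp w" for w
    using that sP unfolding \<sigma>_def
    by (intro order_trans[OF keys_frag_extend]) (auto simp: P1_def)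
  have E_closed: "E w \<in> carrier ?T" if "\<phi>P.S'.supp w" for w
    unfolding E_def using \<sigma>_keys[OF that] by (rule \<phi>P.S.cls_closed)
  have E_diff: "E (v - w) = E v \<ominus>\<^bsub>?T\<^esub> E w"
    if "\<phi>P.S'.supp v" "\<phi>P.S'.supp w" for v w
    using that by (simp add: E_def \<sigma>_def frag_extend_diff \<phi>P.S.cls_diff \<sigma>_keys[unfolded \<sigma>_def])
  have E_of: "E (frag_of (p, n)) = tens A M N (s p) n" for p n
    by (simp add: E_def \<sigma>_def \<phi>P.S.tens_cls)
  have keys_of: "\<phi>P.S'.supp (frag_of (p, n))"
    if "p \<in> P" "n \<in> carrier N" for p n
    using that by (simp add: P1_def)
  note keys_diff' = \<phi>P.S'.keys_diff_subset
  note P = submoduleD[OF Psub]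
  \<comment> \<open>On a relator \<open>E\<close> leaves at most the defect of \<open>s\<close> in
    the left factor, such as s(x + y) - (s x + s y) or s(ma) - (s m)a. This is killed by \<phi> and
    so lies in \<open>L\<close>.\<close>
  have E_K: "E w \<in> Im" if "w \<in> tensor_kernel A P1 N" for w
    using that
  proof (induction rule: \<phi>P.S'.K_induct)
    case zero
    show ?case using Im_zero by (simp add: E_def \<sigma>_def \<phi>P.S.zero_T)
  next
    case (diff u v)
    then show ?case by (simp add: E_diff \<phi>P.S'.K_closed Im_diff)
  next
    case (relator w)
    then show ?case
    proof (cases rule: \<phi>P.S'.relator_cases)
      case (left x y n)
      then have l: "w = frag_of (x \<oplus>\<^bsub>M'\<^esub> y, n) - frag_of (x, n) - frag_of (y, n)" "x \<in> P" "y \<in> P" "n \<in> carrier N"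
        by (simp_all add: P1_def)
      have "E w = tens A M N (s (x \<oplus>\<^bsub>M'\<^esub> y)) n \<ominus>\<^bsub>?T\<^esub> tens A M N (s x) n \<ominus>\<^bsub>?T\<^esub> tens A M N (s y) n"
        using l P by (simp add: E_diff E_of keys_of keys_diff' del: keys_single)
      also have "\<dots> = tens A M N (s (x \<oplus>\<^bsub>M'\<^esub> y)) n \<ominus>\<^bsub>?T\<^esub> tens A M N (s x \<oplus>\<^bsub>M\<^esub> s y) n"
        using l P sP by (simp add: \<phi>P.S.tens_add_left a_minus_def \<phi>P.S.T.minus_add \<phi>P.S.T.a_assoc)
      also have "\<dots> = tens A M N (s (x \<oplus>\<^bsub>M'\<^esub> y) \<ominus>\<^bsub>M\<^esub> (s x \<oplus>\<^bsub>M\<^esub> s y)) n"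
        using l P sP by (simp add: \<phi>P.S.tens_minus_left)
      also have "\<dots> \<in> Im"
        using l P sP by (intro Im_tens L_diff) (auto simp: mod_hom_add[OF \<phi>])
      finally show ?thesis .
    next
      case (right m x y)
      then have r: "w = frag_of (m, x \<oplus>\<^bsub>N\<^esub> y) - frag_of (m, x) - frag_of (m, y)" "m \<in> P" "x \<in> carrier N" "y \<in> carrier N"
        by (simp_all add: P1_def)
      have "E w = tens A M N (s m) (x \<oplus>\<^bsub>N\<^esub> y) \<ominus>\<^bsub>?T\<^esub> tens A M N (s m) x \<ominus>\<^bsub>?T\<^esub> tens A M N (s m) y"
        using r P by (simp add: E_diff E_of keys_of keys_diff' del: keys_single)
      also have "\<dots> = (tens A M N (s m) x \<oplus>\<^bsub>?T\<^esub> tens A M N (s m) y) \<ominus>\<^bsub>?T\<^esub> (tens A M N (s m) x \<oplus>\<^bsub>?T\<^esub> tens A M N (s m) y)"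
        using r sP by (simp add: \<phi>P.S.tens_add_right a_minus_def \<phi>P.S.T.minus_add \<phi>P.S.T.a_assoc)
      also have "\<dots> = \<zero>\<^bsub>?T\<^esub>"
        using r sP by (simp add: \<phi>P.S.T.minus_eq_zero_iff)
      finally show ?thesis using Im_zero by simp
    next
      case (smult a m n)
      then have s: "w = frag_of (a \<odot>\<^bsub>M'\<^esub> m, n) - frag_of (m, a \<odot>\<^bsub>N\<^esub> n)" "a \<in> carrier A" "m \<in> P" "n \<in> carrier N"
        by (simp_all add: P1_def)
      have "E w = tens A M N (s (a \<odot>\<^bsub>M'\<^esub> m)) n \<ominus>\<^bsub>?T\<^esub> tens A M N (s m) (a \<odot>\<^bsub>N\<^esub> n)"
        using s P by (simp add: E_diff E_of keys_of N.smult_closed del: keys_single)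
      also have "\<dots> = tens A M N (s (a \<odot>\<^bsub>M'\<^esub> m) \<ominus>\<^bsub>M\<^esub> a \<odot>\<^bsub>M\<^esub> s m) n"
        using s P sP by (simp add: \<phi>P.S.tens_minus_left \<phi>P.S.tens_smult)
      also have "\<dots> \<in> Im"
        using s P sP by (intro Im_tens L_diff) (auto simp: mod_hom_smult[OF \<phi>])
      finally show ?thesis .
    qed
  qed
  define \<Phi> where "\<Phi> = frag_extend (frag_of \<circ> map_prod \<phi> (\<lambda>n. n :: 'c))"
  have \<Phi>_keys: "\<phi>P.S'.supp (\<Phi> v)"
    if "\<phi>P.S.supp v" for v
    using that unfolding \<Phi>_def
    by (intro order_trans[OF keys_frag_extend]) (auto simp: P1_def P_def)
  \<comment> \<open>For a pure tensor the difference is (m - s(\<phi> m)) \<otimes> n, and m -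
    s(\<phi> m) lies in \<open>L\<close>.\<close>
  have *: "\<phi>P.S.cls v \<ominus>\<^bsub>?T\<^esub> E (\<Phi> v) \<in> Im" if "\<phi>P.S.supp v" for v
    using that
  proof (induction v rule: free_Abelian_group_induct')
    case zero
    have "\<phi>P.S.cls 0 \<ominus>\<^bsub>?T\<^esub> E (\<Phi> 0) = \<zero>\<^bsub>?T\<^esub>"
      by (simp add: \<Phi>_def E_def \<sigma>_def \<phi>P.S.T.minus_eq_zero_iff \<phi>P.S.cls_closed)
    then show ?case using Im_zero by simp
  next
    case (diff v w)
    have "\<phi>P.S.cls (v - w) \<ominus>\<^bsub>?T\<^esub> E (\<Phi> (v - w))
      = (\<phi>P.S.cls v \<ominus>\<^bsub>?T\<^esub> \<phi>P.S.cls w) \<ominus>\<^bsub>?T\<^esub> (E (\<Phi> v) \<ominus>\<^bsub>?T\<^esub> E (\<Phi> w))"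
      using diff \<Phi>_keys E_diff[of "\<Phi> v" "\<Phi> w"] by (simp add: \<phi>P.S.cls_diff \<Phi>_def frag_extend_diff)
    also have "\<dots> = (\<phi>P.S.cls v \<ominus>\<^bsub>?T\<^esub> E (\<Phi> v)) \<ominus>\<^bsub>?T\<^esub> (\<phi>P.S.cls w \<ominus>\<^bsub>?T\<^esub> E (\<Phi> w))"
      using diff \<Phi>_keys E_closed \<phi>P.S.cls_closed
      by (simp add: a_minus_def \<phi>P.S.T.minus_add \<phi>P.S.T.minus_minus \<phi>P.S.T.a_ac)
    finally show ?case using diff Im_diff by simp
  next
    case (of p)
    obtain m n where p: "p = (m, n)" "m \<in> carrier M" "n \<in> carrier N" using of by auto
    have m: "\<phi> m \<in> P" using p by (simp add: P_def)
    have "\<phi>P.S.cls (frag_of p) \<ominus>\<^bsub>?T\<^esub> E (\<Phi> (frag_of p)) = tens A M N (m \<ominus>\<^bsub>M\<^esub> s (\<phi> m)) n"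
      using p m sP by (simp add: \<Phi>_def E_of \<phi>P.S.tens_minus_left flip: \<phi>P.S.tens_cls)
    also have "\<dots> \<in> Im" using p m sP by (intro Im_tens L_diff) auto
    finally show ?case .
  qed
  have "\<Phi> u \<in> tensor_kernel A P1 N"
    using \<open>\<phi>P.fg t = _\<close> \<phi>P.map_cls[OF keys] by (simp add: u \<Phi>_def \<phi>P.S'.cls_eq_zero)
  then have "t \<ominus>\<^bsub>?T\<^esub> E (\<Phi> u) \<in> Im" "E (\<Phi> u) \<in> Im"
    using * keys E_K u by auto
  \<comment> \<open>\<open>Im\<close> is known to be closed under differences, so t is written as (t
    - E) - (0 - E).\<close>
  then have "(t \<ominus>\<^bsub>?T\<^esub> E (\<Phi> u)) \<ominus>\<^bsub>?T\<^esub> (\<zero>\<^bsub>?T\<^esub> \<ominus>\<^bsub>?T\<^esub> E (\<Phi> u)) \<in> Im"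
    by (rule Im_diff[OF _ Im_diff[OF Im_zero]])
  moreover have "(t \<ominus>\<^bsub>?T\<^esub> E (\<Phi> u)) \<ominus>\<^bsub>?T\<^esub> (\<zero>\<^bsub>?T\<^esub> \<ominus>\<^bsub>?T\<^esub> E (\<Phi> u)) = t"
    using t E_closed[OF \<Phi>_keys[OF keys]] by (simp add: a_minus_def \<phi>P.S.T.minus_add \<phi>P.S.T.minus_minus \<phi>P.S.T.a_assoc \<phi>P.S.T.l_neg)
  ultimately have "t \<in> Im" by (simp only:)
  then show ?thesis unfolding Im_def L1_def \<iota>_def by auto
qed

section \<open>Injectivity and quasi-Frobenius rings\<close>

lemma regular_module_simps [simp]:
  "carrier (regular_module A) = carrier A" "\<zero>\<^bsub>regular_module A\<^esub> = \<zero>\<^bsub>A\<^esub>"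
  "x \<oplus>\<^bsub>regular_module A\<^esub> y = x \<oplus>\<^bsub>A\<^esub> y" "a \<odot>\<^bsub>regular_module A\<^esub> x = a \<otimes>\<^bsub>A\<^esub> x"
  by (simp_all add: regular_module_def)

lemma left_module_regular:
  assumes "ring A" shows "left_module A (regular_module A)"
proof -
  interpret ring A by fact
  have "abelian_group (regular_module A)"
    by (rule abelian_groupI) (auto simp: a_ac intro: l_neg bexI[of _ "\<ominus>\<^bsub>A\<^esub> _"])
  then show ?thesis
    unfolding left_module_def left_module_axioms_def using ring_axioms
    by (auto simp: l_distr r_distr m_assoc)
qed

lemma mod_hom_carrier_update:
  assumes "f \<in> mod_hom A M N" "submodule X A M"
  shows "(\<lambda>x\<in>X. f x) \<in> mod_hom A (M\<lparr>carrier := X\<rparr>) N"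
  using submoduleD[OF assms(2)] assms(1) by (intro mod_homI)
    (auto simp: mod_hom_add[OF assms(1)] mod_hom_smult[OF assms(1)] mod_hom_closed[OF assms(1)] subset_iff)

text \<open>The ideal and \<open>A\<close> itself are copied into the test type through singletons
  of constant sequences. An extension of \<open>f\<close> to all of \<open>A\<close> is determined
  by its value at 1, and that value is the required element n.\<close>

lemma injective_ideal_extend:
  fixes A :: "('a, 'k) ring_scheme"
  assumes inj: "injective_module A N" and J: "submodule J A (regular_module A)"
    and f: "f \<in> mod_hom A ((regular_module A)\<lparr>carrier := J\<rparr>) N"
  shows "\<exists>n\<in>carrier N. \<forall>a\<in>J. f a = a \<odot>\<^bsub>N\<^esub> n"
proof -
  have N: "left_module A N" using inj by (simp add: injective_module_def)
  have A: "left_module A (regular_module A)" by (rule left_module_regular[OF left_module_ring[OF N]])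
  interpret A: ring A by (rule left_module_ring[OF N])
  have JM: "left_module A ((regular_module A)\<lparr>carrier := J\<rparr>)" by (rule left_module_submodule[OF A J])
  have JA: "J \<subseteq> carrier A" using submoduleD(1)[OF J] by simp
  define e :: "'a \<Rightarrow> 'a test" where "e a = {\<lambda>_. a}" for a
  have e: "inj_on e S" for S by (auto simp: e_def inj_on_def fun_eq_iff)
  define X where "X = transport e ((regular_module A)\<lparr>carrier := J\<rparr>)"
  define Y where "Y = transport e (regular_module A)"
  have X: "left_module A X" unfolding X_def by (rule left_module_transport[OF JM e])
  have Y: "left_module A Y" unfolding Y_def by (rule left_module_transport[OF A e])
  define i where "i = (\<lambda>p\<in>carrier X. p)"
  have i: "i \<in> mod_hom A X Y"
    using e e[of "carrier A"] JA submoduleD[OF J] unfolding i_def X_def Y_def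
    by (intro mod_homI) (auto simp: transport_simps[OF e] transport_def subset_iff)
  have "inj_on i (carrier X)" by (simp add: i_def inj_on_def)
  moreover define f' where
    "f' = (\<lambda>p\<in>carrier X. f ((\<lambda>p\<in>e ` carrier ((regular_module A)\<lparr>carrier := J\<rparr>). inv_into (carrier ((regular_module A)\<lparr>carrier := J\<rparr>)) e p) p))"
  have "f' \<in> mod_hom A X N"
    unfolding f'_def by (rule mod_hom_compose[OF X transport_inv_hom[OF JM e, folded X_def] f])
  ultimately obtain g where g: "g \<in> mod_hom A Y N" "\<forall>x\<in>carrier X. g (i x) = f' x"
    using inj X Y i unfolding injective_module_def by blast
  show ?thesis
  proof (intro bexI ballI)
    show "g (e \<one>\<^bsub>A\<^esub>) \<in> carrier N"
      using mod_hom_closed[OF g(1)] by (simp add: Y_def transport_simps[OF e])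
    fix a assume a: "a \<in> J"
    then have aA: "a \<in> carrier A" using JA by auto
    have eX: "e a \<in> carrier X" using a by (simp add: X_def transport_simps[OF e])
    have "f a = f' (e a)" using a eX inv_into_f_f[OF e, of a J] by (simp add: f'_def)
    also have "\<dots> = g (e a)" using g(2) eX by (simp add: i_def)
    also have "e a = a \<odot>\<^bsub>Y\<^esub> e \<one>\<^bsub>A\<^esub>" using aA by (simp add: Y_def transport_simps[OF e])
    also have "g \<dots> = a \<odot>\<^bsub>N\<^esub> g (e \<one>\<^bsub>A\<^esub>)"
      by (rule mod_hom_smult[OF g(1) aA]) (simp add: Y_def transport_simps[OF e])
    finally show "f a = a \<odot>\<^bsub>N\<^esub> g (e \<one>\<^bsub>A\<^esub>)" .
  qed
qed

section \<open>Baer's criterion and extension of linear relations\<close>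

definition linear_graph ::
    "('a, 'k) ring_scheme \<Rightarrow> ('a, 'b, 'm) module_scheme \<Rightarrow> ('a, 'c, 'n) module_scheme
      \<Rightarrow> ('b \<times> 'c) set \<Rightarrow> bool" where
  "linear_graph A M N G \<longleftrightarrow> G \<subseteq> carrier M \<times> carrier N \<and> (\<zero>\<^bsub>M\<^esub>, \<zero>\<^bsub>N\<^esub>) \<in> G \<and>
     (\<forall>x y x' y'. (x, y) \<in> G \<longrightarrow> (x', y') \<in> G \<longrightarrow> (x \<oplus>\<^bsub>M\<^esub> x', y \<oplus>\<^bsub>N\<^esub> y') \<in> G) \<and>
     (\<forall>a\<in>carrier A. \<forall>x y. (x, y) \<in> G \<longrightarrow> (a \<odot>\<^bsub>M\<^esub> x, a \<odot>\<^bsub>N\<^esub> y) \<in> G) \<and>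
     (\<forall>z. (\<zero>\<^bsub>M\<^esub>, z) \<in> G \<longrightarrow> z = \<zero>\<^bsub>N\<^esub>)"

text \<open>Baer's criterion. Partial maps are represented by their graphs: a submodule of \<open>M \<times> N\<close>
  is single-valued as soon as it is so over 0.\<close>

lemma injective_extend:
  fixes M (structure)
  assumes inj: "injective_module A N" and M: "left_module A M" and H: "linear_graph A M N H"
  shows "\<exists>g\<in>mod_hom A M N. \<forall>x y. (x, y) \<in> H \<longrightarrow> g x = y"
proof -
  have N: "left_module A N" using inj by (simp add: injective_module_def)
  interpret M: left_module A M by (rule M)
  interpret N: left_module A N by (rule N)
  define graphs where "graphs = {G. H \<subseteq> G \<and> linear_graph A M N G}"
  have "H \<in> graphs" using H by (simp add: graphs_def)
  moreover have "\<Union>\<C> \<in> graphs" if "\<C> \<noteq> {}" and chain: "subset.chain graphs \<C>" for \<C>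
  proof -
    have sub: "H \<subseteq> G" "linear_graph A M N G" if "G \<in> \<C>" for G
      using chain that by (auto simp: subset.chain_def graphs_def)
    note sub' = sub(2)[unfolded linear_graph_def]
    \<comment> \<open>Two pairs from the union lie in a common member of the chain.\<close>
    have add: "(x \<oplus> x', y \<oplus>\<^bsub>N\<^esub> y') \<in> \<Union>\<C>" if pq: "(x, y) \<in> \<Union>\<C>" "(x', y') \<in> \<Union>\<C>" for x y x' y'
    proof -
      obtain P Q where PQ: "P \<in> \<C>" "Q \<in> \<C>" "(x, y) \<in> P" "(x', y') \<in> Q" using pq by blast
      then have "P \<subseteq> Q \<or> Q \<subseteq> P" using chain by (auto simp: subset.chain_def)
      then obtain G where "G \<in> \<C>" "(x, y) \<in> G" "(x', y') \<in> G" using PQ by blast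
      then show ?thesis using sub(2) unfolding linear_graph_def by blast
    qed
    obtain P where "P \<in> \<C>" using \<open>\<C> \<noteq> {}\<close> by blast
    then have "H \<subseteq> \<Union>\<C>" "(\<zero>, \<zero>\<^bsub>N\<^esub>) \<in> \<Union>\<C>" using sub(1) sub' by blast+
    moreover have "\<Union>\<C> \<subseteq> carrier M \<times> carrier N" using sub' by (intro Union_least) blast
    moreover have "\<forall>a\<in>carrier A. \<forall>x y. (x, y) \<in> \<Union>\<C> \<longrightarrow> (a \<odot> x, a \<odot>\<^bsub>N\<^esub> y) \<in> \<Union>\<C>"
      by (meson UnionE UnionI sub')
    moreover have "\<forall>z. (\<zero>, z) \<in> \<Union>\<C> \<longrightarrow> z = \<zero>\<^bsub>N\<^esub>" by (meson UnionE sub')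
    moreover have "\<forall>x y x' y'. (x, y) \<in> \<Union>\<C> \<longrightarrow> (x', y') \<in> \<Union>\<C> \<longrightarrow> (x \<oplus> x', y \<oplus>\<^bsub>N\<^esub> y') \<in> \<Union>\<C>"
      using add by simp
    ultimately show ?thesis
      unfolding graphs_def linear_graph_def mem_Collect_eq by - (intro conjI; assumption)
  qed
  ultimately obtain G where G: "G \<in> graphs" and max: "\<And>G'. G' \<in> graphs \<Longrightarrow> G \<subseteq> G' \<Longrightarrow> G' = G"
    using subset_Zorn_nonempty[of graphs] by blast
  have HG: "H \<subseteq> G" and lin: "linear_graph A M N G" using G by (simp_all add: graphs_def)
  note lin' = lin[unfolded linear_graph_def, rule_format]
  have Gc: "\<And>x y. (x, y) \<in> G \<Longrightarrow> x \<in> carrier M \<and> y \<in> carrier N" and Gzero: "(\<zero>, \<zero>\<^bsub>N\<^esub>) \<in> G"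
    and Gadd: "\<And>x y x' y'. (x, y) \<in> G \<Longrightarrow> (x', y') \<in> G \<Longrightarrow> (x \<oplus> x', y \<oplus>\<^bsub>N\<^esub> y') \<in> G"
    and Gsm: "\<And>a x y. a \<in> carrier A \<Longrightarrow> (x, y) \<in> G \<Longrightarrow> (a \<odot> x, a \<odot>\<^bsub>N\<^esub> y) \<in> G"
    and G0: "\<And>z. (\<zero>, z) \<in> G \<Longrightarrow> z = \<zero>\<^bsub>N\<^esub>"
    by (use lin' in blast, (use lin' in simp)+)
  have Gneg: "(\<ominus> x, \<ominus>\<^bsub>N\<^esub> y) \<in> G" if "(x, y) \<in> G" for x y
    using Gsm[OF _ that, of "\<ominus>\<^bsub>A\<^esub> \<one>\<^bsub>A\<^esub>"] Gc[OF that]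
    by (simp add: smult_minus_left[OF M] smult_minus_left[OF N] M.smult_one N.smult_one)
  have Guniq: "y = y'" if "(x, y) \<in> G" "(x, y') \<in> G" for x y y'
  proof -
    have "(\<zero>, y \<ominus>\<^bsub>N\<^esub> y') \<in> G"
      using Gadd[OF that(1) Gneg[OF that(2)]] Gc[OF that(1)] by (simp add: a_minus_def M.M.r_neg)
    then have "y \<ominus>\<^bsub>N\<^esub> y' = \<zero>\<^bsub>N\<^esub>" by (rule G0)
    then show ?thesis using Gc[OF that(1)] Gc[OF that(2)] N.M.minus_eq_zero_iff by blast
  qed
  \<comment> \<open>For each m some pair (m, n) can be adjoined to the maximal graph; by maximality
    it was there already.\<close>
  have total: "m \<in> Domain G" if m: "m \<in> carrier M" for m
  proof -
    define J where "J = {a \<in> carrier A. a \<odot> m \<in> Domain G}"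
    define f where "f = (\<lambda>a\<in>J. THE y. (a \<odot> m, y) \<in> G)"
    have RA: "left_module A (regular_module A)" by (rule left_module_regular[OF M.A.ring_axioms])
    have J: "submodule J A (regular_module A)"
      using Gzero Gadd Gsm m by (intro submoduleI[OF RA])
        (auto simp: J_def M.smult_l_distr M.smult_assoc smult_zero_left[OF M] Domain_iff; blast)+
    have f: "(a \<odot> m, y) \<in> G \<longleftrightarrow> y = f a" if "a \<in> J" for a y
    proof -
      obtain z where z: "(a \<odot> m, z) \<in> G" using \<open>a \<in> J\<close> by (auto simp: J_def)
      then have "(THE y. (a \<odot> m, y) \<in> G) = z" using Guniq by blast
      then show ?thesis using z Guniq \<open>a \<in> J\<close> by (auto simp: f_def)
    qed
    note J' = submoduleD[OF J]
    have "f \<in> mod_hom A ((regular_module A)\<lparr>carrier := J\<rparr>) N"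
    proof (rule mod_homI)
      fix a b assume ab: "a \<in> carrier (regular_module A\<lparr>carrier := J\<rparr>)" "b \<in> carrier (regular_module A\<lparr>carrier := J\<rparr>)"
      then have "a \<in> carrier A" "b \<in> carrier A" by (simp_all add: J_def)
      then have "((a \<oplus>\<^bsub>A\<^esub> b) \<odot> m, f a \<oplus>\<^bsub>N\<^esub> f b) \<in> G"
        using Gadd[of "a \<odot> m" "f a" "b \<odot> m" "f b"] f ab m J' by (auto simp: M.smult_l_distr)
      then show "f (a \<oplus>\<^bsub>regular_module A\<lparr>carrier := J\<rparr>\<^esub> b) = f a \<oplus>\<^bsub>N\<^esub> f b"
        using f[of "a \<oplus>\<^bsub>A\<^esub> b"] J'(3)[of a b] ab by simp
    next
      fix a b assume ab: "a \<in> carrier A" "b \<in> carrier (regular_module A\<lparr>carrier := J\<rparr>)"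
      then have "b \<in> carrier A" by (simp add: J_def)
      then have "((a \<otimes>\<^bsub>A\<^esub> b) \<odot> m, a \<odot>\<^bsub>N\<^esub> f b) \<in> G"
        using Gsm[of a "b \<odot> m" "f b"] f ab m J' by (auto simp: M.smult_assoc)
      then show "f (a \<odot>\<^bsub>regular_module A\<lparr>carrier := J\<rparr>\<^esub> b) = a \<odot>\<^bsub>N\<^esub> f b"
        using f[of "a \<otimes>\<^bsub>A\<^esub> b"] J'(5)[of a b] ab by simp
    next
      fix a assume "a \<in> carrier (regular_module A\<lparr>carrier := J\<rparr>)"
      then show "f a \<in> carrier N" using f[of a "f a"] Gc by auto
    qed (simp add: f_def)
    \<comment> \<open>The value to be given to m: wherever am already lies in the domain of
      \<open>G\<close>, the prescribed value is an.\<close>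
    then obtain n where n: "n \<in> carrier N" "\<And>a. a \<in> J \<Longrightarrow> f a = a \<odot>\<^bsub>N\<^esub> n"
      using injective_ideal_extend[OF inj J] by blast
    define G' where "G' = {(x \<oplus> a \<odot> m, y \<oplus>\<^bsub>N\<^esub> a \<odot>\<^bsub>N\<^esub> n) | x y a. (x, y) \<in> G \<and> a \<in> carrier A}"
    have GG': "G \<subseteq> G'"
    proof
      fix p assume "p \<in> G"
      then have "p = (fst p \<oplus> \<zero>\<^bsub>A\<^esub> \<odot> m, snd p \<oplus>\<^bsub>N\<^esub> \<zero>\<^bsub>A\<^esub> \<odot>\<^bsub>N\<^esub> n)"
        using Gc[of "fst p" "snd p"] m n by (simp add: smult_zero_left[OF M] smult_zero_left[OF N])
      then show "p \<in> G'" unfolding G'_def using \<open>p \<in> G\<close> M.A.zero_closed by (metis (mono_tags, lifting) CollectI prod.collapse)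
    qed
    have "linear_graph A M N G'"
      unfolding linear_graph_def
    proof (intro conjI ballI allI impI)
      show "G' \<subseteq> carrier M \<times> carrier N"
        using Gc m n by (auto simp: G'_def M.smult_closed N.smult_closed)
      show "(\<zero>, \<zero>\<^bsub>N\<^esub>) \<in> G'" using Gzero GG' by blast
    next
      fix u v u' v' assume "(u, v) \<in> G'" "(u', v') \<in> G'"
      then obtain x y a x' y' a' where
        p: "u = x \<oplus> a \<odot> m" "v = y \<oplus>\<^bsub>N\<^esub> a \<odot>\<^bsub>N\<^esub> n" "(x, y) \<in> G" "a \<in> carrier A" and
        q: "u' = x' \<oplus> a' \<odot> m" "v' = y' \<oplus>\<^bsub>N\<^esub> a' \<odot>\<^bsub>N\<^esub> n" "(x', y') \<in> G" "a' \<in> carrier A"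
        unfolding G'_def by blast
      have "u \<oplus> u' = (x \<oplus> x') \<oplus> (a \<oplus>\<^bsub>A\<^esub> a') \<odot> m"
        "v \<oplus>\<^bsub>N\<^esub> v' = (y \<oplus>\<^bsub>N\<^esub> y') \<oplus>\<^bsub>N\<^esub> (a \<oplus>\<^bsub>A\<^esub> a') \<odot>\<^bsub>N\<^esub> n"
        using p q Gc[OF p(3)] Gc[OF q(3)] m n
        by (simp_all add: M.smult_l_distr N.smult_l_distr M.smult_closed N.smult_closed M.M.a_ac N.M.a_ac)
      then show "(u \<oplus> u', v \<oplus>\<^bsub>N\<^esub> v') \<in> G'"
        unfolding G'_def using Gadd[OF p(3) q(3)] p q by blast
    next
      fix b u v assume b: "b \<in> carrier A" and "(u, v) \<in> G'"
      then obtain x y a where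
        p: "u = x \<oplus> a \<odot> m" "v = y \<oplus>\<^bsub>N\<^esub> a \<odot>\<^bsub>N\<^esub> n" "(x, y) \<in> G" "a \<in> carrier A"
        unfolding G'_def by blast
      have "b \<odot> u = b \<odot> x \<oplus> (b \<otimes>\<^bsub>A\<^esub> a) \<odot> m"
        "b \<odot>\<^bsub>N\<^esub> v = b \<odot>\<^bsub>N\<^esub> y \<oplus>\<^bsub>N\<^esub> (b \<otimes>\<^bsub>A\<^esub> a) \<odot>\<^bsub>N\<^esub> n"
        using p b Gc[OF p(3)] m n
        by (simp_all add: M.smult_r_distr N.smult_r_distr M.smult_assoc N.smult_assoc M.smult_closed N.smult_closed)
      then show "(b \<odot> u, b \<odot>\<^bsub>N\<^esub> v) \<in> G'"
        unfolding G'_def using Gsm[OF b p(3)] p b by blast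
    next
      fix z assume "(\<zero>, z) \<in> G'"
      then obtain x y a where
        p: "\<zero> = x \<oplus> a \<odot> m" "z = y \<oplus>\<^bsub>N\<^esub> a \<odot>\<^bsub>N\<^esub> n" "(x, y) \<in> G" "a \<in> carrier A"
        unfolding G'_def by blast
      \<comment> \<open>Here am = -x already lies in the domain, so \<open>G\<close> prescribes -y
        as its value, and this value is an by the choice of n. Hence y + an = 0.\<close>
      have "\<ominus> x = a \<odot> m"
        using M.M.minus_equality[of "a \<odot> m" x] p(1)[symmetric] Gc[OF p(3)] M.smult_closed[OF p(4) m]
        by (simp only: M.M.a_comm)
      then have am: "(a \<odot> m, \<ominus>\<^bsub>N\<^esub> y) \<in> G" using Gneg[OF p(3)] by simp
      then have aJ: "a \<in> J" using p by (auto simp: J_def)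
      then have "\<ominus>\<^bsub>N\<^esub> y = a \<odot>\<^bsub>N\<^esub> n" using f n am by simp
      then show "z = \<zero>\<^bsub>N\<^esub>" using p Gc[OF p(3)] by (simp flip: \<open>\<ominus>\<^bsub>N\<^esub> y = _\<close> add: N.M.r_neg)
    qed
    then have "G' \<in> graphs" using HG GG' by (auto simp: graphs_def)
    then have "G' = G" using max GG' by blast
    moreover have "(\<zero> \<oplus> \<one>\<^bsub>A\<^esub> \<odot> m, \<zero>\<^bsub>N\<^esub> \<oplus>\<^bsub>N\<^esub> \<one>\<^bsub>A\<^esub> \<odot>\<^bsub>N\<^esub> n) \<in> G'"
      unfolding G'_def using Gzero by blast
    ultimately show ?thesis using m n by (auto simp: M.smult_one)
  qed
  define g where "g = (\<lambda>x\<in>carrier M. THE y. (x, y) \<in> G)"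
  have g: "(x, y) \<in> G \<longleftrightarrow> y = g x" if "x \<in> carrier M" for x y
  proof -
    obtain z where z: "(x, z) \<in> G" using total \<open>x \<in> carrier M\<close> by blast
    then have "(THE y. (x, y) \<in> G) = z" using Guniq by blast
    then show ?thesis using z Guniq that by (auto simp: g_def)
  qed
  show ?thesis
  proof (intro bexI allI impI)
    show "g \<in> mod_hom A M N"
    proof (rule mod_homI)
      show "g x \<in> carrier N" if "x \<in> carrier M" for x using g[OF that, of "g x"] Gc by auto
      show "g (x \<oplus> y) = g x \<oplus>\<^bsub>N\<^esub> g y" if "x \<in> carrier M" "y \<in> carrier M" for x y
        using Gadd[of x "g x" y "g y"] g that by auto
      show "g (a \<odot> x) = a \<odot>\<^bsub>N\<^esub> g x" if "a \<in> carrier A" "x \<in> carrier M" for a x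
        using Gsm[of a x "g x"] g that M.smult_closed by auto
    qed (simp add: g_def)
    fix x y assume "(x, y) \<in> H"
    then have "(x, y) \<in> G" using HG by blast
    then show "g x = y" using g[of x y] Gc[of x y] by simp
  qed
qed

text \<open>The set \<open>I\<close> stands for the sums of maps \<open>g \<circ> \<phi>\<close>.\<close>

lemma injective_factor:
  fixes M (structure)
  assumes inj: "injective_module A N" and M: "left_module A M"
    and F: "finite F" "F \<subseteq> mod_hom A M M" and f: "f \<in> mod_hom A M N"
    and van: "\<And>x. x \<in> carrier M \<Longrightarrow> (\<And>\<phi>. \<phi> \<in> F \<Longrightarrow> \<phi> x = \<zero>) \<Longrightarrow> f x = \<zero>\<^bsub>N\<^esub>"
    and zero: "(\<lambda>x\<in>carrier M. \<zero>\<^bsub>N\<^esub>) \<in> I"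
    and add: "\<And>g h. g \<in> I \<Longrightarrow> h \<in> I \<Longrightarrow> (\<lambda>x\<in>carrier M. g x \<oplus>\<^bsub>N\<^esub> h x) \<in> I"
    and comp: "\<And>\<phi> g. \<phi> \<in> F \<Longrightarrow> g \<in> mod_hom A M N \<Longrightarrow> (\<lambda>x\<in>carrier M. g (\<phi> x)) \<in> I"
  shows "f \<in> I"
  using F f van comp
proof (induction F arbitrary: f rule: finite_induct)
  case empty
  then have "f = (\<lambda>x\<in>carrier M. \<zero>\<^bsub>N\<^esub>)"
    using mod_hom_undefined[OF empty(2)] by (intro ext) auto
  then show ?case by (simp only: zero)
next
  case (insert \<phi> F)
  have N: "left_module A N" using inj by (simp add: injective_module_def)
  interpret M: left_module A M by (rule M)
  interpret N: left_module A N by (rule N)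
  have \<phi>: "\<phi> \<in> mod_hom A M M" and F: "F \<subseteq> mod_hom A M M" using insert.prems by auto
  note f = insert.prems(2)
  \<comment> \<open>One map \<phi> is split off. On the common kernel \<open>L\<close> of the
    remaining maps, f x depends on \<phi> x alone, and injectivity extends the resulting factor to
    all of \<open>M\<close>.\<close>
  define L where "L = {x \<in> carrier M. \<forall>\<psi>\<in>F. \<psi> x = \<zero>}"
  note L = submoduleD[OF submodule_common_kernel[OF M M F], folded L_def]
  have LM: "x \<in> carrier M" if "x \<in> L" for x using that by (simp add: L_def)
  \<comment> \<open>Single-valuedness over 0 is the vanishing hypothesis: an x in \<open>L\<close>
    with \<phi> x = 0 is killed by the whole family. Working with the relation between \<phi> x and
    f x avoids forming a quotient by the kernel of \<phi>.\<close>
  have "linear_graph A M N ((\<lambda>x. (\<phi> x, f x)) ` L)"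
    unfolding linear_graph_def
  proof (intro conjI ballI allI impI)
    show "(\<lambda>x. (\<phi> x, f x)) ` L \<subseteq> carrier M \<times> carrier N"
      using mod_hom_closed[OF \<phi>] mod_hom_closed[OF f] LM by auto
    show "(\<zero>, \<zero>\<^bsub>N\<^esub>) \<in> (\<lambda>x. (\<phi> x, f x)) ` L"
      using mod_hom_zero[OF \<phi> M M] mod_hom_zero[OF f M N] L(2) by (force intro: image_eqI[of _ _ "\<zero>"])
  next
    fix u v u' v' assume "(u, v) \<in> (\<lambda>x. (\<phi> x, f x)) ` L" "(u', v') \<in> (\<lambda>x. (\<phi> x, f x)) ` L"
    then obtain x y where "u = \<phi> x" "v = f x" "u' = \<phi> y" "v' = f y" "x \<in> L" "y \<in> L" by blast
    then show "(u \<oplus> u', v \<oplus>\<^bsub>N\<^esub> v') \<in> (\<lambda>x. (\<phi> x, f x)) ` L"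
      using L(3) LM mod_hom_add[OF \<phi>, of x y] mod_hom_add[OF f, of x y]
      by (intro image_eqI[of _ _ "x \<oplus> y"]) simp_all
  next
    fix a u v assume "a \<in> carrier A" "(u, v) \<in> (\<lambda>x. (\<phi> x, f x)) ` L"
    then obtain x where "u = \<phi> x" "v = f x" "x \<in> L" by blast
    then show "(a \<odot> u, a \<odot>\<^bsub>N\<^esub> v) \<in> (\<lambda>x. (\<phi> x, f x)) ` L"
      using \<open>a \<in> carrier A\<close> L(5) LM mod_hom_smult[OF \<phi>, of a x] mod_hom_smult[OF f, of a x]
      by (intro image_eqI[of _ _ "a \<odot> x"]) simp_all
  next
    fix z assume "(\<zero>, z) \<in> (\<lambda>x. (\<phi> x, f x)) ` L"
    then obtain x where "\<phi> x = \<zero>" "z = f x" "x \<in> L" by auto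
    then show "z = \<zero>\<^bsub>N\<^esub>" using insert.prems(3)[of x] by (auto simp: L_def)
  qed
  then obtain g where g: "g \<in> mod_hom A M N" "\<And>x. x \<in> L \<Longrightarrow> g (\<phi> x) = f x"
    using injective_extend[OF inj M] by (metis (no_types, lifting) image_eqI)
  \<comment> \<open>This difference vanishes on \<open>L\<close>, so the induction hypothesis puts
    it into \<open>I\<close>; adding g \<circ> \<phi> returns f.\<close>
  define k where "k = (\<lambda>x\<in>carrier M. f x \<ominus>\<^bsub>N\<^esub> g (\<phi> x))"
  have c: "f x \<in> carrier N" "g (\<phi> x) \<in> carrier N" if "x \<in> carrier M" for x
    using that mod_hom_closed[OF f] mod_hom_closed[OF g(1)] mod_hom_closed[OF \<phi>] by auto
  have "k \<in> mod_hom A M N"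
  proof (rule mod_homI)
    fix x y assume xy: "x \<in> carrier M" "y \<in> carrier M"
    then show "k (x \<oplus> y) = k x \<oplus>\<^bsub>N\<^esub> k y"
      using c[of x] c[of y] by (simp add: k_def mod_hom_add[OF f] mod_hom_add[OF \<phi>] mod_hom_add[OF g(1)]
        mod_hom_closed[OF \<phi>] a_minus_def N.M.minus_add N.M.a_ac)
  next
    fix a x assume "a \<in> carrier A" "x \<in> carrier M"
    then show "k (a \<odot> x) = a \<odot>\<^bsub>N\<^esub> k x"
      using c[of x] by (simp add: k_def mod_hom_smult[OF f] mod_hom_smult[OF \<phi>] mod_hom_smult[OF g(1)]
        mod_hom_closed[OF \<phi>] a_minus_def N.smult_r_distr smult_minus_right[OF N] M.smult_closed)
  qed (use c in \<open>auto simp: k_def\<close>)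
  moreover have "k x = \<zero>\<^bsub>N\<^esub>" if "x \<in> carrier M" "\<And>\<psi>. \<psi> \<in> F \<Longrightarrow> \<psi> x = \<zero>" for x
  proof -
    have "x \<in> L" using that by (simp add: L_def)
    from g(2)[OF this] show ?thesis using that(1) c[OF that(1)] by (simp add: k_def a_minus_def N.M.r_neg)
  qed
  ultimately have kI: "k \<in> I"
  proof (rule insert.IH[OF F])
    show "(\<lambda>x\<in>carrier M. g (\<psi> x)) \<in> I" if "\<psi> \<in> F" "g \<in> mod_hom A M N" for \<psi> g
      by (rule insert.prems(4)[OF insertI2[OF that(1)] that(2)])
  qed
  have "(\<lambda>x\<in>carrier M. k x \<oplus>\<^bsub>N\<^esub> (\<lambda>x\<in>carrier M. g (\<phi> x)) x) \<in> I"
    by (rule add[OF kI insert.prems(4)[OF insertI1 g(1)]])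
  moreover have "(\<lambda>x\<in>carrier M. k x \<oplus>\<^bsub>N\<^esub> (\<lambda>x\<in>carrier M. g (\<phi> x)) x) = f"
  proof
    fix x
    show "(\<lambda>x\<in>carrier M. k x \<oplus>\<^bsub>N\<^esub> (\<lambda>x\<in>carrier M. g (\<phi> x)) x) x = f x"
      using c[of x] mod_hom_undefined[OF f, of x]
      by (cases "x \<in> carrier M") (simp_all add: k_def a_minus_def N.M.a_assoc N.M.l_neg)
  qed
  ultimately show ?case by (simp only:)
qed

text \<open>By left injectivity a finitely generated right ideal with zero left annihilator contains 1:
  right multiplications by the generators have no common kernel, so the identity factors.\<close>

lemma qf_left_annihilator:
  fixes A (structure)
  assumes qf: "qf_ring A" and J: "submodule J (opp_ring A) (right_regular_module A)"
    and proper: "J \<noteq> carrier A"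
  shows "\<exists>b\<in>carrier A. b \<noteq> \<zero> \<and> (\<forall>a\<in>J. b \<otimes> a = \<zero>)"
proof (rule ccontr)
  assume *: "\<not> ?thesis"
  have ring: "ring A" using qf by (simp add: qf_ring_def left_noetherian_def)
  interpret A: ring A by (rule ring)
  have inj: "injective_module A (regular_module A)" using qf by (simp add: qf_ring_def)
  have M: "left_module A (regular_module A)" by (rule left_module_regular[OF ring])
  have Mr: "right_module A (right_regular_module A)" by (rule left_module_regular[OF ring_opp_ring[OF ring]])
  note J' = submoduleD[OF J, simplified]
  obtain F where F: "F \<subseteq> carrier A" "finite F"
    "J = \<Inter>{J'. submodule J' (opp_ring A) (right_regular_module A) \<and> F \<subseteq> J'}"
  proof -
    have "left_noetherian (opp_ring A)" using qf by (simp add: qf_ring_def right_noetherian_def)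
    then show thesis using J that unfolding left_noetherian_def opp_ring_simps(1) by blast
  qed
  have FJ: "F \<subseteq> J" unfolding F(3) by (rule Inter_greatest) simp
  define \<rho> where "\<rho> a = (\<lambda>x\<in>carrier A. x \<otimes> a)" for a
  have hom: "\<rho> a \<in> mod_hom A (regular_module A) (regular_module A)" if "a \<in> carrier A" for a
    using that by (intro mod_homI) (auto simp: \<rho>_def A.l_distr A.m_assoc)
  \<comment> \<open>The sums of composites are here the right multiplications by elements of
    \<open>J\<close>, so the conclusion amounts to 1 lying in \<open>J\<close>.\<close>
  have "(\<lambda>x\<in>carrier A. x) \<in> \<rho> ` J"
  proof (rule injective_factor[OF inj M, where F = "\<rho> ` F"])
    show "finite (\<rho> ` F)" "\<rho> ` F \<subseteq> mod_hom A (regular_module A) (regular_module A)"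
      using F hom by auto
    show "(\<lambda>x\<in>carrier A. x) \<in> mod_hom A (regular_module A) (regular_module A)"
      by (intro mod_homI) auto
  next
    fix x assume x: "x \<in> carrier (regular_module A)" and "\<And>\<phi>. \<phi> \<in> \<rho> ` F \<Longrightarrow> \<phi> x = \<zero>\<^bsub>regular_module A\<^esub>"
    then have x0: "x \<otimes> a = \<zero>" if "a \<in> F" for a using that by (force simp: \<rho>_def)
    \<comment> \<open>The right annihilator of x is a right ideal containing the generators, hence
      all of \<open>J\<close>; the assumption on \<open>J\<close> then forces x = 0.\<close>
    have "submodule {y \<in> carrier A. x \<otimes> y = \<zero>} (opp_ring A) (right_regular_module A)"
      using x by (intro submoduleI[OF Mr]) (auto simp: A.r_distr simp flip: A.m_assoc)
    then have "J \<subseteq> {y \<in> carrier A. x \<otimes> y = \<zero>}"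
      using F x0 by blast
    then have "x = \<zero>" using * x by auto
    then show "(\<lambda>x\<in>carrier A. x) x = \<zero>\<^bsub>regular_module A\<^esub>" by simp
  next
    show "(\<lambda>x\<in>carrier (regular_module A). \<zero>\<^bsub>regular_module A\<^esub>) \<in> \<rho> ` J"
      using J'(2) by (intro image_eqI[of _ _ "\<zero>"]) (auto simp: \<rho>_def)
  next
    fix g h assume "g \<in> \<rho> ` J" "h \<in> \<rho> ` J"
    then obtain a b where ab: "g = \<rho> a" "h = \<rho> b" "a \<in> J" "b \<in> J" by blast
    then show "(\<lambda>x\<in>carrier (regular_module A). g x \<oplus>\<^bsub>regular_module A\<^esub> h x) \<in> \<rho> ` J"
      using J' by (intro image_eqI[of _ _ "a \<oplus> b"]) (auto simp: \<rho>_def A.r_distr subset_iff)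
  next
    fix \<phi> g assume "\<phi> \<in> \<rho> ` F" and g: "g \<in> mod_hom A (regular_module A) (regular_module A)"
    then obtain a where a: "\<phi> = \<rho> a" "a \<in> F" by blast
    then have aJ: "a \<in> J" "a \<in> carrier A" using FJ J'(1) by auto
    have g1: "g \<one> \<in> carrier A" using mod_hom_closed[OF g, of "\<one>"] by simp
    \<comment> \<open>A left linear endomorphism of \<open>A\<close> is right multiplication by its
      value at 1. Composing it with \<rho> a gives \<rho> (a g(1)), and a g(1) stays in the right
      ideal \<open>J\<close>.\<close>
    have gx: "g x = x \<otimes> g \<one>" if "x \<in> carrier A" for x
      using mod_hom_smult[OF g, of x "\<one>"] that by simp
    have "g (x \<otimes> a) = x \<otimes> (a \<otimes> g \<one>)" if "x \<in> carrier A" for x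
      using gx[of "x \<otimes> a"] that aJ g1 by (simp add: A.m_assoc)
    then have "(\<lambda>x\<in>carrier (regular_module A). g (\<phi> x)) = \<rho> (a \<otimes> g \<one>)"
      by (auto simp: \<rho>_def a(1))
    then show "(\<lambda>x\<in>carrier (regular_module A). g (\<phi> x)) \<in> \<rho> ` J"
      using J'(5)[OF g1 aJ(1)] by blast
  qed
  then obtain a where a: "(\<lambda>x\<in>carrier A. x) = \<rho> a" "a \<in> J" by blast
  then have aA: "a \<in> carrier A" using J'(1) by blast
  have "(\<lambda>x\<in>carrier A. x) \<one> = \<rho> a \<one>" by (simp only: a(1))
  then have "\<one> = a" using aA by (simp add: \<rho>_def)
  then have "J = carrier A" using J'(1) J'(5)[of _ "\<one>"] a(2) by auto
  then show False using proper by simp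
qed

text \<open>The elements a with ca in \<open>X\<close> form a proper right ideal, so some b \<noteq>
  0 kills them from the left. Then x + ca \<mapsto> ba is well defined on X + cA, vanishes on
  \<open>X\<close> and takes the value b at c; right self-injectivity extends it to
  \<open>M\<close>.\<close>

lemma qf_separation:
  fixes M (structure)
  assumes qf: "qf_ring A" and M: "right_module A M" and X: "submodule X (opp_ring A) M"
    and c: "c \<in> carrier M" "c \<notin> X"
  shows "\<exists>f\<in>right_mod_hom A M (right_regular_module A). (\<forall>x\<in>X. f x = \<zero>\<^bsub>A\<^esub>) \<and> f c \<noteq> \<zero>\<^bsub>A\<^esub>"
proof -
  have ring: "ring A" using qf by (simp add: qf_ring_def left_noetherian_def)
  interpret A: ring A by (rule ring)
  interpret M: left_module "opp_ring A" M by (rule M)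
  have inj: "injective_module (opp_ring A) (right_regular_module A)" using qf by (simp add: qf_ring_def)
  have Mr: "right_module A (right_regular_module A)" by (rule left_module_regular[OF ring_opp_ring[OF ring]])
  note X' = submoduleD[OF X, simplified]
  have XM: "x \<in> carrier M" if "x \<in> X" for x using that X'(1) by blast
  have sc [simp]: "a \<odot> x \<in> carrier M" if "a \<in> carrier A" "x \<in> carrier M" for a x
    using that M.smult_closed by simp
  define J where "J = {a \<in> carrier A. a \<odot> c \<in> X}"
  have J: "submodule J (opp_ring A) (right_regular_module A)"
    using X' c M.smult_l_distr[of _ _ c] M.smult_assoc[of _ _ c] smult_zero_left[OF M, of c]
    by (intro submoduleI[OF Mr]) (auto simp: J_def)
  have "\<one>\<^bsub>A\<^esub> \<notin> J" using c M.smult_one by (simp add: J_def)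
  then have "J \<noteq> carrier A" by auto
  then obtain b where b: "b \<in> carrier A" "b \<noteq> \<zero>\<^bsub>A\<^esub>" "\<And>a. a \<in> J \<Longrightarrow> b \<otimes>\<^bsub>A\<^esub> a = \<zero>\<^bsub>A\<^esub>"
    using qf_left_annihilator[OF qf J] by blast
  define G where "G = {(x \<oplus> a \<odot> c, b \<otimes>\<^bsub>A\<^esub> a) | x a. x \<in> X \<and> a \<in> carrier A}"
  have graph: "linear_graph (opp_ring A) M (right_regular_module A) G"
    unfolding linear_graph_def
  proof (intro conjI ballI allI impI)
    show "G \<subseteq> carrier M \<times> carrier (right_regular_module A)" using XM c b by (auto simp: G_def)
    have "(\<zero> \<oplus> \<zero>\<^bsub>A\<^esub> \<odot> c, b \<otimes>\<^bsub>A\<^esub> \<zero>\<^bsub>A\<^esub>) \<in> G" unfolding G_def using X'(2) A.zero_closed by blast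
    then show "(\<zero>, \<zero>\<^bsub>right_regular_module A\<^esub>) \<in> G"
      using smult_zero_left[OF M, of c] c b by simp
  next
    fix u v u' v' assume "(u, v) \<in> G" "(u', v') \<in> G"
    then obtain x a x' a' where p: "u = x \<oplus> a \<odot> c" "v = b \<otimes>\<^bsub>A\<^esub> a" "x \<in> X" "a \<in> carrier A"
      and q: "u' = x' \<oplus> a' \<odot> c" "v' = b \<otimes>\<^bsub>A\<^esub> a'" "x' \<in> X" "a' \<in> carrier A"
      unfolding G_def by blast
    then have "u \<oplus> u' = (x \<oplus> x') \<oplus> (a \<oplus>\<^bsub>A\<^esub> a') \<odot> c" "v \<oplus>\<^bsub>A\<^esub> v' = b \<otimes>\<^bsub>A\<^esub> (a \<oplus>\<^bsub>A\<^esub> a')"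
      using XM c(1) b(1) M.smult_l_distr[of a a' c] by (simp_all add: M.M.a_ac A.r_distr)
    then show "(u \<oplus> u', v \<oplus>\<^bsub>right_regular_module A\<^esub> v') \<in> G"
      unfolding G_def using X'(3)[OF p(3) q(3)] A.a_closed[OF p(4) q(4)] by auto
  next
    fix r u v assume "r \<in> carrier (opp_ring A)" "(u, v) \<in> G"
    then obtain x a where p: "u = x \<oplus> a \<odot> c" "v = b \<otimes>\<^bsub>A\<^esub> a" "x \<in> X" "a \<in> carrier A" "r \<in> carrier A"
      unfolding G_def by auto
    then have "r \<odot> u = r \<odot> x \<oplus> (a \<otimes>\<^bsub>A\<^esub> r) \<odot> c" "v \<otimes>\<^bsub>A\<^esub> r = b \<otimes>\<^bsub>A\<^esub> (a \<otimes>\<^bsub>A\<^esub> r)"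
      using XM c(1) b(1) M.smult_r_distr[of r x "a \<odot> c"] M.smult_assoc[of r a c] by (simp_all add: A.m_assoc)
    then show "(r \<odot> u, r \<odot>\<^bsub>right_regular_module A\<^esub> v) \<in> G"
      unfolding G_def using X'(5)[OF p(5,3)] A.m_closed[OF p(4,5)] by auto
  next
    fix z assume "(\<zero>, z) \<in> G"
    then obtain x a where p: "x \<oplus> a \<odot> c = \<zero>" "z = b \<otimes>\<^bsub>A\<^esub> a" "x \<in> X" "a \<in> carrier A"
      unfolding G_def by auto
    then have "a \<odot> c = \<ominus> x"
      using M.M.minus_equality[of "a \<odot> c" x] XM c(1) by (simp add: M.M.a_comm)
    then have "a \<in> J" using X'(4) p by (simp add: J_def)
    then show "z = \<zero>\<^bsub>right_regular_module A\<^esub>" using b(3) p by simp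
  qed
  obtain g where g: "g \<in> right_mod_hom A M (right_regular_module A)"
    "\<And>x a. x \<in> X \<Longrightarrow> a \<in> carrier A \<Longrightarrow> g (x \<oplus> a \<odot> c) = b \<otimes>\<^bsub>A\<^esub> a"
  proof -
    obtain g where "g \<in> right_mod_hom A M (right_regular_module A)" "\<And>u v. (u, v) \<in> G \<Longrightarrow> g u = v"
      using injective_extend[OF inj M graph] by blast
    then show thesis by (intro that[of g]) (auto simp: G_def)
  qed
  show ?thesis
  proof (intro bexI conjI ballI)
    fix x assume "x \<in> X"
    then show "g x = \<zero>\<^bsub>A\<^esub>"
      using g(2)[of x "\<zero>\<^bsub>A\<^esub>"] XM c(1) smult_zero_left[OF M, of c] b(1) by simp
  next
    have "\<zero> \<oplus> \<one>\<^bsub>A\<^esub> \<odot> c = c" using c M.smult_one[of c] by simp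
    then show "g c \<noteq> \<zero>\<^bsub>A\<^esub>"
      using g(2)[OF X'(2), of "\<one>\<^bsub>A\<^esub>"] b(1,2) by simp
  qed (rule g(1))
qed

section \<open>Tensor products with bimodules\<close>

lemma abelian_group_cong:
  assumes "abelian_group G" "carrier H = carrier G" "\<zero>\<^bsub>H\<^esub> = \<zero>\<^bsub>G\<^esub>" "ring.add H = ring.add G"
  shows "abelian_group H"
  using abelian_groupE[OF assms(1)] unfolding assms(2-4)[symmetric] by (intro abelian_groupI) blast+

lemma rmod_simps [simp]:
  "carrier (rmod C) = carrier C" "\<zero>\<^bsub>rmod C\<^esub> = \<zero>\<^bsub>C\<^esub>" "ring.add (rmod C) = ring.add C"
  "a \<odot>\<^bsub>rmod C\<^esub> c = rsmult C c a"
  by (simp_all add: rmod_def)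

lemma right_tensor_simps [simp]:
  "carrier (right_tensor A M C) = carrier (tensor A M C)" "\<zero>\<^bsub>right_tensor A M C\<^esub> = \<zero>\<^bsub>tensor A M C\<^esub>"
  "ring.add (right_tensor A M C) = ring.add (tensor A M C)"
  by (simp_all add: right_tensor_def)

lemma bimod_tensor_simps [simp]:
  "carrier (bimod_tensor A C D) = carrier (tensor A (rmod C) D)"
  "\<zero>\<^bsub>bimod_tensor A C D\<^esub> = \<zero>\<^bsub>tensor A (rmod C) D\<^esub>"
  "ring.add (bimod_tensor A C D) = ring.add (tensor A (rmod C) D)"
  "rsmult (bimod_tensor A C D) t a = a \<odot>\<^bsub>right_tensor A (rmod C) D\<^esub> t"
  by (simp_all add: bimod_tensor_def Let_def)

text \<open>Each module axiom is additive in the tensor, so pure tensors decide it. \<open>H\<close>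
  and \<open>B\<close> are left open because the lemma serves the right action, with
  \<open>B\<close> the opposite ring, as well as the left action on a product of bimodules.\<close>

lemma (in tensor_product) left_module_tensorI:
  assumes B: "ring B" and H: "carrier H = carrier T" "\<zero>\<^bsub>H\<^esub> = \<zero>\<^bsub>T\<^esub>" "ring.add H = ring.add T"
    and hom: "\<And>a. a \<in> carrier B \<Longrightarrow> (\<lambda>t. a \<odot>\<^bsub>H\<^esub> t) \<in> add_hom T T"
    and add: "\<And>a b m n. a \<in> carrier B \<Longrightarrow> b \<in> carrier B \<Longrightarrow> m \<in> carrier M \<Longrightarrow> n \<in> carrier N \<Longrightarrow>
      (a \<oplus>\<^bsub>B\<^esub> b) \<odot>\<^bsub>H\<^esub> tens A M N m n = a \<odot>\<^bsub>H\<^esub> tens A M N m n \<oplus>\<^bsub>T\<^esub> b \<odot>\<^bsub>H\<^esub> tens A M N m n"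
    and mult: "\<And>a b m n. a \<in> carrier B \<Longrightarrow> b \<in> carrier B \<Longrightarrow> m \<in> carrier M \<Longrightarrow> n \<in> carrier N \<Longrightarrow>
      (a \<otimes>\<^bsub>B\<^esub> b) \<odot>\<^bsub>H\<^esub> tens A M N m n = a \<odot>\<^bsub>H\<^esub> (b \<odot>\<^bsub>H\<^esub> tens A M N m n)"
    and one: "\<And>m n. m \<in> carrier M \<Longrightarrow> n \<in> carrier N \<Longrightarrow> \<one>\<^bsub>B\<^esub> \<odot>\<^bsub>H\<^esub> tens A M N m n = tens A M N m n"
  shows "left_module B H"
proof -
  interpret B: ring B by (rule B)
  note cl = add_hom_closed[OF hom]
  have "(a \<oplus>\<^bsub>B\<^esub> b) \<odot>\<^bsub>H\<^esub> t = a \<odot>\<^bsub>H\<^esub> t \<oplus>\<^bsub>T\<^esub> b \<odot>\<^bsub>H\<^esub> t" "(a \<otimes>\<^bsub>B\<^esub> b) \<odot>\<^bsub>H\<^esub> t = a \<odot>\<^bsub>H\<^esub> (b \<odot>\<^bsub>H\<^esub> t)"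
    if "a \<in> carrier B" "b \<in> carrier B" "t \<in> carrier T" for a b t
    using that(3,1,2)
    by (induction rule: induct) (simp_all add: add mult add_hom_add[OF hom] cl T.a_ac)
  moreover have "\<one>\<^bsub>B\<^esub> \<odot>\<^bsub>H\<^esub> t = t" if "t \<in> carrier T" for t
    using that by (induction rule: induct) (simp_all add: one add_hom_add[OF hom])
  ultimately show ?thesis
    unfolding left_module_def left_module_axioms_def
    using B abelian_group_cong[OF abelian_T H] add_hom_add[OF hom] cl by (simp add: H)
qed

locale bimod =
  fixes A :: "('a, 'k) ring_scheme" (structure) and C :: "('a, 'c, 'm) bimodule_scheme"
  assumes left: "left_module A C" and right: "right_module A (rmod C)"
    and assoc: "\<And>a c b. a \<in> carrier A \<Longrightarrow> c \<in> carrier C \<Longrightarrow> b \<in> carrier A \<Longrightarrow>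
      rsmult C (a \<odot>\<^bsub>C\<^esub> c) b = a \<odot>\<^bsub>C\<^esub> rsmult C c b"
begin

sublocale L: left_module A C by (rule left)

lemma rsmult_closed [simp]: "c \<in> carrier C \<Longrightarrow> a \<in> carrier A \<Longrightarrow> rsmult C c a \<in> carrier C"
  using left_module.smult_closed[OF right, of a c] by simp

lemma rsmult_add:
  "c \<in> carrier C \<Longrightarrow> d \<in> carrier C \<Longrightarrow> a \<in> carrier A \<Longrightarrow>
    rsmult C (c \<oplus>\<^bsub>C\<^esub> d) a = rsmult C c a \<oplus>\<^bsub>C\<^esub> rsmult C d a"
  using left_module.smult_r_distr[OF right, of a c d] by simp

lemma rsmult_add_right:
  "c \<in> carrier C \<Longrightarrow> a \<in> carrier A \<Longrightarrow> b \<in> carrier A \<Longrightarrow>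
    rsmult C c (a \<oplus> b) = rsmult C c a \<oplus>\<^bsub>C\<^esub> rsmult C c b"
  using left_module.smult_l_distr[OF right, of a b c] by simp

lemma rsmult_mult:
  "c \<in> carrier C \<Longrightarrow> a \<in> carrier A \<Longrightarrow> b \<in> carrier A \<Longrightarrow>
    rsmult C c (b \<otimes> a) = rsmult C (rsmult C c b) a"
  using left_module.smult_assoc[OF right, of a b c] by simp

lemma rsmult_one: "c \<in> carrier C \<Longrightarrow> rsmult C c \<one> = c"
  using left_module.smult_one[OF right, of c] by simp

context
  fixes M :: "('a, 'b, 'n) module_scheme"
  assumes M: "right_module A M"
begin

interpretation T: tensor_product A M C
  using M left by (rule tensor_product.intro)

text \<open>The compatibility (ac)b = a(cb) of the two actions on \<open>C\<close> is what makes
  this map balanced over the middle \<open>A\<close>.\<close>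

lemma right_tensor_balanced:
  assumes "a \<in> carrier A"
  shows "balanced A M C (tensor A M C) (\<lambda>m c. tens A M C m (rsmult C c a))"
  using assms by (intro balanced.intro)
    (simp_all add: T.tens_add_left T.tens_add_right T.tens_smult rsmult_add assoc L.smult_closed)

lemma right_tensor_smult_hom:
  "a \<in> carrier A \<Longrightarrow> (\<lambda>t. a \<odot>\<^bsub>right_tensor A M C\<^esub> t) \<in> add_hom (tensor A M C) (tensor A M C)"
  using T.lift_add_hom[OF T.abelian_T right_tensor_balanced] by (simp add: right_tensor_def)

lemma right_tensor_smult_tens:
  "a \<in> carrier A \<Longrightarrow> m \<in> carrier M \<Longrightarrow> c \<in> carrier C \<Longrightarrow>
    a \<odot>\<^bsub>right_tensor A M C\<^esub> tens A M C m c = tens A M C m (rsmult C c a)"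
  using T.lift_tens[OF T.abelian_T right_tensor_balanced] by (simp add: right_tensor_def)

lemma right_tensor_module: "right_module A (right_tensor A M C)"
  by (rule T.left_module_tensorI[OF ring_opp_ring[OF left_module_ring[OF left]]])
    (simp_all add: right_tensor_smult_hom right_tensor_smult_tens rsmult_add_right rsmult_mult rsmult_one T.tens_add_right)

end

context
  fixes D :: "('a, 'd, 'n) bimodule_scheme"
  assumes D: "left_module A D"
begin

interpretation T: tensor_product A "rmod C" D
  using right D by (rule tensor_product.intro)

lemma bimod_tensor_balanced:
  assumes "a \<in> carrier A"
  shows "balanced A (rmod C) D (tensor A (rmod C) D) (\<lambda>c d. tens A (rmod C) D (a \<odot>\<^bsub>C\<^esub> c) d)"
proof (rule balanced.intro, goal_cases)
  case (2 x y n)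
  with assms show ?case
    using T.tens_add_left[of "a \<odot>\<^bsub>C\<^esub> x" "a \<odot>\<^bsub>C\<^esub> y" n] by (simp add: L.smult_closed L.smult_r_distr)
next
  case (3 m x y)
  with assms show ?case
    using T.tens_add_right[of "a \<odot>\<^bsub>C\<^esub> m" x y] by (simp add: L.smult_closed)
next
  case (4 b m n)
  with assms show ?case
    using T.tens_smult[of b "a \<odot>\<^bsub>C\<^esub> m" n] by (simp add: L.smult_closed assoc)
qed (use assms in \<open>simp add: L.smult_closed\<close>)

lemma bimod_tensor_smult_hom:
  "a \<in> carrier A \<Longrightarrow> (\<lambda>t. a \<odot>\<^bsub>bimod_tensor A C D\<^esub> t) \<in> add_hom (tensor A (rmod C) D) (tensor A (rmod C) D)"
  using T.lift_add_hom[OF T.abelian_T bimod_tensor_balanced] by (simp add: bimod_tensor_def Let_def)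

lemma bimod_tensor_smult_tens:
  "a \<in> carrier A \<Longrightarrow> c \<in> carrier C \<Longrightarrow> d \<in> carrier D \<Longrightarrow>
    a \<odot>\<^bsub>bimod_tensor A C D\<^esub> tens A (rmod C) D c d = tens A (rmod C) D (a \<odot>\<^bsub>C\<^esub> c) d"
  using T.lift_tens[OF T.abelian_T bimod_tensor_balanced] by (simp add: bimod_tensor_def Let_def)

lemma bimod_tensor_left_module: "left_module A (bimod_tensor A C D)"
proof (rule T.left_module_tensorI[OF left_module_ring[OF left]])
  fix a b m n assume "a \<in> carrier A" "b \<in> carrier A" "m \<in> carrier (rmod C)" "n \<in> carrier D"
  then show "(a \<oplus> b) \<odot>\<^bsub>bimod_tensor A C D\<^esub> tens A (rmod C) D m n
    = a \<odot>\<^bsub>bimod_tensor A C D\<^esub> tens A (rmod C) D m n \<oplus>\<^bsub>tensor A (rmod C) D\<^esub> b \<odot>\<^bsub>bimod_tensor A C D\<^esub> tens A (rmod C) D m n"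
    using T.tens_add_left[of "a \<odot>\<^bsub>C\<^esub> m" "b \<odot>\<^bsub>C\<^esub> m" n]
    by (simp add: bimod_tensor_smult_tens L.smult_l_distr L.smult_closed)
qed (simp_all add: bimod_tensor_smult_hom bimod_tensor_smult_tens L.smult_assoc L.smult_closed L.smult_one)

end

lemma right_tensor_map_hom:
  assumes M: "right_module A M" and M': "right_module A M'" and f: "f \<in> right_mod_hom A M M'"
  shows "tensor_map A M C M' C f (\<lambda>c. c) \<in> right_mod_hom A (right_tensor A M C) (right_tensor A M' C)"
proof -
  interpret f: tensor_mapping A M C M' C f "\<lambda>c. c" by (rule tensor_mapping_hom[OF M M' left f])
  note h = right_tensor_smult_hom[OF M] and h' = right_tensor_smult_hom[OF M']
  show ?thesis
  proof (rule mod_homI)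
    fix a t assume a: "a \<in> carrier (opp_ring A)" and t: "t \<in> carrier (right_tensor A M C)"
    show "f.fg (a \<odot>\<^bsub>right_tensor A M C\<^esub> t) = a \<odot>\<^bsub>right_tensor A M' C\<^esub> f.fg t"
    proof (rule f.S.hom_eqI[of "\<lambda>t. f.fg (a \<odot>\<^bsub>right_tensor A M C\<^esub> t)" "tensor A M' C" "\<lambda>t. a \<odot>\<^bsub>right_tensor A M' C\<^esub> f.fg t"])
      show "(\<lambda>t. f.fg (a \<odot>\<^bsub>right_tensor A M C\<^esub> t)) \<in> add_hom (tensor A M C) (tensor A M' C)"
        using add_hom_compose[OF h f.map_add_hom] a by simp
      show "(\<lambda>t. a \<odot>\<^bsub>right_tensor A M' C\<^esub> f.fg t) \<in> add_hom (tensor A M C) (tensor A M' C)"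
        using add_hom_compose[OF f.map_add_hom h'] a by simp
    qed (use a t in \<open>simp_all add: right_tensor_smult_tens[OF M] right_tensor_smult_tens[OF M'] f.map_tens mod_hom_closed[OF f]\<close>)
  qed (use f.map_extensional in \<open>auto simp: f.map_closed f.map_add extensional_def\<close>)
qed

end

section \<open>Associativity of the tensor product\<close>

locale tensor_triple = C: bimod A C + D: bimod A D
  for A :: "('a, 'k) ring_scheme" and C :: "('a, 'c, 'm) bimodule_scheme"
    and D :: "('a, 'd, 'n) bimodule_scheme" +
  fixes M :: "('a, 'b, 'o) module_scheme"
  assumes M: "right_module A M"
begin

sublocale MC: tensor_product A M C using M C.left by (rule tensor_product.intro)
sublocale CD: tensor_product A "rmod C" D using C.right D.left by (rule tensor_product.intro)
sublocale MC_D: tensor_product A "right_tensor A M C" D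
  using C.right_tensor_module[OF M] D.left by (rule tensor_product.intro)
sublocale M_CD: tensor_product A M "bimod_tensor A C D"
  using M C.bimod_tensor_left_module[OF D.left] by (rule tensor_product.intro)

abbreviation "T_l \<equiv> tensor A (right_tensor A M C) D"
abbreviation "T_r \<equiv> tensor A M (bimod_tensor A C D)"
abbreviation "tens_l \<equiv> tens A (right_tensor A M C) D"
abbreviation "tens_r \<equiv> tens A M (bimod_tensor A C D)"
abbreviation "tens_m \<equiv> tens A (rmod C) D"
abbreviation "\<alpha> \<equiv> tensor_assoc A M C D"

lemma CD_tens_closed [simp]: "c \<in> carrier C \<Longrightarrow> d \<in> carrier D \<Longrightarrow> tens_m c d \<in> carrier CD.T"
  using CD.tens_closed by simp

lemma M_CD_tens_closed [simp]: "m \<in> carrier M \<Longrightarrow> t \<in> carrier CD.T \<Longrightarrow> tens_r m t \<in> carrier T_r"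
  using M_CD.tens_closed by simp

lemma MC_D_tens_closed [simp]: "t \<in> carrier MC.T \<Longrightarrow> d \<in> carrier D \<Longrightarrow> tens_l t d \<in> carrier T_l"
  using MC_D.tens_closed by simp

text \<open>Threefold pure tensors suffice: with the last factor fixed, uniqueness applies once more
  in the inner product.\<close>

lemma MC_D_eqI:
  assumes "h \<in> add_hom T_l G" "h' \<in> add_hom T_l G" "t \<in> carrier T_l"
    and "\<And>m c d. m \<in> carrier M \<Longrightarrow> c \<in> carrier C \<Longrightarrow> d \<in> carrier D \<Longrightarrow>
      h (tens_l (tens A M C m c) d) = h' (tens_l (tens A M C m c) d)"
  shows "h t = h' t"
proof (rule MC_D.hom_eqI[OF assms(1-3)])
  fix s d assume s: "s \<in> carrier (right_tensor A M C)" and d: "d \<in> carrier D"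
  have *: "(\<lambda>s. tens_l s d) \<in> add_hom MC.T T_l"
    using MC_D.tens_left_add_hom[OF d] by (simp add: add_hom_def)
  show "h (tens_l s d) = h' (tens_l s d)"
    using MC.hom_eqI[OF add_hom_compose[OF * assms(1)] add_hom_compose[OF * assms(2)], of s] s d assms(4) by simp
qed

lemma tens_right_add_hom:
  "m \<in> carrier M \<Longrightarrow> (\<lambda>t. tens_r m t) \<in> add_hom CD.T T_r"
  using M_CD.tens_add_right by (intro add_homI) auto

lemma M_CD_eqI:
  assumes "h \<in> add_hom T_r G" "h' \<in> add_hom T_r G" "t \<in> carrier T_r"
    and "\<And>m c d. m \<in> carrier M \<Longrightarrow> c \<in> carrier C \<Longrightarrow> d \<in> carrier D \<Longrightarrow>
      h (tens_r m (tens_m c d)) = h' (tens_r m (tens_m c d))"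
  shows "h t = h' t"
proof (rule M_CD.hom_eqI[OF assms(1-3)])
  fix m s assume m: "m \<in> carrier M" and s: "s \<in> carrier (bimod_tensor A C D)"
  note * = tens_right_add_hom[OF m]
  show "h (tens_r m s) = h' (tens_r m s)"
    using CD.hom_eqI[OF add_hom_compose[OF * assms(1)] add_hom_compose[OF * assms(2)], of s] s m assms(4) by simp
qed

text \<open>The inner lift of \<open>tensor_assoc\<close> for a fixed last factor:
  \<open>\<gamma> d t\<close> is the value of \<alpha> at t \<otimes> d.\<close>

definition \<gamma> where
  "\<gamma> d = tensor_lift A M C T_r (\<lambda>m c. tens_r m (tens_m c d))"

lemma \<gamma>_balanced:
  assumes "d \<in> carrier D"
  shows "balanced A M C T_r (\<lambda>m c. tens_r m (tens_m c d))"
proof (rule balanced.intro, goal_cases)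
  case (2 x y n)
  with assms show ?case using M_CD.tens_add_left[of x y "tens_m n d"] by simp
next
  case (3 m x y)
  with assms show ?case
    using CD.tens_add_left[of x y d] M_CD.tens_add_right[of m "tens_m x d" "tens_m y d"] by simp
next
  case (4 a m n)
  with assms show ?case
    using M_CD.tens_smult[of a m "tens_m n d"] C.bimod_tensor_smult_tens[OF D.left, of a n d] by simp
qed (use assms in simp)

lemmas \<gamma>_hom = MC.lift_add_hom[OF M_CD.abelian_T \<gamma>_balanced, folded \<gamma>_def]
  and \<gamma>_tens = MC.lift_tens[OF M_CD.abelian_T \<gamma>_balanced, folded \<gamma>_def]

lemma assoc_balanced: "balanced A (right_tensor A M C) D T_r (\<lambda>t d. \<gamma> d t)"
proof (rule balanced.intro, goal_cases)
  case (1 m n)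
  then show ?case using add_hom_closed[OF \<gamma>_hom] by simp
next
  case (2 x y n)
  then show ?case using add_hom_add[OF \<gamma>_hom] by simp
next
  case (3 t x y)
  have "\<gamma> (x \<oplus>\<^bsub>D\<^esub> y) t = (\<lambda>t. \<gamma> x t \<oplus>\<^bsub>T_r\<^esub> \<gamma> y t) t"
  proof (rule MC.hom_eqI)
    show "\<gamma> (x \<oplus>\<^bsub>D\<^esub> y) \<in> add_hom MC.T T_r" using 3 by (intro \<gamma>_hom) simp
    show "(\<lambda>t. \<gamma> x t \<oplus>\<^bsub>T_r\<^esub> \<gamma> y t) \<in> add_hom MC.T T_r"
      using 3 \<gamma>_hom[of x] \<gamma>_hom[of y]
      by (intro add_homI) (simp_all add: add_hom_closed add_hom_add[OF \<gamma>_hom] M_CD.T.a_ac add_hom_closed[OF \<gamma>_hom])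
    show "t \<in> carrier MC.T" using 3 by simp
    fix m c assume mc: "m \<in> carrier M" "c \<in> carrier C"
    have "tens_m c (x \<oplus>\<^bsub>D\<^esub> y) = tens_m c x \<oplus>\<^bsub>CD.T\<^esub> tens_m c y"
      using CD.tens_add_right[of c x y] mc 3 by simp
    then show "\<gamma> (x \<oplus>\<^bsub>D\<^esub> y) (tens A M C m c) = \<gamma> x (tens A M C m c) \<oplus>\<^bsub>T_r\<^esub> \<gamma> y (tens A M C m c)"
      using mc 3 M_CD.tens_add_right[of m "tens_m c x" "tens_m c y"]
      by (simp add: \<gamma>_tens)
  qed
  then show ?case by simp
next
  case (4 a t d)
  have "(\<lambda>t. \<gamma> d (a \<odot>\<^bsub>right_tensor A M C\<^esub> t)) t = \<gamma> (a \<odot>\<^bsub>D\<^esub> d) t"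
  proof (rule MC.hom_eqI[where h = "\<lambda>t. \<gamma> d (a \<odot>\<^bsub>right_tensor A M C\<^esub> t)" and t = t])
    show "(\<lambda>t. \<gamma> d (a \<odot>\<^bsub>right_tensor A M C\<^esub> t)) \<in> add_hom MC.T T_r"
      using 4 by (intro add_hom_compose[OF C.right_tensor_smult_hom[OF M] \<gamma>_hom])
    show "\<gamma> (a \<odot>\<^bsub>D\<^esub> d) \<in> add_hom MC.T T_r" using 4 by (intro \<gamma>_hom D.L.smult_closed)
    show "t \<in> carrier MC.T" using 4 by simp
    fix m c assume mc: "m \<in> carrier M" "c \<in> carrier C"
    then show "\<gamma> d (a \<odot>\<^bsub>right_tensor A M C\<^esub> tens A M C m c) = \<gamma> (a \<odot>\<^bsub>D\<^esub> d) (tens A M C m c)"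
      using 4 CD.tens_smult[of a c d] by (simp add: \<gamma>_tens C.right_tensor_smult_tens[OF M] D.L.smult_closed)
  qed
  then show ?case by simp
qed

lemma \<alpha>_eq: "\<alpha> = tensor_lift A (right_tensor A M C) D T_r (\<lambda>t d. \<gamma> d t)"
  by (simp add: tensor_assoc_def \<gamma>_def Let_def)

lemmas \<alpha>_hom = MC_D.lift_add_hom[OF M_CD.abelian_T assoc_balanced, folded \<alpha>_eq]

lemma \<alpha>_tens:
  "t \<in> carrier MC.T \<Longrightarrow> d \<in> carrier D \<Longrightarrow> \<alpha> (tens_l t d) = \<gamma> d t"
  using MC_D.lift_tens[OF M_CD.abelian_T assoc_balanced, folded \<alpha>_eq] by simp

text \<open>The mirror image of \<gamma> with the first factor fixed, for the inverse map m
  \<otimes> (c \<otimes> d) \<mapsto> (m \<otimes> c) \<otimes> d.\<close>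

definition \<delta> where
  "\<delta> m = tensor_lift A (rmod C) D T_l (\<lambda>c d. tens_l (tens A M C m c) d)"

lemma \<delta>_balanced:
  assumes "m \<in> carrier M"
  shows "balanced A (rmod C) D T_l (\<lambda>c d. tens_l (tens A M C m c) d)"
proof (rule balanced.intro, goal_cases)
  case (2 x y n)
  with assms show ?case
    using MC.tens_add_right[of m x y] MC_D.tens_add_left[of "tens A M C m x" "tens A M C m y" n] by simp
next
  case (3 c x y)
  with assms show ?case using MC_D.tens_add_right[of "tens A M C m c" x y] by simp
next
  case (4 a c n)
  with assms show ?case
    using MC_D.tens_smult[of a "tens A M C m c" n] C.right_tensor_smult_tens[OF M, of a m c] by simp
qed (use assms in simp)

lemmas \<delta>_hom = CD.lift_add_hom[OF MC_D.abelian_T \<delta>_balanced, folded \<delta>_def]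

lemma \<delta>_tens:
  "m \<in> carrier M \<Longrightarrow> c \<in> carrier C \<Longrightarrow> d \<in> carrier D \<Longrightarrow>
    \<delta> m (tens_m c d) = tens_l (tens A M C m c) d"
  using CD.lift_tens[OF MC_D.abelian_T \<delta>_balanced, folded \<delta>_def] by simp

lemma assoc_inv_balanced: "balanced A M (bimod_tensor A C D) T_l \<delta>"
proof (rule balanced.intro, goal_cases)
  case (1 m n)
  then show ?case using add_hom_closed[OF \<delta>_hom] by simp
next
  case (2 x y t)
  have "\<delta> (x \<oplus>\<^bsub>M\<^esub> y) t = (\<lambda>t. \<delta> x t \<oplus>\<^bsub>T_l\<^esub> \<delta> y t) t"
  proof (rule CD.hom_eqI)
    show "\<delta> (x \<oplus>\<^bsub>M\<^esub> y) \<in> add_hom CD.T T_l" using 2 by (intro \<delta>_hom) simp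
    show "(\<lambda>t. \<delta> x t \<oplus>\<^bsub>T_l\<^esub> \<delta> y t) \<in> add_hom CD.T T_l"
      using 2 \<delta>_hom[of x] \<delta>_hom[of y]
      by (intro add_homI) (simp_all add: add_hom_closed add_hom_add[OF \<delta>_hom] MC_D.T.a_ac add_hom_closed[OF \<delta>_hom])
    show "t \<in> carrier CD.T" using 2 by simp
    fix c d assume cd: "c \<in> carrier (rmod C)" "d \<in> carrier D"
    then show "\<delta> (x \<oplus>\<^bsub>M\<^esub> y) (tens_m c d) = \<delta> x (tens_m c d) \<oplus>\<^bsub>T_l\<^esub> \<delta> y (tens_m c d)"
      using 2 MC.tens_add_left[of x y c] MC_D.tens_add_left[of "tens A M C x c" "tens A M C y c" d]
      by (simp add: \<delta>_tens)
  qed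
  then show ?case by simp
next
  case (3 m x y)
  then show ?case using add_hom_add[OF \<delta>_hom] by simp
next
  case (4 a m t)
  have "\<delta> (a \<odot>\<^bsub>M\<^esub> m) t = (\<lambda>t. \<delta> m (a \<odot>\<^bsub>bimod_tensor A C D\<^esub> t)) t"
  proof (rule CD.hom_eqI[where h' = "\<lambda>t. \<delta> m (a \<odot>\<^bsub>bimod_tensor A C D\<^esub> t)" and t = t])
    show "(\<lambda>t. \<delta> m (a \<odot>\<^bsub>bimod_tensor A C D\<^esub> t)) \<in> add_hom CD.T T_l"
      using 4 by (intro add_hom_compose[OF C.bimod_tensor_smult_hom[OF D.left] \<delta>_hom])
    show "\<delta> (a \<odot>\<^bsub>M\<^esub> m) \<in> add_hom CD.T T_l" using 4 by (intro \<delta>_hom MC.M_smult_closed)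
    show "t \<in> carrier CD.T" using 4 by simp
    fix c d assume cd: "c \<in> carrier (rmod C)" "d \<in> carrier D"
    then show "\<delta> (a \<odot>\<^bsub>M\<^esub> m) (tens_m c d) = \<delta> m (a \<odot>\<^bsub>bimod_tensor A C D\<^esub> tens_m c d)"
      using 4 MC.tens_smult[of a m c] by (simp add: \<delta>_tens C.bimod_tensor_smult_tens[OF D.left] C.L.smult_closed)
  qed
  then show ?case by simp
qed

definition \<alpha>_inv where "\<alpha>_inv = tensor_lift A M (bimod_tensor A C D) T_l \<delta>"

lemmas \<alpha>_inv_hom = M_CD.lift_add_hom[OF MC_D.abelian_T assoc_inv_balanced, folded \<alpha>_inv_def]

lemma \<alpha>_inv_tens:
  "m \<in> carrier M \<Longrightarrow> t \<in> carrier CD.T \<Longrightarrow> \<alpha>_inv (tens_r m t) = \<delta> m t"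
  using M_CD.lift_tens[OF MC_D.abelian_T assoc_inv_balanced, folded \<alpha>_inv_def] by simp

text \<open>This side of the inversion makes \<open>\<alpha>_inv\<close> injective, which is what
  transfers flatness to an iterated tensor product.\<close>

lemma \<alpha>_\<alpha>_inv: "t \<in> carrier T_r \<Longrightarrow> \<alpha> (\<alpha>_inv t) = t"
  by (rule M_CD_eqI[OF add_hom_compose[OF \<alpha>_inv_hom \<alpha>_hom], of "\<lambda>t. t"])
    (auto simp: add_hom_def \<alpha>_inv_tens \<alpha>_tens \<delta>_tens \<gamma>_tens)

end

text \<open>Flatness of \<open>C\<close> keeps i \<otimes> C injective, and flatness of
  \<open>D\<close> then does so for (i \<otimes> C) \<otimes> D. Naturality and injectivity of
  \<open>\<alpha>_inv\<close> move the result to X \<otimes> (C \<otimes> D). With both bimodules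
  equal to the coring, this is where coassociativity of a restricted coaction can be tested.\<close>

lemma flat_bimod_tensor:
  assumes bimod: "bimod A C" "bimod A D" and flat: "flat_left_module A C" "flat_left_module A D"
    and X: "right_module A X" and Y: "right_module A Y"
    and i: "i \<in> right_mod_hom A X Y" and inj: "inj_on i (carrier X)"
    and t: "t \<in> carrier (tensor A X (bimod_tensor A C D))"
    and zero: "tensor_map A X (bimod_tensor A C D) Y (bimod_tensor A C D) i (\<lambda>n. n) t = \<zero>\<^bsub>tensor A Y (bimod_tensor A C D)\<^esub>"
  shows "t = \<zero>\<^bsub>tensor A X (bimod_tensor A C D)\<^esub>"
proof -
  interpret X: tensor_triple A C D X using bimod X by (intro tensor_triple.intro tensor_triple_axioms.intro)
  interpret Y: tensor_triple A C D Y using bimod Y by (intro tensor_triple.intro tensor_triple_axioms.intro)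
  interpret i: tensor_mapping A X "bimod_tensor A C D" Y "bimod_tensor A C D" i "\<lambda>n. n"
    by (rule tensor_mapping_hom[OF X Y X.C.bimod_tensor_left_module[OF X.D.left] i])
  interpret iC: tensor_mapping A X C Y C i "\<lambda>n. n"
    by (rule tensor_mapping_hom[OF X Y X.C.left i])
  have XC: "right_module A (right_tensor A X C)" by (rule X.C.right_tensor_module[OF X])
  have YC: "right_module A (right_tensor A Y C)" by (rule X.C.right_tensor_module[OF Y])
  have iCh: "iC.fg \<in> right_mod_hom A (right_tensor A X C) (right_tensor A Y C)"
    by (rule X.C.right_tensor_map_hom[OF X Y i])
  interpret iCD: tensor_mapping A "right_tensor A X C" D "right_tensor A Y C" D iC.fg "\<lambda>n. n"
    by (rule tensor_mapping_hom[OF XC YC X.D.left iCh])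
  have "inj_on iC.fg (carrier (right_tensor A X C))"
    using flat_tensor_map_eq_zero[OF flat(1) X Y i inj] add_hom_inj_iff[OF iC.map_add_hom X.MC.abelian_T Y.MC.abelian_T]
    by simp
  note flat' = flat_tensor_map_eq_zero[OF flat(2) XC YC iCh this]
  have "iCD.fg (X.\<alpha>_inv t) = Y.\<alpha>_inv (i.fg t)"
    by (rule X.M_CD_eqI[OF add_hom_compose[OF X.\<alpha>_inv_hom iCD.map_add_hom] add_hom_compose[OF i.map_add_hom Y.\<alpha>_inv_hom] t])
      (simp add: X.\<alpha>_inv_tens X.\<delta>_tens iCD.map_tens iC.map_tens i.map_tens Y.\<alpha>_inv_tens Y.\<delta>_tens mod_hom_closed[OF i])
  also have "\<dots> = \<zero>\<^bsub>tensor A (right_tensor A Y C) D\<^esub>"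
    unfolding zero by (rule add_hom_zero[OF Y.\<alpha>_inv_hom Y.M_CD.abelian_T Y.MC_D.abelian_T])
  finally have "X.\<alpha>_inv t = \<zero>\<^bsub>tensor A (right_tensor A X C) D\<^esub>"
    using add_hom_closed[OF X.\<alpha>_inv_hom t] by (intro flat')
  then have "X.\<alpha> (X.\<alpha>_inv t) = \<zero>\<^bsub>tensor A X (bimod_tensor A C D)\<^esub>"
    using add_hom_zero[OF X.\<alpha>_hom X.MC_D.abelian_T X.M_CD.abelian_T] by simp
  then show ?thesis using X.\<alpha>_\<alpha>_inv[OF t] by simp
qed

section \<open>Corings and their subcomodules\<close>

locale coring_dual = bimod A C
  for A :: "('a, 'k) ring_scheme" (structure) and C :: "('a, 'c, 'm) coring_scheme" +
  assumes comult_hom: "comult C \<in> bimod_hom A C (bimod_tensor A C C)"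
    and counit_hom: "counit C \<in> bimod_hom A C (regular_bimodule A)"
    and coassoc: "\<And>c. c \<in> carrier C \<Longrightarrow>
      tensor_assoc A (rmod C) C C
        (tensor_map A (rmod C) C (right_tensor A (rmod C) C) C (comult C) (\<lambda>y. y) (comult C c))
      = tensor_map A (rmod C) C (rmod C) (bimod_tensor A C C) (\<lambda>x. x) (comult C) (comult C c)"
    and left_counit: "\<And>c. c \<in> carrier C \<Longrightarrow>
      tensor_lift A (rmod C) C C (\<lambda>x y. counit C x \<odot>\<^bsub>C\<^esub> y) (comult C c) = c"
    and right_counit: "\<And>c. c \<in> carrier C \<Longrightarrow>
      tensor_lift A (rmod C) C C (\<lambda>x y. rsmult C x (counit C y)) (comult C c) = c"

lemma coring_dualI:
  assumes "coring R A C"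
  shows "coring_dual A C"
proof -
  interpret coring R A C by fact
  show ?thesis
    by (intro coring_dual.intro bimod.intro coring_dual_axioms.intro)
      (fact L.left_module_axioms Rt.left_module_axioms bimodule_assoc comult_hom counit_hom coassoc left_counit right_counit)+
qed

context coring_dual
begin

abbreviation \<Delta> where "\<Delta> \<equiv> comult C"
abbreviation \<epsilon> where "\<epsilon> \<equiv> counit C"
abbreviation S where "S \<equiv> dual_ring A C"

sublocale CC: tensor_triple A C C "rmod C"
  by (intro tensor_triple.intro tensor_triple_axioms.intro right bimod_axioms)

lemma ring_A: "ring A"
  by (rule left_module_ring[OF left])

lemma abelian_A: "abelian_group A"
  by (rule ring.is_abelian_group[OF ring_A])

lemma abelian_C: "abelian_group C"
  by (rule left_module_abelian[OF left])

lemma \<Delta>_left: "\<Delta> \<in> mod_hom A C (bimod_tensor A C C)"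
  and \<Delta>_right: "\<Delta> \<in> right_mod_hom A (rmod C) (rmod (bimod_tensor A C C))"
  using comult_hom by (simp_all add: bimod_hom_def)

text \<open>The axiom on the comultiplication speaks of \<open>rmod (bimod_tensor A C C)\<close>,
  coactions of \<open>right_tensor A (rmod C) C\<close>. These are different expressions for the
  same right module.\<close>

lemma \<Delta>_right': "\<Delta> \<in> right_mod_hom A (rmod C) (right_tensor A (rmod C) C)"
  using \<Delta>_right by (simp add: mod_hom_def)

lemma tensor_mapping_\<Delta>_left:
  "tensor_mapping A (rmod C) C (right_tensor A (rmod C) C) C \<Delta> (\<lambda>c. c)"
  by (rule tensor_mapping_hom[OF right right_tensor_module[OF right] left \<Delta>_right'])

lemma tensor_mapping_\<Delta>_right:
  "right_module A M \<Longrightarrow> tensor_mapping A M C M (bimod_tensor A C C) (\<lambda>x. x) \<Delta>"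
  by (intro tensor_mapping.intro tensor_product.intro tensor_mapping_axioms.intro left
      bimod_tensor_left_module[OF left] mod_hom_add_hom[OF \<Delta>_left])
    (simp_all add: add_hom_def mod_hom_smult[OF \<Delta>_left])

lemma \<Delta>_closed [simp]: "c \<in> carrier C \<Longrightarrow> \<Delta> c \<in> carrier CC.MC.T"
  using mod_hom_closed[OF \<Delta>_left] by simp

lemma \<Delta>_add_hom: "\<Delta> \<in> add_hom C CC.MC.T"
  using mod_hom_add_hom[OF \<Delta>_left] by (simp add: add_hom_def)

lemma \<epsilon>_closed [simp]: "c \<in> carrier C \<Longrightarrow> \<epsilon> c \<in> carrier A"
  and \<epsilon>_add: "c \<in> carrier C \<Longrightarrow> d \<in> carrier C \<Longrightarrow> \<epsilon> (c \<oplus>\<^bsub>C\<^esub> d) = \<epsilon> c \<oplus> \<epsilon> d"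
  and \<epsilon>_smult: "a \<in> carrier A \<Longrightarrow> c \<in> carrier C \<Longrightarrow> \<epsilon> (a \<odot>\<^bsub>C\<^esub> c) = a \<otimes> \<epsilon> c"
  and \<epsilon>_rsmult: "a \<in> carrier A \<Longrightarrow> c \<in> carrier C \<Longrightarrow> \<epsilon> (rsmult C c a) = \<epsilon> c \<otimes> a"
  using counit_hom by (auto simp: bimod_hom_def mod_hom_def regular_bimodule_def rmod_def)

section \<open>Functionals and the endomorphisms they induce\<close>

lemma dual_carrier: "carrier S = right_mod_hom A (rmod C) (right_regular_module A)"
  by (simp add: dual_ring_def)

lemma dualI:
  assumes "\<And>c. c \<in> carrier C \<Longrightarrow> f c \<in> carrier A" "\<And>c. c \<notin> carrier C \<Longrightarrow> f c = undefined"
    "\<And>c d. c \<in> carrier C \<Longrightarrow> d \<in> carrier C \<Longrightarrow> f (c \<oplus>\<^bsub>C\<^esub> d) = f c \<oplus> f d"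
    "\<And>a c. a \<in> carrier A \<Longrightarrow> c \<in> carrier C \<Longrightarrow> f (rsmult C c a) = f c \<otimes> a"
  shows "f \<in> carrier S"
  unfolding dual_carrier by (rule mod_homI) (use assms in auto)

lemma dual_closed [simp]: "f \<in> carrier S \<Longrightarrow> c \<in> carrier C \<Longrightarrow> f c \<in> carrier A"
  and dual_add: "f \<in> carrier S \<Longrightarrow> c \<in> carrier C \<Longrightarrow> d \<in> carrier C \<Longrightarrow> f (c \<oplus>\<^bsub>C\<^esub> d) = f c \<oplus> f d"
  and dual_rsmult: "f \<in> carrier S \<Longrightarrow> c \<in> carrier C \<Longrightarrow> a \<in> carrier A \<Longrightarrow> f (rsmult C c a) = f c \<otimes> a"
  and dual_undefined: "f \<in> carrier S \<Longrightarrow> c \<notin> carrier C \<Longrightarrow> f c = undefined"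
  by (auto simp: dual_carrier mod_hom_def)

lemma dual_add_hom: "f \<in> carrier S \<Longrightarrow> f \<in> add_hom C A"
  by (intro add_homI) (auto simp: dual_add)

lemma \<epsilon>_dual: "\<epsilon> \<in> carrier S"
  using counit_hom by (intro dualI) (auto simp: \<epsilon>_add \<epsilon>_rsmult bimod_hom_def mod_hom_def)

text \<open>f \<otimes> C followed by the identification of A \<otimes> C with \<open>C\<close>.
  Separating it from \<Delta> gives an additive map on all tensors, to which uniqueness on pure
  tensors applies.\<close>

definition \<Lambda> where "\<Lambda> f = tensor_lift A (rmod C) C C (\<lambda>x y. f x \<odot>\<^bsub>C\<^esub> y)"

lemma \<Lambda>_balanced:
  assumes "f \<in> carrier S"
  shows "balanced A (rmod C) C C (\<lambda>x y. f x \<odot>\<^bsub>C\<^esub> y)"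
  using assms by (intro balanced.intro)
    (simp_all add: L.smult_closed dual_add dual_rsmult L.smult_l_distr L.smult_r_distr L.smult_assoc)

lemmas \<Lambda>_hom = CC.MC.lift_add_hom[OF abelian_C \<Lambda>_balanced, folded \<Lambda>_def]

lemma \<Lambda>_tens:
  "f \<in> carrier S \<Longrightarrow> x \<in> carrier C \<Longrightarrow> y \<in> carrier C \<Longrightarrow> \<Lambda> f (tens A (rmod C) C x y) = f x \<odot>\<^bsub>C\<^esub> y"
  using CC.MC.lift_tens[OF abelian_C \<Lambda>_balanced, folded \<Lambda>_def] by simp

definition \<phi> where "\<phi> f = (\<lambda>c\<in>carrier C. \<Lambda> f (\<Delta> c))"

lemma \<phi>_eq: "c \<in> carrier C \<Longrightarrow> \<phi> f c = \<Lambda> f (\<Delta> c)"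
  by (simp add: \<phi>_def)

lemma \<phi>_closed [simp]: "f \<in> carrier S \<Longrightarrow> c \<in> carrier C \<Longrightarrow> \<phi> f c \<in> carrier C"
  by (simp add: \<phi>_eq add_hom_closed[OF \<Lambda>_hom])

lemma \<Lambda>_right_smult:
  assumes f: "f \<in> carrier S" and a: "a \<in> carrier A" and t: "t \<in> carrier CC.MC.T"
  shows "\<Lambda> f (a \<odot>\<^bsub>right_tensor A (rmod C) C\<^esub> t) = rsmult C (\<Lambda> f t) a"
proof (rule CC.MC.hom_eqI[where h = "\<lambda>t. \<Lambda> f (a \<odot>\<^bsub>right_tensor A (rmod C) C\<^esub> t)" and h' = "\<lambda>t. rsmult C (\<Lambda> f t) a"])
  show "(\<lambda>t. \<Lambda> f (a \<odot>\<^bsub>right_tensor A (rmod C) C\<^esub> t)) \<in> add_hom CC.MC.T C"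
    by (rule add_hom_compose[OF right_tensor_smult_hom[OF right a] \<Lambda>_hom[OF f]])
  have "(\<lambda>c. rsmult C c a) \<in> add_hom C C" using a by (intro add_homI) (simp_all add: rsmult_add)
  then show "(\<lambda>t. rsmult C (\<Lambda> f t) a) \<in> add_hom CC.MC.T C"
    by (rule add_hom_compose[OF \<Lambda>_hom[OF f]])
  fix m n assume "m \<in> carrier (rmod C)" "n \<in> carrier C"
  then show "\<Lambda> f (a \<odot>\<^bsub>right_tensor A (rmod C) C\<^esub> tens A (rmod C) C m n) = rsmult C (\<Lambda> f (tens A (rmod C) C m n)) a"
    using f a by (simp add: right_tensor_smult_tens[OF right] \<Lambda>_tens assoc)
qed (rule t)

lemma \<phi>_hom:
  assumes "f \<in> carrier S"
  shows "\<phi> f \<in> right_mod_hom A (rmod C) (rmod C)"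
proof (rule mod_homI)
  fix a x assume "a \<in> carrier (opp_ring A)" "x \<in> carrier (rmod C)"
  then show "\<phi> f (a \<odot>\<^bsub>rmod C\<^esub> x) = a \<odot>\<^bsub>rmod C\<^esub> \<phi> f x"
    using assms mod_hom_smult[OF \<Delta>_right', of a x] by (simp add: \<phi>_eq \<Lambda>_right_smult)
qed (use assms in \<open>simp_all add: add_hom_closed[OF \<Lambda>_hom] \<phi>_eq add_hom_add[OF \<Delta>_add_hom] add_hom_add[OF \<Lambda>_hom]\<close>,
  simp add: \<phi>_def)

text \<open>On a pure tensor both sides give g(f(x) y). In this form a product in the dual is a
  composite in which the endomorphism of the left factor acts before the right factor is
  evaluated.\<close>

lemma dual_mult:
  assumes "f \<in> carrier S" "g \<in> carrier S" "c \<in> carrier C"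
  shows "(f \<otimes>\<^bsub>S\<^esub> g) c = g (\<phi> f c)"
proof -
  have "(f \<otimes>\<^bsub>S\<^esub> g) c = tensor_lift A (rmod C) C A (\<lambda>x y. g (f x \<odot>\<^bsub>C\<^esub> y)) (\<Delta> c)"
    using assms by (simp add: dual_ring_def)
  also have "\<dots> = g (\<Lambda> f (\<Delta> c))"
  proof (rule CC.MC.lift_eqI[OF abelian_A])
    show "balanced A (rmod C) C A (\<lambda>x y. g (f x \<odot>\<^bsub>C\<^esub> y))"
      using assms balanced.add_left[OF \<Lambda>_balanced[OF assms(1)]] balanced.add_right[OF \<Lambda>_balanced[OF assms(1)]]
        balanced.smult[OF \<Lambda>_balanced[OF assms(1)]]
      by (intro balanced.intro) (simp_all add: L.smult_closed dual_add)
    show "(\<lambda>t. g (\<Lambda> f t)) \<in> add_hom CC.MC.T A"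
      by (rule add_hom_compose[OF \<Lambda>_hom[OF assms(1)] dual_add_hom[OF assms(2)]])
  qed (use assms in \<open>simp_all add: \<Lambda>_tens\<close>)
  finally show ?thesis using assms by (simp add: \<phi>_eq)
qed

lemma dual_add_apply: "c \<in> carrier C \<Longrightarrow> (f \<oplus>\<^bsub>S\<^esub> g) c = f c \<oplus> g c"
  by (simp add: dual_ring_def)

lemma dual_zero: "\<zero>\<^bsub>S\<^esub> = (\<lambda>c\<in>carrier C. \<zero>)"
  by (simp add: dual_ring_def)

text \<open>With c1, c2 the legs of \<Delta> c, the right counit law gives \<epsilon>(f(c1) c2) =
  f(c1) \<epsilon>(c2) = f(c1 \<epsilon>(c2)) = f(c). Thus f is recovered from \<phi> f, and \<phi>
  f c = 0 forces f c = 0.\<close>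

lemma \<epsilon>_\<phi>:
  assumes f: "f \<in> carrier S" and c: "c \<in> carrier C"
  shows "\<epsilon> (\<phi> f c) = f c"
proof -
  define r where "r = tensor_lift A (rmod C) C C (\<lambda>x y. rsmult C x (\<epsilon> y))"
  have bal: "balanced A (rmod C) C C (\<lambda>x y. rsmult C x (\<epsilon> y))"
    by (intro balanced.intro) (simp_all add: rsmult_add rsmult_add_right \<epsilon>_add \<epsilon>_smult rsmult_mult)
  note r = CC.MC.lift_add_hom[OF abelian_C bal, folded r_def] CC.MC.lift_tens[OF abelian_C bal, folded r_def]
  have "(\<lambda>t. \<epsilon> (\<Lambda> f t)) (\<Delta> c) = (\<lambda>t. f (r t)) (\<Delta> c)"
  proof (rule CC.MC.hom_eqI[where h = "\<lambda>t. \<epsilon> (\<Lambda> f t)" and h' = "\<lambda>t. f (r t)"])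
    show "(\<lambda>t. \<epsilon> (\<Lambda> f t)) \<in> add_hom CC.MC.T A"
      by (rule add_hom_compose[OF \<Lambda>_hom[OF f] dual_add_hom[OF \<epsilon>_dual]])
    show "(\<lambda>t. f (r t)) \<in> add_hom CC.MC.T A"
      by (rule add_hom_compose[OF r(1) dual_add_hom[OF f]])
  qed (use f c in \<open>simp_all add: \<Lambda>_tens r(2) \<epsilon>_smult dual_rsmult\<close>)
  then show ?thesis using c right_counit[OF c] by (simp add: \<phi>_eq r_def)
qed

text \<open>Applying \<open>x \<otimes> t \<mapsto> f(x) t\<close> to both sides of coassociativity gives colinearity of \<open>\<phi> f\<close>.\<close>

lemma \<phi>_comod_End:
  assumes f: "f \<in> carrier S"
  shows "\<phi> f \<in> comod_End A C"
proof -
  let ?BT = "bimod_tensor A C C" and ?T2 = "tensor A (rmod C) (bimod_tensor A C C)"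
  have BT: "left_module A ?BT" by (rule bimod_tensor_left_module[OF left])
  note BT_ab = left_module_abelian[OF BT]
  define h where "h = tensor_lift A (rmod C) ?BT ?BT (\<lambda>x t. f x \<odot>\<^bsub>?BT\<^esub> t)"
  have bal: "balanced A (rmod C) ?BT ?BT (\<lambda>x t. f x \<odot>\<^bsub>?BT\<^esub> t)"
    using f left_module.smult_closed[OF BT] left_module.smult_l_distr[OF BT] left_module.smult_r_distr[OF BT]
      left_module.smult_assoc[OF BT]
    by (intro balanced.intro) (simp_all add: dual_add dual_rsmult)
  have hh: "h \<in> add_hom ?T2 CC.MC.T"
    using CC.M_CD.lift_add_hom[OF BT_ab bal, folded h_def] by (simp add: add_hom_def)
  have ht: "h (tens A (rmod C) ?BT x t) = f x \<odot>\<^bsub>?BT\<^esub> t" if "x \<in> carrier C" "t \<in> carrier CC.MC.T" for x t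
    using CC.M_CD.lift_tens[OF BT_ab bal, folded h_def] that by simp
  interpret \<phi>: tensor_mapping A "rmod C" C "rmod C" C "\<phi> f" "\<lambda>c. c"
    by (rule tensor_mapping_hom[OF right right left \<phi>_hom[OF f]])
  interpret \<Delta>1: tensor_mapping A "rmod C" C "right_tensor A (rmod C) C" C \<Delta> "\<lambda>c. c"
    by (rule tensor_mapping_\<Delta>_left)
  interpret \<Delta>2: tensor_mapping A "rmod C" C "rmod C" ?BT "\<lambda>x. x" \<Delta>
    by (rule tensor_mapping_\<Delta>_right[OF right])
  have "\<Delta> (\<phi> f c) = \<phi>.fg (\<Delta> c)" if c: "c \<in> carrier C" for c
  proof -
    \<comment> \<open>\<Delta> is left linear, so \<Delta>(f(c1) c2) = f(c1) \<Delta>(c2).\<close>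
    have "\<Delta> (\<Lambda> f (\<Delta> c)) = h (\<Delta>2.fg (\<Delta> c))"
    proof (rule CC.MC.hom_eqI[OF add_hom_compose[OF \<Lambda>_hom[OF f] \<Delta>_add_hom] add_hom_compose[OF \<Delta>2.map_add_hom hh] \<Delta>_closed[OF c]])
      fix x y assume "x \<in> carrier (rmod C)" "y \<in> carrier C"
      then show "\<Delta> (\<Lambda> f (tens A (rmod C) C x y)) = h (\<Delta>2.fg (tens A (rmod C) C x y))"
        using f by (simp add: \<Lambda>_tens \<Delta>2.map_tens ht mod_hom_smult[OF \<Delta>_left])
    qed
    also have "\<Delta>2.fg (\<Delta> c) = CC.\<alpha> (\<Delta>1.fg (\<Delta> c))" using coassoc[OF c] by simp
    also have "h (CC.\<alpha> (\<Delta>1.fg (\<Delta> c))) = \<phi>.fg (\<Delta> c)"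
    proof (rule CC.MC.hom_eqI[OF add_hom_compose[OF add_hom_compose[OF \<Delta>1.map_add_hom CC.\<alpha>_hom] hh] \<phi>.map_add_hom \<Delta>_closed[OF c]])
      fix x y assume xy: "x \<in> carrier (rmod C)" "y \<in> carrier C"
      have "h (CC.\<alpha> (\<Delta>1.fg (tens A (rmod C) C x y))) = h (CC.\<gamma> y (\<Delta> x))"
        using xy by (simp add: \<Delta>1.map_tens CC.\<alpha>_tens)
      \<comment> \<open>With y fixed, both sides send a pure tensor m \<otimes> n in place of
        \<Delta> x to f(m) n \<otimes> y.\<close>
      also have "\<dots> = tens A (rmod C) C (\<Lambda> f (\<Delta> x)) y"
      proof (rule CC.MC.hom_eqI[OF add_hom_compose[OF CC.\<gamma>_hom hh] add_hom_compose[OF \<Lambda>_hom[OF f]], where t = "\<Delta> x"])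
        show "(\<lambda>m. tens A (rmod C) C m y) \<in> add_hom C CC.MC.T"
          using CC.MC.tens_left_add_hom[OF xy(2)] by (simp add: add_hom_def)
        fix m n assume "m \<in> carrier (rmod C)" "n \<in> carrier C"
        then show "h (CC.\<gamma> y (tens A (rmod C) C m n)) = tens A (rmod C) C (\<Lambda> f (tens A (rmod C) C m n)) y"
          using f xy by (simp add: CC.\<gamma>_tens ht \<Lambda>_tens bimod_tensor_smult_tens[OF left])
      qed (use xy in simp_all)
      also have "\<dots> = \<phi>.fg (tens A (rmod C) C x y)"
        using xy by (simp add: \<phi>.map_tens \<phi>_eq)
      finally show "h (CC.\<alpha> (\<Delta>1.fg (tens A (rmod C) C x y))) = \<phi>.fg (tens A (rmod C) C x y)" .
    qed
    finally show ?thesis using c by (simp add: \<phi>_eq)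
  qed
  then show ?thesis
    unfolding comod_End_def comod_hom_def using \<phi>_hom[OF f] by simp
qed

text \<open>Take f = \<epsilon> \<circ> \<psi>. Colinearity turns \<epsilon>(\<psi>(c1)) c2 into
  \<epsilon>(d1) d2 for d = \<psi> c, which is d by the left counit law.\<close>

lemma comod_End_\<phi>:
  assumes "\<psi> \<in> comod_End A C"
  shows "\<exists>f\<in>carrier S. \<phi> f = \<psi>"
proof
  have \<psi>: "\<psi> \<in> right_mod_hom A (rmod C) (rmod C)"
    and co: "\<And>c. c \<in> carrier C \<Longrightarrow> \<Delta> (\<psi> c) = tensor_map A (rmod C) C (rmod C) C \<psi> (\<lambda>c. c) (\<Delta> c)"
    using assms by (auto simp: comod_End_def comod_hom_def)
  interpret \<psi>: tensor_mapping A "rmod C" C "rmod C" C \<psi> "\<lambda>c. c"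
    by (rule tensor_mapping_hom[OF right right left \<psi>])
  have cl: "\<psi> c \<in> carrier C" if "c \<in> carrier C" for c using mod_hom_closed[OF \<psi>] that by simp
  define f where "f = (\<lambda>c\<in>carrier C. \<epsilon> (\<psi> c))"
  show f: "f \<in> carrier S"
    using mod_hom_add[OF \<psi>] mod_hom_smult[OF \<psi>] cl
    by (intro dualI) (simp_all add: f_def \<epsilon>_add \<epsilon>_rsmult)
  have "\<phi> f c = \<psi> c" if c: "c \<in> carrier C" for c
  proof -
    have "\<Lambda> f (\<Delta> c) = \<Lambda> \<epsilon> (\<psi>.fg (\<Delta> c))"
    proof (rule CC.MC.hom_eqI[OF \<Lambda>_hom[OF f] add_hom_compose[OF \<psi>.map_add_hom \<Lambda>_hom[OF \<epsilon>_dual]] \<Delta>_closed[OF c]])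
      fix x y assume "x \<in> carrier (rmod C)" "y \<in> carrier C"
      then show "\<Lambda> f (tens A (rmod C) C x y) = \<Lambda> \<epsilon> (\<psi>.fg (tens A (rmod C) C x y))"
        using f \<epsilon>_dual cl by (simp add: \<Lambda>_tens \<psi>.map_tens) (simp add: f_def)
    qed
    also have "\<dots> = \<psi> c" using co[OF c] left_counit[OF cl[OF c]] by (simp add: \<Lambda>_def)
    finally show ?thesis using c by (simp add: \<phi>_eq)
  qed
  then show "\<phi> f = \<psi>"
    using mod_hom_eqI[OF \<phi>_hom[OF f] \<psi>] by simp
qed

lemma comod_End_eq: "comod_End A C = \<phi> ` carrier S"
  using \<phi>_comod_End comod_End_\<phi> by blast

text \<open>\<Delta> x comes from X \<otimes> C, so only values of f on \<open>X\<close> occur in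
  f(x1) x2. This is what makes the annihilator of a subcomodule a right ideal.\<close>

lemma subcomodule_\<phi>_zero:
  assumes X: "right_subcomodule A C X" and f: "f \<in> carrier S" "\<And>x. x \<in> X \<Longrightarrow> f x = \<zero>" and x: "x \<in> X"
  shows "\<phi> f x = \<zero>\<^bsub>C\<^esub>"
proof -
  let ?X = "rmod C\<lparr>carrier := X\<rparr>"
  have sub: "submodule X (opp_ring A) (rmod C)" using X by (simp add: right_subcomodule_def)
  have Xm: "right_module A ?X" by (rule left_module_submodule[OF right sub])
  have xC: "x \<in> carrier C" using submoduleD(1)[OF sub] x by auto
  define \<iota> where "\<iota> = (\<lambda>x\<in>X. x)"
  have \<iota>: "\<iota> \<in> right_mod_hom A ?X (rmod C)" unfolding \<iota>_def by (rule mod_hom_incl[OF sub])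
  obtain \<rho> where "right_comodule A C ?X \<rho>" "\<iota> \<in> comod_hom A C ?X \<rho> (rmod C) \<Delta>"
    using X by (auto simp: right_subcomodule_def \<iota>_def)
  then have \<rho>: "\<rho> x \<in> carrier (tensor A ?X C)" "\<Delta> x = tensor_map A ?X C (rmod C) C \<iota> (\<lambda>c. c) (\<rho> x)"
    using x mod_hom_closed[of \<rho> "opp_ring A" ?X "right_tensor A ?X C" x]
    by (auto simp: right_comodule_def comod_hom_def \<iota>_def)
  interpret \<iota>: tensor_mapping A ?X C "rmod C" C \<iota> "\<lambda>c. c"
    by (rule tensor_mapping_hom[OF Xm right left \<iota>])
  have "\<Lambda> f (\<iota>.fg (\<rho> x)) = (\<lambda>_. \<zero>\<^bsub>C\<^esub>) (\<rho> x)"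
  proof (rule \<iota>.S.hom_eqI[OF add_hom_compose[OF \<iota>.map_add_hom \<Lambda>_hom[OF f(1)]] _ \<rho>(1), where h' = "\<lambda>_. \<zero>\<^bsub>C\<^esub>"])
    show "(\<lambda>_. \<zero>\<^bsub>C\<^esub>) \<in> add_hom (tensor A ?X C) C"
      by (intro add_homI) simp_all
    fix m c assume "m \<in> carrier ?X" "c \<in> carrier C"
    moreover from this have "\<iota> m = m" "m \<in> carrier C"
      using submoduleD(1)[OF sub] by (auto simp: \<iota>_def)
    ultimately show "\<Lambda> f (\<iota>.fg (tens A ?X C m c)) = \<zero>\<^bsub>C\<^esub>"
      using f smult_zero_left[OF left] by (simp add: \<iota>.map_tens \<Lambda>_tens)
  qed
  then show ?thesis using \<rho>(2) xC by (simp add: \<phi>_eq)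
qed

text \<open>Flatness makes the image of \<open>K \<otimes> C\<close> in \<open>C \<otimes> C\<close> a copy of \<open>K \<otimes> C\<close>, which transports
  coassociativity.\<close>

lemma right_subcomoduleI:
  assumes flat: "flat_left_module A C" and sub: "submodule K (opp_ring A) (rmod C)"
    and ex: "\<And>k. k \<in> K \<Longrightarrow> \<exists>s\<in>carrier (tensor A (rmod C\<lparr>carrier := K\<rparr>) C).
      tensor_map A (rmod C\<lparr>carrier := K\<rparr>) C (rmod C) C (\<lambda>x\<in>K. x) (\<lambda>c. c) s = \<Delta> k"
  shows "right_subcomodule A C K"
proof -
  define KM where "KM = rmod C\<lparr>carrier := K\<rparr>"
  have KM: "right_module A KM" unfolding KM_def by (rule left_module_submodule[OF right sub])
  define \<iota> where "\<iota> = (\<lambda>x\<in>K. x)"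
  have \<iota>: "\<iota> \<in> right_mod_hom A KM (rmod C)" unfolding \<iota>_def KM_def by (rule mod_hom_incl[OF sub])
  have KM_simps [simp]: "carrier KM = K" "ring.add KM = ring.add C" "\<And>a x. a \<odot>\<^bsub>KM\<^esub> x = rsmult C x a" "\<zero>\<^bsub>KM\<^esub> = \<zero>\<^bsub>C\<^esub>"
    by (simp_all add: KM_def)
  have KC: "k \<in> carrier C" if "k \<in> K" for k using submoduleD(1)[OF sub] that by auto
  have \<iota>_eq [simp]: "\<iota> k = k" if "k \<in> K" for k using that by (simp add: \<iota>_def)
  have \<iota>_inj: "inj_on \<iota> (carrier KM)" by (auto simp: inj_on_def)
  note K = submoduleD(2-)[OF sub, simplified]
  interpret KT: tensor_triple A C C KM by (intro tensor_triple.intro tensor_triple_axioms.intro KM bimod_axioms)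
  interpret \<iota>: tensor_mapping A KM C "rmod C" C \<iota> "\<lambda>c. c"
    by (rule tensor_mapping_hom[OF KM right left \<iota>])
  let ?KC = "right_tensor A KM C" and ?CC = "right_tensor A (rmod C) C" and ?BT = "bimod_tensor A C C"
  have KCm: "right_module A ?KC" by (rule right_tensor_module[OF KM])
  have CCm: "right_module A ?CC" by (rule right_tensor_module[OF right])
  have BT: "left_module A ?BT" by (rule bimod_tensor_left_module[OF left])
  have \<iota>C: "\<iota>.fg \<in> right_mod_hom A ?KC ?CC" by (rule right_tensor_map_hom[OF KM right \<iota>])
  have inj: "inj_on \<iota>.fg (carrier KT.MC.T)"
    using flat_tensor_map_eq_zero[OF flat KM right \<iota> \<iota>_inj] add_hom_inj_iff[OF \<iota>.map_add_hom KT.MC.abelian_T CC.MC.abelian_T]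
    by simp
  \<comment> \<open>The choice is harmless: since \<iota> \<otimes> C is injective the preimage of
    \<Delta> k is unique, and uniqueness also yields additivity and linearity.\<close>
  define \<rho> where "\<rho> = (\<lambda>k\<in>K. SOME s. s \<in> carrier KT.MC.T \<and> \<iota>.fg s = \<Delta> k)"
  have \<rho>: "\<rho> k \<in> carrier KT.MC.T" "\<iota>.fg (\<rho> k) = \<Delta> k" if "k \<in> K" for k
  proof -
    have "\<exists>s. s \<in> carrier KT.MC.T \<and> \<iota>.fg s = \<Delta> k" using ex[OF that] by (auto simp: KM_def \<iota>_def)
    from someI_ex[OF this] have "\<rho> k \<in> carrier KT.MC.T \<and> \<iota>.fg (\<rho> k) = \<Delta> k"
      using that by (simp add: \<rho>_def)
    then show "\<rho> k \<in> carrier KT.MC.T" "\<iota>.fg (\<rho> k) = \<Delta> k" by blast+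
  qed
  have \<rho>_hom: "\<rho> \<in> right_mod_hom A KM ?KC"
  proof (rule mod_homI)
    fix x y assume xy: "x \<in> carrier KM" "y \<in> carrier KM"
    have "\<iota>.fg (\<rho> (x \<oplus>\<^bsub>C\<^esub> y)) = \<iota>.fg (\<rho> x \<oplus>\<^bsub>KT.MC.T\<^esub> \<rho> y)"
      using xy K KC by (simp add: \<rho> \<iota>.map_add add_hom_add[OF \<Delta>_add_hom])
    moreover have "\<rho> (x \<oplus>\<^bsub>C\<^esub> y) \<in> carrier KT.MC.T" "\<rho> x \<oplus>\<^bsub>KT.MC.T\<^esub> \<rho> y \<in> carrier KT.MC.T"
      using xy K \<rho> by simp_all
    ultimately have "\<rho> (x \<oplus>\<^bsub>C\<^esub> y) = \<rho> x \<oplus>\<^bsub>KT.MC.T\<^esub> \<rho> y" by (rule inj_onD[OF inj])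
    then show "\<rho> (x \<oplus>\<^bsub>KM\<^esub> y) = \<rho> x \<oplus>\<^bsub>?KC\<^esub> \<rho> y" by simp
  next
    fix a x assume a: "a \<in> carrier (opp_ring A)" and x: "x \<in> carrier KM"
    have "\<iota>.fg (\<rho> (rsmult C x a)) = \<iota>.fg (a \<odot>\<^bsub>?KC\<^esub> \<rho> x)"
      using a x K KC mod_hom_smult[OF \<iota>C, of a "\<rho> x"] mod_hom_smult[OF \<Delta>_right', of a x] by (simp add: \<rho>)
    moreover have "\<rho> (rsmult C x a) \<in> carrier KT.MC.T"
      using a x K \<rho> by simp
    moreover have "a \<odot>\<^bsub>?KC\<^esub> \<rho> x \<in> carrier KT.MC.T"
      using left_module.smult_closed[OF KCm, of a "\<rho> x"] a x \<rho> by simp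
    ultimately have "\<rho> (rsmult C x a) = a \<odot>\<^bsub>?KC\<^esub> \<rho> x" by (rule inj_onD[OF inj])
    then show "\<rho> (a \<odot>\<^bsub>KM\<^esub> x) = a \<odot>\<^bsub>?KC\<^esub> \<rho> x" by simp
  qed (simp_all add: \<rho>, simp add: \<rho>_def)
  interpret \<rho>1: tensor_mapping A KM C ?KC C \<rho> "\<lambda>c. c"
    by (rule tensor_mapping_hom[OF KM KCm left \<rho>_hom])
  interpret \<Delta>1: tensor_mapping A "rmod C" C ?CC C \<Delta> "\<lambda>c. c"
    by (rule tensor_mapping_\<Delta>_left)
  interpret \<Delta>2: tensor_mapping A "rmod C" C "rmod C" ?BT "\<lambda>x. x" \<Delta>
    by (rule tensor_mapping_\<Delta>_right[OF right])
  interpret \<Delta>K: tensor_mapping A KM C KM ?BT "\<lambda>x. x" \<Delta>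
    by (rule tensor_mapping_\<Delta>_right[OF KM])
  interpret \<iota>CC: tensor_mapping A ?KC C ?CC C \<iota>.fg "\<lambda>c. c"
    by (rule tensor_mapping_hom[OF KCm CCm left \<iota>C])
  interpret \<iota>BT: tensor_mapping A KM ?BT "rmod C" ?BT \<iota> "\<lambda>c. c"
    by (rule tensor_mapping_hom[OF KM right BT \<iota>])
  \<comment> \<open>Both sides are compared in C \<otimes> (C \<otimes> C), into which K \<otimes>
    (C \<otimes> C) embeds because C \<otimes> C is flat.\<close>
  have coassoc_K: "KT.\<alpha> (\<rho>1.fg (\<rho> k)) = \<Delta>K.fg (\<rho> k)" if k: "k \<in> K" for k
  proof -
    have \<rho>k: "\<rho> k \<in> carrier KT.MC.T" using \<rho> k by simp
    have "\<iota>BT.fg (KT.\<alpha> (\<rho>1.fg (\<rho> k))) = CC.\<alpha> (\<iota>CC.fg (\<rho>1.fg (\<rho> k)))"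
    proof (rule KT.MC_D_eqI[OF add_hom_compose[OF KT.\<alpha>_hom \<iota>BT.map_add_hom] add_hom_compose[OF \<iota>CC.map_add_hom CC.\<alpha>_hom]])
      show "\<rho>1.fg (\<rho> k) \<in> carrier KT.T_l" by (rule \<rho>1.map_closed[OF \<rho>k])
      fix m c d assume "m \<in> carrier KM" "c \<in> carrier C" "d \<in> carrier C"
      then show "\<iota>BT.fg (KT.\<alpha> (tens A ?KC C (tens A KM C m c) d)) = CC.\<alpha> (\<iota>CC.fg (tens A ?KC C (tens A KM C m c) d))"
        using KC by (simp add: KT.\<alpha>_tens KT.\<gamma>_tens \<iota>BT.map_tens \<iota>CC.map_tens \<iota>.map_tens CC.\<alpha>_tens CC.\<gamma>_tens)
    qed
    also have "\<iota>CC.fg (\<rho>1.fg (\<rho> k)) = \<Delta>1.fg (\<iota>.fg (\<rho> k))"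
      by (rule KT.MC.hom_eqI[OF add_hom_compose[OF \<rho>1.map_add_hom \<iota>CC.map_add_hom] add_hom_compose[OF \<iota>.map_add_hom \<Delta>1.map_add_hom] \<rho>k])
        (simp add: \<rho>1.map_tens \<iota>CC.map_tens \<iota>.map_tens \<Delta>1.map_tens \<rho> KC)
    also have "CC.\<alpha> (\<Delta>1.fg (\<iota>.fg (\<rho> k))) = \<Delta>2.fg (\<iota>.fg (\<rho> k))"
      using coassoc[OF KC[OF k]] \<rho>(2)[OF k] by simp
    also have "\<Delta>2.fg (\<iota>.fg (\<rho> k)) = \<iota>BT.fg (\<Delta>K.fg (\<rho> k))"
      by (rule KT.MC.hom_eqI[OF add_hom_compose[OF \<iota>.map_add_hom \<Delta>2.map_add_hom] add_hom_compose[OF \<Delta>K.map_add_hom \<iota>BT.map_add_hom] \<rho>k])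
        (simp add: \<iota>BT.map_tens \<Delta>K.map_tens \<iota>.map_tens \<Delta>2.map_tens KC)
    finally have eq: "\<iota>BT.fg (KT.\<alpha> (\<rho>1.fg (\<rho> k))) = \<iota>BT.fg (\<Delta>K.fg (\<rho> k))" .
    have "inj_on \<iota>BT.fg (carrier KT.T_r)"
      using flat_bimod_tensor[OF bimod_axioms bimod_axioms flat flat KM right \<iota> \<iota>_inj]
        add_hom_inj_iff[OF \<iota>BT.map_add_hom KT.M_CD.abelian_T CC.M_CD.abelian_T] by simp
    then show ?thesis
      using eq add_hom_closed[OF KT.\<alpha>_hom \<rho>1.map_closed[OF \<rho>k]] \<Delta>K.map_closed[OF \<rho>k] by (auto dest: inj_onD)
  qed
  have "tensor_lift A KM C KM (\<lambda>x c. rsmult C x (\<epsilon> c)) (\<rho> k) = k" if k: "k \<in> K" for k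
  proof -
    have \<rho>k: "\<rho> k \<in> carrier KT.MC.T" using \<rho> k by simp
    have KMab: "abelian_group KM" by (rule left_module_abelian[OF KM])
    have balK: "balanced A KM C KM (\<lambda>x c. rsmult C x (\<epsilon> c))"
      using K KC by (intro balanced.intro) (simp_all add: rsmult_add rsmult_add_right \<epsilon>_add \<epsilon>_smult rsmult_mult)
    have bal: "balanced A (rmod C) C C (\<lambda>x y. rsmult C x (\<epsilon> y))"
      by (intro balanced.intro) (simp_all add: rsmult_add rsmult_add_right \<epsilon>_add \<epsilon>_smult rsmult_mult)
    have incl: "(\<lambda>x. x) \<in> add_hom KM C" using KC by (intro add_homI) simp_all
    have "tensor_lift A KM C KM (\<lambda>x c. rsmult C x (\<epsilon> c)) (\<rho> k) = tensor_lift A (rmod C) C C (\<lambda>x y. rsmult C x (\<epsilon> y)) (\<iota>.fg (\<rho> k))"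
      by (rule KT.MC.hom_eqI[OF add_hom_compose[OF KT.MC.lift_add_hom[OF KMab balK] incl] add_hom_compose[OF \<iota>.map_add_hom CC.MC.lift_add_hom[OF abelian_C bal]] \<rho>k])
        (simp add: KT.MC.lift_tens[OF KMab balK] \<iota>.map_tens CC.MC.lift_tens[OF abelian_C bal] KC)
    then show ?thesis using right_counit[OF KC[OF k]] \<rho>(2)[OF k] by simp
  qed
  then have "right_comodule A C KM \<rho>"
    unfolding right_comodule_def using KM \<rho>_hom coassoc_K by simp
  moreover have "\<iota> \<in> comod_hom A C KM \<rho> (rmod C) \<Delta>"
    unfolding comod_hom_def using \<iota> \<rho> by simp
  ultimately show ?thesis
    unfolding right_subcomodule_def using sub by (auto simp: KM_def \<iota>_def)
qed

text \<open>Let \<open>L\<close> be the common kernel for the maps treated so far. If k in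
  \<open>L\<close> also satisfies \<phi> f k = 0, then colinearity gives (\<phi> f \<otimes>
  C)(\<Delta> k) = \<Delta>(\<phi> f k) = 0. As \<Delta> k already comes from L \<otimes> C,
  exactness lets it come from the smaller kernel.\<close>

lemma common_kernel_subcomodule:
  assumes flat: "flat_left_module A C" and F: "finite F" "F \<subseteq> carrier S"
    and K: "K = {c \<in> carrier C. \<forall>f\<in>F. \<phi> f c = \<zero>\<^bsub>C\<^esub>}"
  shows "right_subcomodule A C K"
proof -
  let ?M = "rmod C"
  \<comment> \<open>The induction carries only the lifting of \<Delta> k to K \<otimes> C; the
    coaction and its coassociativity are built once, at the end.\<close>
  have "submodule K (opp_ring A) ?M \<and>
    (\<forall>k\<in>K. \<exists>s\<in>carrier (tensor A (?M\<lparr>carrier := K\<rparr>) C).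
      tensor_map A (?M\<lparr>carrier := K\<rparr>) C ?M C (\<lambda>x\<in>K. x) (\<lambda>c. c) s = \<Delta> k)"
    using F K
  proof (induction F arbitrary: K rule: finite_induct)
    case empty
    then have K: "K = carrier C" by simp
    have MK: "?M\<lparr>carrier := K\<rparr> = ?M" by (simp add: K rmod_def)
    have sub: "submodule K (opp_ring A) ?M"
      unfolding K using left_module.smult_closed[OF right] by (intro submoduleI[OF right]) simp_all
    define \<iota> where "\<iota> = (\<lambda>x\<in>K. x)"
    have "\<iota> \<in> right_mod_hom A ?M ?M"
      unfolding \<iota>_def using mod_hom_incl[OF sub] by (simp only: MK)
    then interpret \<iota>: tensor_mapping A ?M C ?M C \<iota> "\<lambda>c. c"
      by (rule tensor_mapping_hom[OF right right left])
    have \<iota>_eq: "\<iota> c = c" if "c \<in> carrier C" for c using that by (simp add: \<iota>_def K)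
    have "\<iota>.fg (\<Delta> k) = (\<lambda>t. t) (\<Delta> k)" if "k \<in> K" for k
      by (rule CC.MC.hom_eqI[OF \<iota>.map_add_hom, where h' = "\<lambda>t. t" and t = "\<Delta> k"])
        (use that in \<open>auto simp: add_hom_def \<iota>.map_tens \<iota>_eq K\<close>)
    then have "\<exists>s\<in>carrier (tensor A ?M C). \<iota>.fg s = \<Delta> k" if "k \<in> K" for k
      using that K by (intro bexI[of _ "\<Delta> k"]) simp_all
    then show ?case using sub unfolding MK \<iota>_def by blast
  next
    case (insert f F)
    define L where "L = {c \<in> carrier C. \<forall>f\<in>F. \<phi> f c = \<zero>\<^bsub>C\<^esub>}"
    have f: "f \<in> carrier S" using insert.prems by simp
    have L: "submodule L (opp_ring A) ?M"
      and exL: "\<And>k. k \<in> L \<Longrightarrow> \<exists>s\<in>carrier (tensor A (?M\<lparr>carrier := L\<rparr>) C).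
        tensor_map A (?M\<lparr>carrier := L\<rparr>) C ?M C (\<lambda>x\<in>L. x) (\<lambda>c. c) s = \<Delta> k"
      using insert.IH[OF _ L_def] insert.prems(1) by blast+
    define LM where "LM = ?M\<lparr>carrier := L\<rparr>"
    define \<iota> where "\<iota> = (\<lambda>x\<in>L. x)"
    define \<psi> where "\<psi> = (\<lambda>x\<in>L. \<phi> f x)"
    have LM: "right_module A LM" unfolding LM_def by (rule left_module_submodule[OF right L])
    have \<iota>: "\<iota> \<in> right_mod_hom A LM ?M" unfolding \<iota>_def LM_def by (rule mod_hom_incl[OF L])
    have \<psi>: "\<psi> \<in> right_mod_hom A LM ?M"
      unfolding \<psi>_def LM_def by (rule mod_hom_carrier_update[OF \<phi>_hom[OF f] L])
    have LC: "x \<in> carrier C" if "x \<in> L" for x using submoduleD(1)[OF L] that by auto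
    have Keq: "K = {x \<in> L. \<psi> x = \<zero>\<^bsub>C\<^esub>}" "K \<subseteq> L"
      unfolding insert.prems(2) by (auto simp: L_def \<psi>_def)
    have Ksub: "submodule K (opp_ring A) ?M"
      using submodule_common_kernel[OF right right, of "\<phi> ` insert f F"] \<phi>_hom insert.prems
      by (auto simp: image_subset_iff subset_iff)
    define KM where "KM = ?M\<lparr>carrier := K\<rparr>"
    have KM: "right_module A KM" unfolding KM_def by (rule left_module_submodule[OF right Ksub])
    have KL: "KM = LM\<lparr>carrier := K\<rparr>" by (simp add: KM_def LM_def)
    define \<kappa> where "\<kappa> = (\<lambda>x\<in>K. x)"
    have \<kappa>L: "\<kappa> \<in> right_mod_hom A KM LM" and \<kappa>M: "\<kappa> \<in> right_mod_hom A KM ?M"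
      using submoduleD[OF Ksub] Keq(2) by (auto intro!: mod_homI simp: \<kappa>_def KM_def LM_def)
    interpret \<phi>: tensor_mapping A ?M C ?M C "\<phi> f" "\<lambda>c. c"
      by (rule tensor_mapping_hom[OF right right left \<phi>_hom[OF f]])
    have "\<exists>s\<in>carrier (tensor A KM C). tensor_map A KM C ?M C \<kappa> (\<lambda>c. c) s = \<Delta> k" if k: "k \<in> K" for k
    proof -
      have kL: "k \<in> L" and kC: "k \<in> carrier C" and \<phi>k: "\<phi> f k = \<zero>\<^bsub>C\<^esub>"
        using k Keq LC by (auto simp: \<psi>_def)
      obtain s where s: "s \<in> carrier (tensor A LM C)" "tensor_map A LM C ?M C \<iota> (\<lambda>c. c) s = \<Delta> k"
        using exL[OF kL] unfolding LM_def \<iota>_def by blast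
      have "tensor_map A LM C ?M C \<psi> (\<lambda>c. c) s = \<phi>.fg (tensor_map A LM C ?M C \<iota> (\<lambda>c. c) s)"
        by (rule tensor_map_compose[OF LM right right left \<iota> \<phi>_hom[OF f] \<psi> _ s(1), symmetric])
          (simp add: LM_def \<psi>_def \<iota>_def)
      also have "\<dots> = \<Delta> (\<phi> f k)"
        using \<phi>_comod_End[OF f] s(2) kC by (simp add: comod_End_def comod_hom_def)
      also have "\<dots> = \<zero>\<^bsub>CC.MC.T\<^esub>"
        unfolding \<phi>k by (rule add_hom_zero[OF \<Delta>_add_hom abelian_C CC.MC.abelian_T])
      \<comment> \<open>Exactness is applied to \<psi>, the restriction of \<phi> f to
        \<open>L\<close>, whose kernel is \<open>K\<close>.\<close>
      finally obtain r where r: "r \<in> carrier (tensor A KM C)" "tensor_map A KM C LM C \<kappa> (\<lambda>c. c) r = s"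
        using tensor_map_kernel[OF flat LM right \<psi> _ s(1), of K] Keq(1) unfolding KL \<kappa>_def
        by (auto simp: LM_def)
      have "\<kappa> m = \<iota> (\<kappa> m)" if "m \<in> carrier KM" for m
        using that Keq(2) by (auto simp: \<kappa>_def \<iota>_def KM_def)
      then have "tensor_map A KM C ?M C \<kappa> (\<lambda>c. c) r = \<Delta> k"
        using tensor_map_compose[OF KM LM right left \<kappa>L \<iota> \<kappa>M _ r(1)] s(2) r(2) by simp
      then show ?thesis using r(1) by blast
    qed
    then show ?case using Ksub unfolding KM_def \<kappa>_def by blast
  qed
  then show ?thesis using right_subcomoduleI[OF flat] by blast
qed

end

section \<open>The duality between fully invariant subcomodules and ideals\<close>

locale qf_coring = coring_dual A C
  for A :: "('a, 'k) ring_scheme" (structure) and C :: "('a, 'c, 'm) coring_scheme" +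
  assumes qf: "qf_ring A" and flat: "flat_left_module A C"
    and noetherian: "right_noetherian (dual_ring A C)"
begin

section \<open>Annihilators in the coring and in its dual\<close>

abbreviation "perp \<equiv> perp_dual A C"
abbreviation "coperp \<equiv> perp_coring A C"

text \<open>The noetherian hypothesis includes, by its definition, that the opposite of the dual is
  a ring; taking opposites once more returns \<open>S\<close>.\<close>

lemma ring_S: "ring S"
  using noetherian ring_opp_ring[of "opp_ring S"] by (simp add: right_noetherian_def left_noetherian_def)

sublocale S: ring S by (rule ring_S)

lemma dual_zero_right: "f \<in> carrier S \<Longrightarrow> f \<zero>\<^bsub>C\<^esub> = \<zero>"
  by (rule add_hom_zero[OF dual_add_hom abelian_C abelian_A])

lemma zero_apply: "c \<in> carrier C \<Longrightarrow> \<zero>\<^bsub>S\<^esub> c = \<zero>"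
  by (simp add: dual_zero)

lemma submodule_zero: "submodule {\<zero>\<^bsub>C\<^esub>} (opp_ring A) (rmod C)"
  using smult_zero_right[OF right] by (intro submoduleI[OF right]) auto

lemma perp_perp_coring:
  assumes X: "submodule X (opp_ring A) (rmod C)"
  shows "coperp (perp X) = X"
proof
  show "X \<subseteq> coperp (perp X)"
    using submoduleD(1)[OF X] by (auto simp: perp_coring_def perp_dual_def)
  show "coperp (perp X) \<subseteq> X"
  proof
    fix c assume c: "c \<in> coperp (perp X)"
    show "c \<in> X"
    proof (rule ccontr)
      assume "c \<notin> X"
      then obtain f where "f \<in> carrier S" "\<forall>x\<in>X. f x = \<zero>" "f c \<noteq> \<zero>"
        using qf_separation[OF qf right X, of c] c unfolding dual_carrier by (auto simp: perp_coring_def)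
      then show False using c by (auto simp: perp_coring_def perp_dual_def)
    qed
  qed
qed

text \<open>The zero submodule equals its double annihilator, so c - d is zero once every functional
  kills it.\<close>

lemma separate_points:
  assumes "c \<in> carrier C" "d \<in> carrier C" "\<And>g. g \<in> carrier S \<Longrightarrow> g c = g d"
  shows "c = d"
proof -
  have "g (c \<ominus>\<^bsub>C\<^esub> d) = \<zero>" if "g \<in> carrier S" for g
    using add_hom_diff[OF dual_add_hom[OF that] abelian_C abelian_A assms(1,2)] assms that
      abelian_group.minus_eq_zero_iff[OF abelian_A] by simp
  then have "c \<ominus>\<^bsub>C\<^esub> d \<in> coperp (perp {\<zero>\<^bsub>C\<^esub>})"
    using assms abelian_group.minus_closed[OF abelian_C] by (auto simp: perp_coring_def perp_dual_def)
  then show ?thesis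
    using perp_perp_coring[OF submodule_zero] assms by (simp add: abelian_group.minus_eq_zero_iff[OF abelian_C])
qed

text \<open>As (fg)(c) = g(\<phi> f c), the hypothesis says that every functional kills \<phi> f c.
  Properties of \<phi> can thus be read off from the ring laws of the dual.\<close>

lemma \<phi>_zeroI:
  assumes "c \<in> carrier C" "f \<in> carrier S" "\<And>g. g \<in> carrier S \<Longrightarrow> (f \<otimes>\<^bsub>S\<^esub> g) c = \<zero>"
  shows "\<phi> f c = \<zero>\<^bsub>C\<^esub>"
proof (rule separate_points)
  show "\<zero>\<^bsub>C\<^esub> \<in> carrier C" by (rule abelian_groupE(2)[OF abelian_C])
  show "g (\<phi> f c) = g \<zero>\<^bsub>C\<^esub>" if "g \<in> carrier S" for g
    using assms(3)[OF that] dual_mult[OF assms(2) that assms(1)] dual_zero_right[OF that] by simp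
qed (use assms in simp)

text \<open>Serves to pass from generators to a whole right ideal: once this right ideal contains a
  generating set of I, it contains I. Its closure properties are distributivity and associativity in
  the dual, seen through \<open>\<phi>_zeroI\<close>.\<close>

lemma annihilator_right_ideal:
  assumes c: "c \<in> carrier C"
  shows "submodule {g \<in> carrier S. \<phi> g c = \<zero>\<^bsub>C\<^esub>} (opp_ring S) (right_regular_module S)"
proof (rule submoduleI)
  show "left_module (opp_ring S) (right_regular_module S)"
    by (rule left_module_regular[OF ring_opp_ring[OF ring_S]])
  have "\<phi> \<zero>\<^bsub>S\<^esub> c = \<zero>\<^bsub>C\<^esub>" using c by (intro \<phi>_zeroI) (simp_all add: zero_apply)
  then show "\<zero>\<^bsub>right_regular_module S\<^esub> \<in> {g \<in> carrier S. \<phi> g c = \<zero>\<^bsub>C\<^esub>}" by simp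
next
  fix f g assume "f \<in> {g \<in> carrier S. \<phi> g c = \<zero>\<^bsub>C\<^esub>}" "g \<in> {g \<in> carrier S. \<phi> g c = \<zero>\<^bsub>C\<^esub>}"
  then have fg: "f \<in> carrier S" "g \<in> carrier S" "\<phi> f c = \<zero>\<^bsub>C\<^esub>" "\<phi> g c = \<zero>\<^bsub>C\<^esub>" by auto
  have "\<phi> (f \<oplus>\<^bsub>S\<^esub> g) c = \<zero>\<^bsub>C\<^esub>"
  proof (rule \<phi>_zeroI[OF c])
    fix h assume "h \<in> carrier S"
    then have "((f \<oplus>\<^bsub>S\<^esub> g) \<otimes>\<^bsub>S\<^esub> h) c = h (\<phi> f c) \<oplus> h (\<phi> g c)"
      using c fg by (simp add: S.l_distr dual_add_apply dual_mult)
    then show "((f \<oplus>\<^bsub>S\<^esub> g) \<otimes>\<^bsub>S\<^esub> h) c = \<zero>"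
      using fg \<open>h \<in> carrier S\<close> abelian_groupE(2,5)[OF abelian_A] by (simp add: dual_zero_right)
  qed (use fg in simp)
  then show "f \<oplus>\<^bsub>right_regular_module S\<^esub> g \<in> {g \<in> carrier S. \<phi> g c = \<zero>\<^bsub>C\<^esub>}" using fg by simp
next
  fix h g assume h: "h \<in> carrier (opp_ring S)" and "g \<in> {g \<in> carrier S. \<phi> g c = \<zero>\<^bsub>C\<^esub>}"
  then have g: "g \<in> carrier S" "\<phi> g c = \<zero>\<^bsub>C\<^esub>" by auto
  have "\<phi> (g \<otimes>\<^bsub>S\<^esub> h) c = \<zero>\<^bsub>C\<^esub>"
  proof (rule \<phi>_zeroI[OF c])
    fix k assume k: "k \<in> carrier S"
    then have "((g \<otimes>\<^bsub>S\<^esub> h) \<otimes>\<^bsub>S\<^esub> k) c = (h \<otimes>\<^bsub>S\<^esub> k) (\<phi> g c)"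
      using c g h S.m_closed[of h k] by (simp add: S.m_assoc dual_mult)
    then show "((g \<otimes>\<^bsub>S\<^esub> h) \<otimes>\<^bsub>S\<^esub> k) c = \<zero>"
      using g h k by (simp add: dual_zero_right)
  qed (use g h in simp)
  then show "h \<odot>\<^bsub>right_regular_module S\<^esub> g \<in> {g \<in> carrier S. \<phi> g c = \<zero>\<^bsub>C\<^esub>}" using g h by simp
qed auto

text \<open>\<open>F\<close> generates I as a right ideal. If I kills c, then so do all products fg
  with f in \<open>F\<close>, and \<phi> f c = 0 by separation of points. Conversely the right ideal
  of all g with \<phi> g c = 0 contains \<open>F\<close>, hence I, and applying \<epsilon> gives g c
  = 0.\<close>

lemma perp_coring_finite:
  assumes I: "ideal I S"
  shows "\<exists>F. finite F \<and> F \<subseteq> I \<and> coperp I = {c \<in> carrier C. \<forall>f\<in>F. \<phi> f c = \<zero>\<^bsub>C\<^esub>}"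
proof -
  interpret I: ideal I S by (rule I)
  have R: "left_module (opp_ring S) (right_regular_module S)"
    by (rule left_module_regular[OF ring_opp_ring[OF ring_S]])
  have "submodule I (opp_ring S) (right_regular_module S)"
    by (intro submoduleI[OF R]) (auto simp: I.I_r_closed I.Icarr)
  then obtain F where F: "F \<subseteq> carrier S" "finite F"
    "I = \<Inter>{J. submodule J (opp_ring S) (right_regular_module S) \<and> F \<subseteq> J}"
    using noetherian unfolding right_noetherian_def left_noetherian_def opp_ring_simps(1) by blast
  have FI: "F \<subseteq> I" unfolding F(3) by (rule Inter_greatest) simp
  have "coperp I = {c \<in> carrier C. \<forall>f\<in>F. \<phi> f c = \<zero>\<^bsub>C\<^esub>}"
  proof (intro equalityI subsetI)
    fix c assume c: "c \<in> coperp I"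
    have "\<phi> f c = \<zero>\<^bsub>C\<^esub>" if "f \<in> F" for f
      using that FI c I.I_r_closed I.Icarr by (intro \<phi>_zeroI) (auto simp: perp_coring_def)
    then show "c \<in> {c \<in> carrier C. \<forall>f\<in>F. \<phi> f c = \<zero>\<^bsub>C\<^esub>}" using c by (simp add: perp_coring_def)
  next
    fix c assume c: "c \<in> {c \<in> carrier C. \<forall>f\<in>F. \<phi> f c = \<zero>\<^bsub>C\<^esub>}"
    then have "I \<subseteq> {g \<in> carrier S. \<phi> g c = \<zero>\<^bsub>C\<^esub>}"
      using annihilator_right_ideal[of c] F(1,3) by blast
    then have "f c = \<zero>" if "f \<in> I" for f
      using that c \<epsilon>_\<phi>[of f c] dual_zero_right[OF \<epsilon>_dual] by auto
    then show "c \<in> coperp I" using c by (simp add: perp_coring_def)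
  qed
  then show ?thesis using F(2) FI by blast
qed

section \<open>The bijection between ideals and fully invariant subcomodules\<close>

lemma fully_invariant_submodule:
  "fully_invariant A C X \<Longrightarrow> submodule X (opp_ring A) (rmod C)"
  by (simp add: fully_invariant_def right_subcomodule_def)

lemma fully_invariant_carrier: "fully_invariant A C X \<Longrightarrow> x \<in> X \<Longrightarrow> x \<in> carrier C"
  using submoduleD(1)[OF fully_invariant_submodule] by auto

text \<open>The two sides of the ideal play different roles: right generators present the set as a
  finite common kernel, hence a subcomodule, while closure under left multiplication gives
  invariance through f(\<phi> g c) = (gf)(c) = 0.\<close>

lemma fully_invariant_perp_coring:
  assumes I: "ideal I S"
  shows "fully_invariant A C (coperp I)"
proof -
  interpret I: ideal I S by (rule I)
  obtain F where F: "finite F" "F \<subseteq> I" "coperp I = {c \<in> carrier C. \<forall>f\<in>F. \<phi> f c = \<zero>\<^bsub>C\<^esub>}"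
    using perp_coring_finite[OF I] by blast
  then have "F \<subseteq> carrier S" using I.Icarr by blast
  then have "right_subcomodule A C (coperp I)"
    by (rule common_kernel_subcomodule[OF flat F(1) _ F(3)])
  moreover have "\<phi> g c \<in> coperp I" if "g \<in> carrier S" "c \<in> coperp I" for g c
  proof -
    have c: "c \<in> carrier C" "\<And>f. f \<in> I \<Longrightarrow> f c = \<zero>" using that by (simp_all add: perp_coring_def)
    have "f (\<phi> g c) = \<zero>" if "f \<in> I" for f
      using c(2)[OF I.I_l_closed[OF that \<open>g \<in> carrier S\<close>]]
        dual_mult[OF \<open>g \<in> carrier S\<close> I.Icarr[OF that] c(1)] by simp
    then show ?thesis using c(1) \<open>g \<in> carrier S\<close> by (simp add: perp_coring_def)
  qed
  ultimately show ?thesis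
    unfolding fully_invariant_def comod_End_eq by auto
qed

text \<open>A functional vanishing on the common kernel of finitely many \<phi> h with h in I is, by
  injectivity of \<open>A\<close>, a sum of maps g \<circ> \<phi> h. Each of these is the product
  hg, which lies in I because I is a right ideal.\<close>

lemma perp_perp_dual:
  assumes I: "ideal I S"
  shows "perp (coperp I) = I"
proof
  interpret I: ideal I S by (rule I)
  show "I \<subseteq> perp (coperp I)"
    using I.Icarr by (auto simp: perp_coring_def perp_dual_def)
  obtain F where F: "finite F" "F \<subseteq> I" "coperp I = {c \<in> carrier C. \<forall>f\<in>F. \<phi> f c = \<zero>\<^bsub>C\<^esub>}"
    using perp_coring_finite[OF I] by blast
  have FS: "f \<in> carrier S" if "f \<in> F" for f using that F(2) I.Icarr by blast
  have inj: "injective_module (opp_ring A) (right_regular_module A)"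
    using qf by (simp add: qf_ring_def)
  show "perp (coperp I) \<subseteq> I"
  proof
    fix f assume f: "f \<in> perp (coperp I)"
    show "f \<in> I"
    proof (rule injective_factor[OF inj right, where F = "\<phi> ` F"])
      show "finite (\<phi> ` F)" using F by simp
      show "\<phi> ` F \<subseteq> right_mod_hom A (rmod C) (rmod C)" using FS \<phi>_hom by blast
      show "f \<in> right_mod_hom A (rmod C) (right_regular_module A)"
        using f by (simp add: perp_dual_def dual_carrier)
      show "(\<lambda>x\<in>carrier (rmod C). \<zero>\<^bsub>right_regular_module A\<^esub>) \<in> I"
        using I.zero_closed by (simp add: dual_zero)
      show "(\<lambda>x\<in>carrier (rmod C). g x \<oplus>\<^bsub>right_regular_module A\<^esub> h x) \<in> I" if "g \<in> I" "h \<in> I" for g h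
        using I.a_closed[OF that] by (simp add: dual_ring_def)
    next
      fix x assume x: "x \<in> carrier (rmod C)" and "\<And>\<psi>. \<psi> \<in> \<phi> ` F \<Longrightarrow> \<psi> x = \<zero>\<^bsub>rmod C\<^esub>"
      then have "\<forall>g\<in>F. \<phi> g x = \<zero>\<^bsub>C\<^esub>" by auto
      then have "x \<in> coperp I" using x F(3) by simp
      then show "f x = \<zero>\<^bsub>right_regular_module A\<^esub>" using f by (simp add: perp_dual_def)
    next
      fix \<psi> g assume "\<psi> \<in> \<phi> ` F" and g: "g \<in> right_mod_hom A (rmod C) (right_regular_module A)"
      then obtain h where h: "\<psi> = \<phi> h" "h \<in> F" by blast
      have gS: "g \<in> carrier S" using g by (simp add: dual_carrier)
      have "h \<otimes>\<^bsub>S\<^esub> g = (\<lambda>x\<in>carrier C. g (\<phi> h x))"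
      proof
        fix x
        show "(h \<otimes>\<^bsub>S\<^esub> g) x = (\<lambda>x\<in>carrier C. g (\<phi> h x)) x"
          using dual_mult[OF FS[OF h(2)] gS, of x] dual_undefined[OF S.m_closed[OF FS[OF h(2)] gS], of x]
          by (cases "x \<in> carrier C") simp_all
      qed
      moreover have "h \<otimes>\<^bsub>S\<^esub> g \<in> I" using I.I_r_closed h F(2) gS by blast
      ultimately show "(\<lambda>x\<in>carrier (rmod C). g (\<psi> x)) \<in> I" unfolding h(1) by simp
    qed
  qed
qed

text \<open>Invariance of \<open>X\<close> under all \<phi> g gives closure under left
  multiplication. The subcomodule property makes \<phi> f vanish on \<open>X\<close> for f in the
  annihilator, which gives closure under right multiplication.\<close>

lemma ideal_perp_dual:
  assumes X: "fully_invariant A C X"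
  shows "ideal (perp X) S"
proof -
  note XC = fully_invariant_carrier[OF X]
  have sub: "right_subcomodule A C X" and inv: "\<And>g x. g \<in> carrier S \<Longrightarrow> x \<in> X \<Longrightarrow> \<phi> g x \<in> X"
    using X unfolding fully_invariant_def comod_End_eq by auto
  have l: "g \<otimes>\<^bsub>S\<^esub> f \<in> perp X" if "f \<in> perp X" "g \<in> carrier S" for f g
    using that inv XC by (auto simp: perp_dual_def dual_mult)
  have r: "f \<otimes>\<^bsub>S\<^esub> g \<in> perp X" if "f \<in> perp X" "g \<in> carrier S" for f g
    using that subcomodule_\<phi>_zero[OF sub, of f] XC by (auto simp: perp_dual_def dual_mult dual_zero_right)
  \<comment> \<open>Negation is left multiplication by -1, so it is covered by the closure already
    shown.\<close>
  have neg: "\<ominus>\<^bsub>S\<^esub> f \<in> perp X" if "f \<in> perp X" for f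
    using l[OF that, of "\<ominus>\<^bsub>S\<^esub> \<one>\<^bsub>S\<^esub>"] that by (simp add: S.l_minus perp_dual_def)
  have "subgroup (perp X) (add_monoid S)"
  proof (rule S.add.subgroupI)
    show "perp X \<subseteq> carrier S" by (auto simp: perp_dual_def)
    have "\<zero>\<^bsub>S\<^esub> \<in> perp X" using XC by (auto simp: perp_dual_def zero_apply)
    then show "perp X \<noteq> {}" by blast
    show "f \<oplus>\<^bsub>S\<^esub> g \<in> perp X" if "f \<in> perp X" "g \<in> perp X" for f g
      using that XC abelian_groupE(2,5)[OF abelian_A] by (auto simp: perp_dual_def dual_add_apply)
  qed (rule neg)
  then show ?thesis using l r by (intro idealI[OF ring_S])
qed

section \<open>Inclusions, colons and primality under the bijection\<close>

lemma subset_iff_perp_dual: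
  assumes "fully_invariant A C B" "fully_invariant A C X"
  shows "B \<subseteq> X \<longleftrightarrow> perp X \<subseteq> perp B"
proof
  show "B \<subseteq> X \<Longrightarrow> perp X \<subseteq> perp B" by (auto simp: perp_dual_def)
  assume "perp X \<subseteq> perp B"
  then have "coperp (perp B) \<subseteq> coperp (perp X)"
    by (auto simp: perp_coring_def)
  then show "B \<subseteq> X" using assms by (simp add: perp_perp_coring fully_invariant_submodule)
qed

text \<open>An endomorphism \<phi> f vanishes on \<open>X\<close> exactly when f does, and \<phi> f
  c lies in \<open>Y\<close> exactly when every g in the annihilator of \<open>Y\<close> kills it.
  So c lies in (X : Y) exactly when all the products fg kill c. Sums of such products add nothing,
  as the annihilator of \<open>B\<close> is an ideal.\<close>

lemma subset_colon_iff:
  assumes B: "fully_invariant A C B" and X: "fully_invariant A C X" and Y: "fully_invariant A C Y"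
  shows "B \<subseteq> subcomodule_colon A C X Y \<longleftrightarrow> perp X \<cdot>\<^bsub>S\<^esub> perp Y \<subseteq> perp B"
proof -
  have sub: "right_subcomodule A C X" using X by (simp add: fully_invariant_def)
  have van: "\<phi> f ` X \<subseteq> {\<zero>\<^bsub>C\<^esub>} \<longleftrightarrow> f \<in> perp X" if "f \<in> carrier S" for f
  proof
    assume *: "\<phi> f ` X \<subseteq> {\<zero>\<^bsub>C\<^esub>}"
    have "f x = \<zero>" if "x \<in> X" for x
      using * that \<epsilon>_\<phi>[OF \<open>f \<in> carrier S\<close> fully_invariant_carrier[OF X that]] dual_zero_right[OF \<epsilon>_dual] by auto
    then show "f \<in> perp X" using that by (simp add: perp_dual_def)
  next
    assume "f \<in> perp X"
    then show "\<phi> f ` X \<subseteq> {\<zero>\<^bsub>C\<^esub>}" using subcomodule_\<phi>_zero[OF sub that] by (auto simp: perp_dual_def)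
  qed
  have Y_iff: "y \<in> Y \<longleftrightarrow> (\<forall>g\<in>perp Y. g y = \<zero>)" if "y \<in> carrier C" for y
    using perp_perp_coring[OF fully_invariant_submodule[OF Y]] that by (auto simp: perp_coring_def)
  have colon: "c \<in> subcomodule_colon A C X Y \<longleftrightarrow>
      (\<forall>f\<in>perp X. \<forall>g\<in>perp Y. (f \<otimes>\<^bsub>S\<^esub> g) c = \<zero>)" if c: "c \<in> carrier C" for c
  proof -
    have "c \<in> subcomodule_colon A C X Y \<longleftrightarrow> (\<forall>f\<in>carrier S. \<phi> f ` X \<subseteq> {\<zero>\<^bsub>C\<^esub>} \<longrightarrow> \<phi> f c \<in> Y)"
      unfolding subcomodule_colon_def comod_End_eq using c by auto
    also have "\<dots> \<longleftrightarrow> (\<forall>f\<in>perp X. \<phi> f c \<in> Y)"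
      using van by (auto simp: perp_dual_def)
    also have "\<dots> \<longleftrightarrow> (\<forall>f\<in>perp X. \<forall>g\<in>perp Y. g (\<phi> f c) = \<zero>)"
      using c by (intro ball_cong refl Y_iff) (auto simp: perp_dual_def)
    also have "\<dots> \<longleftrightarrow> (\<forall>f\<in>perp X. \<forall>g\<in>perp Y. (f \<otimes>\<^bsub>S\<^esub> g) c = \<zero>)"
      using c by (intro ball_cong refl) (auto simp: perp_dual_def dual_mult)
    finally show ?thesis .
  qed
  show ?thesis
  proof
    assume *: "B \<subseteq> subcomodule_colon A C X Y"
    show "perp X \<cdot>\<^bsub>S\<^esub> perp Y \<subseteq> perp B"
    proof
      fix s assume "s \<in> perp X \<cdot>\<^bsub>S\<^esub> perp Y"
      then show "s \<in> perp B"
      proof induction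
        case (prod i j)
        then have "(i \<otimes>\<^bsub>S\<^esub> j) b = \<zero>" if "b \<in> B" for b
          using colon[OF fully_invariant_carrier[OF B that]] * that by blast
        moreover have "i \<otimes>\<^bsub>S\<^esub> j \<in> carrier S" using prod by (intro S.m_closed) (auto simp: perp_dual_def)
        ultimately show ?case by (simp add: perp_dual_def)
      next
        case (sum s1 s2)
        interpret I: ideal "perp B" S by (rule ideal_perp_dual[OF B])
        show ?case using sum by (intro I.a_closed)
      qed
    qed
  next
    assume *: "perp X \<cdot>\<^bsub>S\<^esub> perp Y \<subseteq> perp B"
    show "B \<subseteq> subcomodule_colon A C X Y"
    proof
      fix b assume b: "b \<in> B"
      have "(f \<otimes>\<^bsub>S\<^esub> g) b = \<zero>" if "f \<in> perp X" "g \<in> perp Y" for f g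
        using ideal_prod.prod[OF that, of S] * b by (auto simp: perp_dual_def)
      then show "b \<in> subcomodule_colon A C X Y"
        using colon[OF fully_invariant_carrier[OF B b]] by blast
    qed
  qed
qed

text \<open>Matches the two nontriviality clauses: a coprime subcomodule is nonzero, a prime ideal
  is proper. The double annihilator reduces this to the zero submodule, which is annihilated by the
  whole dual.\<close>

lemma perp_dual_eq_carrier_iff:
  assumes B: "fully_invariant A C B"
  shows "perp B = carrier S \<longleftrightarrow> B = {\<zero>\<^bsub>C\<^esub>}"
proof -
  have *: "perp {\<zero>\<^bsub>C\<^esub>} = carrier S"
    by (auto simp: perp_dual_def dual_zero_right)
  then show ?thesis
    using perp_perp_coring[OF fully_invariant_submodule[OF B]] perp_perp_coring[OF submodule_zero] by metis
qed

text \<open>The quantifiers over pairs X, Y and over pairs I, J run through the same data: every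
  ideal is the annihilator of a fully invariant subcomodule, every annihilator of such a subcomodule
  is an ideal, and inclusions are reversed.\<close>

lemma fully_coprime_iff:
  "fully_coprime A C B \<longleftrightarrow> fully_invariant A C B \<and> prime_ideal S (perp B)"
proof (cases "fully_invariant A C B")
  case B: True
  have "(\<forall>X Y. fully_invariant A C X \<and> fully_invariant A C Y \<and> B \<subseteq> subcomodule_colon A C X Y
        \<longrightarrow> B \<subseteq> X \<or> B \<subseteq> Y) \<longleftrightarrow>
    (\<forall>I J. ideal I S \<and> ideal J S \<and> I \<cdot>\<^bsub>S\<^esub> J \<subseteq> perp B \<longrightarrow> I \<subseteq> perp B \<or> J \<subseteq> perp B)"
    (is "?l \<longleftrightarrow> ?r")
  proof
    assume l: ?l
    show ?r
    proof (intro allI impI, elim conjE)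
      fix I J assume I: "ideal I S" and J: "ideal J S" and "I \<cdot>\<^bsub>S\<^esub> J \<subseteq> perp B"
      note X = fully_invariant_perp_coring[OF I] and Y = fully_invariant_perp_coring[OF J]
      have "B \<subseteq> subcomodule_colon A C (coperp I) (coperp J)"
        using subset_colon_iff[OF B X Y] I J \<open>I \<cdot>\<^bsub>S\<^esub> J \<subseteq> _\<close> by (simp add: perp_perp_dual)
      then have "B \<subseteq> coperp I \<or> B \<subseteq> coperp J" using l X Y by blast
      then show "I \<subseteq> perp B \<or> J \<subseteq> perp B"
        using subset_iff_perp_dual[OF B X] subset_iff_perp_dual[OF B Y] I J by (simp add: perp_perp_dual)
    qed
  next
    assume r: ?r
    show ?l
      using r ideal_perp_dual subset_colon_iff[OF B] subset_iff_perp_dual[OF B] by meson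
  qed
  then show ?thesis
    using B ideal_perp_dual[OF B] perp_dual_eq_carrier_iff[OF B]
    unfolding fully_coprime_def prime_ideal_def by blast
qed (simp add: fully_coprime_def)

lemma prime_ideal_eq_perp_dual:
  "prime_ideal S P \<longleftrightarrow> (\<exists>B. fully_coprime A C B \<and> P = perp B)"
proof
  assume P: "prime_ideal S P"
  then have I: "ideal P S" by (simp add: prime_ideal_def)
  then show "\<exists>B. fully_coprime A C B \<and> P = perp B"
    using P by (intro exI[of _ "coperp P"]) (simp add: fully_coprime_iff perp_perp_dual fully_invariant_perp_coring)
qed (auto simp: fully_coprime_iff)

section \<open>The coprime coradical and the prime radical\<close>

lemma coprime_carrier: "\<Union>{B. fully_coprime A C B} \<subseteq> carrier C"
  using fully_invariant_carrier by (auto simp: fully_coprime_def)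

text \<open>The coradical is defined only as a generated additive subgroup. The double annihilator
  theorem asks for a right submodule, so closure under the action of \<open>A\<close> is proved by
  induction on generation, starting from the coprime subcomodules.\<close>

lemma CPcorad_submodule: "submodule (CPcorad A C) (opp_ring A) (rmod C)"
proof -
  let ?U = "\<Union>{B. fully_coprime A C B}"
  have U: "?U \<subseteq> carrier (add_monoid C)" using coprime_carrier by simp
  have cl: "x \<in> carrier C" if "x \<in> CPcorad A C" for x
    using group.generate_in_carrier[OF abelian_group.a_group[OF abelian_C] U] that by (simp add: CPcorad_def)
  have U_smult: "rsmult C x a \<in> ?U" if "x \<in> ?U" "a \<in> carrier A" for x a
    using that submoduleD(5)[OF fully_invariant_submodule, of _ a x] by (auto simp: fully_coprime_def)
  have smult: "rsmult C x a \<in> CPcorad A C" if "x \<in> CPcorad A C" and a: "a \<in> carrier A" for x a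
    using that(1) unfolding CPcorad_def
  proof induction
    case one
    then show ?case
      using smult_zero_right[OF right, of a] a generate.one[of "add_monoid C" ?U] by simp
  next
    case (incl h)
    then show ?case using U_smult a by (blast intro: generate.incl)
  next
    case (inv h)
    then have "h \<in> carrier C" using U by auto
    then have "rsmult C (inv\<^bsub>add_monoid C\<^esub> h) a = inv\<^bsub>add_monoid C\<^esub> (rsmult C h a)"
      using add_hom_minus[of "\<lambda>c. rsmult C c a" C C h] abelian_C a rsmult_add
      by (simp add: add_homI a_inv_def)
    then show ?case using U_smult[OF inv a] by (auto intro: generate.inv)
  next
    case (eng x y)
    then have "x \<in> carrier C" "y \<in> carrier C" using cl by (simp_all add: CPcorad_def)
    then show ?case using eng.IH a generate.eng[OF eng.IH] by (simp add: rsmult_add)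
  qed
  show ?thesis
  proof (rule submoduleI[OF right])
    show "CPcorad A C \<subseteq> carrier (rmod C)" using cl by auto
    show "\<zero>\<^bsub>rmod C\<^esub> \<in> CPcorad A C"
      using generate.one[of "add_monoid C" ?U] by (simp add: CPcorad_def)
    show "x \<oplus>\<^bsub>rmod C\<^esub> y \<in> CPcorad A C" if "x \<in> CPcorad A C" "y \<in> CPcorad A C" for x y
      using generate.eng[of x "add_monoid C" ?U y] that by (simp add: CPcorad_def)
  qed (use smult in simp)
qed

text \<open>A functional is additive, so it vanishes on the generated subgroup as soon as it
  vanishes on each coprime subcomodule.\<close>

lemma perp_dual_CPcorad:
  "perp (CPcorad A C) = {f \<in> carrier S. \<forall>B. fully_coprime A C B \<longrightarrow> f \<in> perp B}"
proof -
  let ?U = "\<Union>{B. fully_coprime A C B}"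
  have "(\<forall>c\<in>CPcorad A C. f c = \<zero>) \<longleftrightarrow> (\<forall>c\<in>?U. f c = \<zero>)" if f: "f \<in> carrier S" for f
  proof
    assume *: "\<forall>c\<in>?U. f c = \<zero>"
    have "c \<in> carrier C \<and> f c = \<zero>" if "c \<in> CPcorad A C" for c
      using that unfolding CPcorad_def
    proof induction
      case one
      then show ?case using dual_zero_right[OF f] by simp
    next
      case (incl h)
      then show ?case using * coprime_carrier by auto
    next
      case (inv h)
      then have h: "h \<in> carrier C" "f h = \<zero>" using * coprime_carrier by auto
      then have "f (\<ominus>\<^bsub>C\<^esub> h) = \<zero>"
        using add_hom_minus[OF dual_add_hom[OF f] abelian_C abelian_A h(1)]
          abelian_group.minus_eq_zero_iff[OF abelian_A, of "\<zero>" "\<zero>"] abelian_groupE(2)[OF abelian_A]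
        by (simp add: abelian_group.minus_equality[OF abelian_A] abelian_groupE(5)[OF abelian_A])
      then show ?case using h by (simp flip: a_inv_def)
    next
      case (eng x y)
      then show ?case using f abelian_groupE(2,5)[OF abelian_A] by (simp add: dual_add)
    qed
    then show "\<forall>c\<in>CPcorad A C. f c = \<zero>" by blast
  qed (auto simp: CPcorad_def intro: generate.incl)
  then show ?thesis by (auto simp: perp_dual_def)
qed

text \<open>Both sides are intersections of the same family of ideals, taken inside
  \<open>carrier S\<close>, so an empty family would give the whole dual on either side.\<close>

lemma Prad_eq: "Prad S = perp (CPcorad A C)"
  unfolding perp_dual_CPcorad Prad_def prime_ideal_eq_perp_dual by blast

lemma CPcorad_eq: "CPcorad A C = coperp (Prad S)"
  unfolding Prad_eq by (rule perp_perp_coring[OF CPcorad_submodule, symmetric])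

end

theorem proposition5p22:
  fixes R :: "('r, 'k) ring_scheme"
    and A :: "('r, 'a, 'l) module_scheme"
    and C :: "('a, 'c, 'm) coring_scheme"
  assumes "cring R" and "\<one>\<^bsub>R\<^esub> \<noteq> \<zero>\<^bsub>R\<^esub>"
    and "unital_algebra R A"
    and "qf_ring A"
    and "coring R A C" and "carrier C \<noteq> {\<zero>\<^bsub>C\<^esub>}"
    and "flat_left_module A C"
    and "right_noetherian (dual_ring A C)"
  shows "Prad (dual_ring A C) = perp_dual A C (CPcorad A C)
    \<and> CPcorad A C = perp_coring A C (Prad (dual_ring A C))"
proof -
  interpret qf_coring A C
    using assms by (intro qf_coring.intro qf_coring_axioms.intro coring_dualI)
  show ?thesis using Prad_eq CPcorad_eq by blast
qed

end
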